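(* Consider the dyadic regression model with graphon missingness, the node split $D_1,D_2$, and the weighted conformal set $\widehat C^{\mathrm{weighted}}_{kl}$ at level $\alpha\in(0,1)$, all as defined in the context. Suppose that: (a) $w(x,y)\ge c>0$ and $\hat p_{ij}/\rho_n\ge c>0$ for some $c>0$; (b) $\rho_n=\omega(\sqrt{\log n}/n)$; (c) $\dfrac1{n^2\rho_n^3}E\bigl[\|\hat P-P\|_F^2\bigr]=o(1)$. Suppose there exists a collection of random variables $(\tilde Y_{ij})_{1\le i,j\le n}$ such that $|\hat Y_{kl}-\tilde Y_{kl}|=o_P(1)$ and $\tilde Y_{kl}=h(X_k,\xi_k,\zeta_k,X_l,\xi_l,\zeta_l)$ for some measurable $h$. Suppose one of the following four conditions holds, as appropriate for the setting: (d1) discrete response, without network covariates: $E|\hat\pi_1(\hat Y_{kl})-\pi_1(\tilde Y_{kl})|=o(1)$; (d2) discrete response, with network covariates: $E|\hat\pi_1(\hat Y_{kl})-\pi_1(\tilde Y_{kl})|=o(\rho_n)$; (e1) continuous response, without network covariates: $E\bigl|\tilde F_n(Y_{kl}\mid\hat Y_{kl})-\tilde F(Y_{kl}\mid\tilde Y_{kl})\bigr|=o(1)$; (e2) continuous response, with network covariates: $E\bigl|\tilde F_n(Y_{kl}\mid\hat Y_{kl})-\tilde F(Y_{kl}\mid\tilde Y_{kl})\bigr|=o(\rho_n)$. Then, if the discrete-response score or the continuous-response score defined in the context is used in the discrete or continuous case, respectively, for $k,l\in D_2$ with $k<l$, $$P\left(Y_{kl}\in\widehat C^{\mathrm{weighted}}_{kl}\mid\tilde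 Y_{kl},\,M_{kl}=0\right)\ge1-\alpha-R_n,$$ where $R_n\ge0$ and $P(R_n>\epsilon)\to0$ for any $\epsilon>0$.
   Context: Asymptotics are as $n\to\infty$ along even $n$; the pair $k=k_n<l=l_n$ in $D_2$ may depend on $n$, and conditions stated for $(k,l)$ are understood to hold for all such pairs. Model (dyadic regression with graphon missingness): $(X_1,\xi_1,\zeta_1),\dots,(X_n,\xi_n,\zeta_n)$ are i.i.d. from a distribution, with $\xi_i\in[0,1]$; $(\eta_{ij})_{1\le i<j\le n}$ and $(\nu_{ij})_{1\le i<j\le n}$ are collections of i.i.d. random variables independent of all other random variables, with $\eta_{ij}\sim\mathrm{Uniform}[0,1]$. $Y_{ij}=Y_{ji}$ and $M_{ij}=M_{ji}$ for $i\ne j$, and for measurable $g$, $w$ and $i<j$, $$Y_{ij}=g(X_i,\zeta_i,X_j,\zeta_j,\nu_{ij}),\qquad M_{ij}=\mathbf 1\bigl(\eta_{ij}\le\rho_n w(\xi_i,\xi_j)\wedge1\bigr),$$ where $\int_0^1\int_0^1w(u,v)\,du\,dv=1$, $0<c<w(x,y)<C<\infty$, $\rho_n>0$ and $\rho_n\to0$. $M_{ij}=1$ means that $Y_{ij}$ is observed, $M_{ij}=0$ that it is missing. "Discrete response" means $Y_{ij}\in\{0,1\}$; "continuous response" means $Y_{ij}$ is real-valued with continuous conditional CDF $\tilde F$ (below). Split conformal with deterministic node splitting: $N=n/2$, $D_1=\{1,\dots,N\}$, $D_2=\{N+1,\dots,n\}$. The training set is $\mathcal H_1=\{\{i,j\}: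 M_{ij}=1,\ i,j\in D_1\}$, the calibration set is $\mathcal H_2=\{\{i,j\}: M_{ij}=1,\ i,j\in D_2\}$, and for a missing test pair, $\mathcal K_{kl}=\mathcal H_2\cup\{\{k,l\}\}$. Predictions: "without network covariates" means $\hat Y_{ij}=\hat h(X_i,X_j)$; "with network covariates" means $\hat Y_{ij}=\hat h(X_i,X_j,\mathcal Z_{ij})$, where $\mathcal Z=\zeta(\mathcal X)$ are network summary statistics, a measurable function $\zeta$ of $\mathcal X=(X_i,X_j,E_{ij},M_{ij})_{1\le i,j\le n}$ (edge covariates $E_{ij}$ being functions of the node covariates) satisfying $\mathcal Z^\sigma=\zeta(\mathcal X^\sigma)$ for every permutation $\sigma$ of $[n]$, with $B^\sigma=(B_{\sigma(i),\sigma(j)})_{i,j}$ for an array $B$. In both cases $\hat h$, and the estimates $\hat\pi$, $\tilde F_n$ below, are fitted on the training set. Scores: $S_{ij}$ is the score evaluated at $(Y_{ij},\hat Y_{ij})$. Discrete case: $\pi_y(\tilde y)=P(Y_{ij}=y\mid\tilde Y_{ij}=\tilde y,M_{ij}=0)$, $\hat\pi_y$ is an estimate of $\pi_y$ with $\hat\pi_0(u)+\hat\pi_1(u)=1$ for all $u\in\mathbb R$, and $$\tilde s(y,\hat y;\hat\pi)=\begin{cases}0&\hat\pi_y(\hat y)\ge0.5\\1-\hat\pi_y(\hat y)&\hat\pi_y(\hat y)<0.5,\end{cases}\qquad s(y,\hat y;\hat\pi)=\tilde s(y,\hat y;\hat\pi)\vee(1-\alpha).$$ Continuous case: $\tilde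 F(y\mid\tilde y)$ is the conditional CDF of $Y_{ij}$ given $\tilde Y_{ij}=\tilde y$ and $M_{ij}=0$, $\tilde F_n$ is an estimate of $\tilde F$, and $s(y,\hat y,\tilde F_n)=\left|\tfrac12-\tilde F_n(y\mid\hat y)\right|$. Graphon estimation: $P=(\rho_nw(\xi_i,\xi_j))_{1\le i,j\le n}=(p_{ij})$, and $\hat P=(\hat p_{ij})_{1\le i,j\le n}$ is an estimator of $P$; $\|\cdot\|_F$ is the Frobenius norm. Let $\hat\rho_n=\binom N2^{-1}\sum_{N+1\le i<j\le n}M_{ij}$. Weighted conformal set: for $k,l\in D_2$ with $M_{kl}=0$, $$\Pi^{\mathrm{weighted}}_{kl}=\frac1{\binom N2(1-\hat\rho_n)}\sum_{\{i,j\}\in\mathcal K_{kl}}\frac{1-\hat p_{ij}}{\hat p_{ij}}\mathbf 1(S_{ij}\ge S_{kl}),\qquad \widehat C^{\mathrm{weighted}}_{kl}=\{y_{kl}:\Pi^{\mathrm{weighted}}_{kl}>\alpha\},$$ where $\Pi^{\mathrm{weighted}}_{kl}$ is regarded as a function of the candidate value $y_{kl}$ substituted for $Y_{kl}$. $a_n=\omega(b_n)$ means $a_n/b_n\to\infty$.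
   Formalization: In the discrete case at levels α ≥ 1/2 it is additionally assumed that P(Y_kl = 1 | Ỹ_kl) ≠ 1/2 almost surely; without this the claim fails, since vanishing errors in π̂ can put the realised class on the wrong side of the score's jump at 1/2. *)

theory Defs
  imports "HOL-Probability.Probability"
begin

section \<open>Dyadic regression with graphon missingness\<close>

text \<open>
  One sample of size \<open>n\<close>, on its own probability space.  Nodes are numbered from 1 and dyads are
  represented by ordered pairs \<open>(i, j)\<close> with \<open>i < j\<close>; the values of \<open>eta\<close> and \<open>nu\<close> at other
  arguments are never used.
\<close>

record ('a, 'x, 'z, 'v) sample =
  pspace :: "'a measure"
  Xcov :: "nat \<Rightarrow> 'a \<Rightarrow> 'x"
  xi :: "nat \<Rightarrow> 'a \<Rightarrow> real"
  zeta :: "nat \<Rightarrow> 'a \<Rightarrow> 'z"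
  eta :: "nat \<Rightarrow> nat \<Rightarrow> 'a \<Rightarrow> real"
  nu :: "nat \<Rightarrow> nat \<Rightarrow> 'a \<Rightarrow> 'v"

definition node :: "('a, 'x, 'z, 'v) sample \<Rightarrow> nat \<Rightarrow> 'a \<Rightarrow> 'x \<times> real \<times> 'z" where
  "node s i \<omega> = (Xcov s i \<omega>, xi s i \<omega>, zeta s i \<omega>)"

definition node_space :: "'x measure \<Rightarrow> 'z measure \<Rightarrow> ('x \<times> real \<times> 'z) measure" where
  "node_space SX SZ = SX \<Otimes>\<^sub>M borel \<Otimes>\<^sub>M SZ"

definition dyads :: "nat set \<Rightarrow> (nat \<times> nat) set" where
  "dyads A = {(i, j). i \<in> A \<and> j \<in> A \<and> i < j}"

text \<open>
  The nodes, the \<open>eta\<close>'s and the \<open>nu\<close>'s take values in different types, so their joint independence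
  cannot be written with \<open>indep_vars\<close>; it is spelled out as \<open>indep_sets\<close> of the preimage families,
  which is how \<open>indep_vars\<close> is defined.
\<close>

datatype source = Node nat | Eta nat nat | Nu nat nat

fun source_events ::
  "'x measure \<Rightarrow> 'z measure \<Rightarrow> 'v measure \<Rightarrow> ('a, 'x, 'z, 'v) sample \<Rightarrow> source \<Rightarrow> 'a set set" where
  "source_events SX SZ V s (Node i) =
     {node s i -` A \<inter> space (pspace s) | A. A \<in> sets (node_space SX SZ)}"
| "source_events SX SZ V s (Eta i j) =
     {eta s i j -` A \<inter> space (pspace s) | A. A \<in> sets borel}"
| "source_events SX SZ V s (Nu i j) =
     {nu s i j -` A \<inter> space (pspace s) | A. A \<in> sets V}"

definition sources :: "nat \<Rightarrow> source set" where
  "sources n = Node ` {1..n} \<union> case_prod Eta ` dyads {1..n} \<union> case_prod Nu ` dyads {1..n}"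

definition dyadic_sample ::
  "'x measure \<Rightarrow> 'z measure \<Rightarrow> ('x \<times> real \<times> 'z) measure \<Rightarrow> 'v measure \<Rightarrow>
   nat \<Rightarrow> ('a, 'x, 'z, 'v) sample \<Rightarrow> bool" where
  "dyadic_sample SX SZ D V n s \<longleftrightarrow>
     prob_space (pspace s) \<and>
     (\<forall>i\<in>{1..n}. node s i \<in> measurable (pspace s) (node_space SX SZ) \<and>
        distr (pspace s) (node_space SX SZ) (node s i) = D \<and>
        (\<forall>\<omega>\<in>space (pspace s). xi s i \<omega> \<in> {0..1})) \<and>
     (\<forall>(i, j)\<in>dyads {1..n}.
        eta s i j \<in> borel_measurable (pspace s) \<and>
        distr (pspace s) borel (eta s i j) = uniform_measure lborel {0..1} \<and>
        nu s i j \<in> measurable (pspace s) V \<and>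
        distr (pspace s) V (nu s i j) = V) \<and>
     prob_space.indep_sets (pspace s) (source_events SX SZ V s) (sources n)"

text \<open>The sample size tends to infinity along the even numbers.\<close>

definition even_top :: "nat filter" where
  "even_top = inf sequentially (principal {n. even n})"

text \<open>
  The law \<open>D\<close> of a node, the law \<open>V\<close> of \<open>nu\<close>, the response function \<open>g\<close> and the graphon \<open>w\<close> are the
  same for all \<open>n\<close>; the samples themselves form a triangular array.
\<close>

definition dyadic_model ::
  "'x measure \<Rightarrow> 'z measure \<Rightarrow> ('x \<times> real \<times> 'z) measure \<Rightarrow> 'v measure \<Rightarrow>
   ('x \<Rightarrow> 'z \<Rightarrow> 'x \<Rightarrow> 'z \<Rightarrow> 'v \<Rightarrow> real) \<Rightarrow> (real \<Rightarrow> real \<Rightarrow> real) \<Rightarrow> (nat \<Rightarrow> real) \<Rightarrow>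
   (nat \<Rightarrow> ('a, 'x, 'z, 'v) sample) \<Rightarrow> bool" where
  "dyadic_model SX SZ D V g w \<rho> smp \<longleftrightarrow>
     (\<forall>n. dyadic_sample SX SZ D V n (smp n)) \<and>
     (\<lambda>(x, z, x', z', v). g x z x' z' v) \<in> borel_measurable (SX \<Otimes>\<^sub>M SZ \<Otimes>\<^sub>M SX \<Otimes>\<^sub>M SZ \<Otimes>\<^sub>M V) \<and>
     (\<lambda>(u, v). w u v) \<in> borel_measurable (restrict_space borel ({0..1} \<times> {0..1})) \<and>
     (\<integral>u\<in>{0..1}. (\<integral>v\<in>{0..1}. w u v \<partial>lborel) \<partial>lborel) = 1 \<and>
     (\<exists>c C. 0 < c \<and> (\<forall>u\<in>{0..1}. \<forall>v\<in>{0..1}. c < w u v \<and> w u v < C)) \<and>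
     (\<forall>n. 0 < \<rho> n) \<and>
     (\<rho> \<longlongrightarrow> 0) even_top"

text \<open>The case distinction makes \<open>resp\<close> and \<open>obs\<close> symmetric; \<open>obs\<close> is 0 on the diagonal.\<close>

definition resp ::
  "('x \<Rightarrow> 'z \<Rightarrow> 'x \<Rightarrow> 'z \<Rightarrow> 'v \<Rightarrow> real) \<Rightarrow> ('a, 'x, 'z, 'v) sample \<Rightarrow> nat \<Rightarrow> nat \<Rightarrow> 'a \<Rightarrow> real" where
  "resp g s i j \<omega> = (let a = min i j; b = max i j in
     g (Xcov s a \<omega>) (zeta s a \<omega>) (Xcov s b \<omega>) (zeta s b \<omega>) (nu s a b \<omega>))"

definition obs ::
  "(real \<Rightarrow> real \<Rightarrow> real) \<Rightarrow> real \<Rightarrow> ('a, 'x, 'z, 'v) sample \<Rightarrow> nat \<Rightarrow> nat \<Rightarrow> 'a \<Rightarrow> real" where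
  "obs w r s i j \<omega> = (let a = min i j; b = max i j in
     of_bool (i \<noteq> j \<and> eta s a b \<omega> \<le> min (r * w (xi s a \<omega>) (xi s b \<omega>)) 1))"

definition pmat ::
  "(real \<Rightarrow> real \<Rightarrow> real) \<Rightarrow> real \<Rightarrow> ('a, 'x, 'z, 'v) sample \<Rightarrow> nat \<Rightarrow> nat \<Rightarrow> 'a \<Rightarrow> real" where
  "pmat w r s i j \<omega> = r * w (xi s i \<omega>) (xi s j \<omega>)"

definition frobenius_norm :: "nat \<Rightarrow> (nat \<Rightarrow> nat \<Rightarrow> real) \<Rightarrow> real" where
  "frobenius_norm n A = sqrt (\<Sum>i\<in>{1..n}. \<Sum>j\<in>{1..n}. (A i j)\<^sup>2)"

section \<open>Node splitting, training and predictions\<close>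

definition D1 :: "nat \<Rightarrow> nat set" where
  "D1 n = {1..n div 2}"

definition D2 :: "nat \<Rightarrow> nat set" where
  "D2 n = {n div 2 + 1..n}"

definition pair_seq :: "(nat \<Rightarrow> nat) \<Rightarrow> (nat \<Rightarrow> nat) \<Rightarrow> bool" where
  "pair_seq k l \<longleftrightarrow> (\<forall>n. even n \<and> 4 \<le> n \<longrightarrow> (k n, l n) \<in> dyads (D2 n))"

text \<open>
  The sigma-algebra of the training data: for every dyad of \<open>D1\<close> it contains whether the dyad is
  observed and, if so, the record \<open>d i j\<close> attached to it.  ``Fitted on the training set'' means
  measurable with respect to it.
\<close>

definition training_algebra ::
  "(real \<Rightarrow> real \<Rightarrow> real) \<Rightarrow> real \<Rightarrow> nat \<Rightarrow> ('a, 'x, 'z, 'v) sample \<Rightarrow>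
   'd measure \<Rightarrow> (nat \<Rightarrow> nat \<Rightarrow> 'a \<Rightarrow> 'd) \<Rightarrow> 'a measure" where
  "training_algebra w r n s SD d = sigma (space (pspace s))
     {{\<omega> \<in> space (pspace s). obs w r s i j \<omega> = 1 \<and> d i j \<omega> \<in> A} | i j A.
        (i, j) \<in> dyads (D1 n) \<and> A \<in> sets SD}"

definition training_plain ::
  "'x measure \<Rightarrow> ('x \<Rightarrow> 'z \<Rightarrow> 'x \<Rightarrow> 'z \<Rightarrow> 'v \<Rightarrow> real) \<Rightarrow> (real \<Rightarrow> real \<Rightarrow> real) \<Rightarrow> real \<Rightarrow> nat \<Rightarrow>
   ('a, 'x, 'z, 'v) sample \<Rightarrow> 'a measure" where
  "training_plain SX g w r n s = training_algebra w r n s (SX \<Otimes>\<^sub>M SX \<Otimes>\<^sub>M borel)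
     (\<lambda>i j \<omega>. (Xcov s i \<omega>, Xcov s j \<omega>, resp g s i j \<omega>))"

definition predicts_without_network ::
  "'x measure \<Rightarrow> ('x \<Rightarrow> 'z \<Rightarrow> 'x \<Rightarrow> 'z \<Rightarrow> 'v \<Rightarrow> real) \<Rightarrow> (real \<Rightarrow> real \<Rightarrow> real) \<Rightarrow> (nat \<Rightarrow> real) \<Rightarrow>
   (nat \<Rightarrow> ('a, 'x, 'z, 'v) sample) \<Rightarrow> (nat \<Rightarrow> nat \<Rightarrow> nat \<Rightarrow> 'a \<Rightarrow> real) \<Rightarrow> bool" where
  "predicts_without_network SX g w \<rho> smp Yhat \<longleftrightarrow>
     (\<exists>hhat. \<forall>n.
        (\<lambda>(\<omega>, x, x'). hhat n \<omega> x x')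
          \<in> borel_measurable (training_plain SX g w (\<rho> n) n (smp n) \<Otimes>\<^sub>M SX \<Otimes>\<^sub>M SX) \<and>
        (\<forall>(i, j)\<in>dyads {1..n}. \<forall>\<omega>\<in>space (pspace (smp n)).
           Yhat n i j \<omega> = hhat n \<omega> (Xcov (smp n) i \<omega>) (Xcov (smp n) j \<omega>)))"

definition covariate_array ::
  "('x \<Rightarrow> 'x \<Rightarrow> 'e) \<Rightarrow> (real \<Rightarrow> real \<Rightarrow> real) \<Rightarrow> real \<Rightarrow> nat \<Rightarrow> ('a, 'x, 'z, 'v) sample \<Rightarrow>
   'a \<Rightarrow> nat \<times> nat \<Rightarrow> 'x \<times> 'x \<times> 'e \<times> real" where
  "covariate_array ecov w r n s \<omega> = (\<lambda>(i, j)\<in>{1..n} \<times> {1..n}.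
     (Xcov s i \<omega>, Xcov s j \<omega>, ecov (Xcov s i \<omega>) (Xcov s j \<omega>), obs w r s i j \<omega>))"

definition permute_array :: "nat \<Rightarrow> (nat \<Rightarrow> nat) \<Rightarrow> (nat \<times> nat \<Rightarrow> 'b) \<Rightarrow> nat \<times> nat \<Rightarrow> 'b" where
  "permute_array n \<sigma> B = (\<lambda>(i, j)\<in>{1..n} \<times> {1..n}. B (\<sigma> i, \<sigma> j))"

definition network_statistic ::
  "'x measure \<Rightarrow> 'e measure \<Rightarrow> 'c measure \<Rightarrow> ('x \<Rightarrow> 'x \<Rightarrow> 'e) \<Rightarrow> (real \<Rightarrow> real \<Rightarrow> real) \<Rightarrow>
   (nat \<Rightarrow> real) \<Rightarrow> (nat \<Rightarrow> ('a, 'x, 'z, 'v) sample) \<Rightarrow>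
   (nat \<Rightarrow> (nat \<times> nat \<Rightarrow> 'x \<times> 'x \<times> 'e \<times> real) \<Rightarrow> nat \<times> nat \<Rightarrow> 'c) \<Rightarrow> bool" where
  "network_statistic SX SE SC ecov w \<rho> smp zst \<longleftrightarrow>
     (\<lambda>(x, x'). ecov x x') \<in> measurable (SX \<Otimes>\<^sub>M SX) SE \<and>
     (\<forall>n. zst n \<in> measurable
            (PiM ({1..n} \<times> {1..n}) (\<lambda>_. SX \<Otimes>\<^sub>M SX \<Otimes>\<^sub>M SE \<Otimes>\<^sub>M borel))
            (PiM ({1..n} \<times> {1..n}) (\<lambda>_. SC)) \<and>
        (\<forall>\<sigma>. \<sigma> permutes {1..n} \<longrightarrow> (\<forall>\<omega>\<in>space (pspace (smp n)).
           permute_array n \<sigma> (zst n (covariate_array ecov w (\<rho> n) n (smp n) \<omega>)) =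
           zst n (permute_array n \<sigma> (covariate_array ecov w (\<rho> n) n (smp n) \<omega>)))))"

definition training_network ::
  "'x measure \<Rightarrow> 'c measure \<Rightarrow> ('x \<Rightarrow> 'z \<Rightarrow> 'x \<Rightarrow> 'z \<Rightarrow> 'v \<Rightarrow> real) \<Rightarrow> (real \<Rightarrow> real \<Rightarrow> real) \<Rightarrow>
   real \<Rightarrow> nat \<Rightarrow> ('a, 'x, 'z, 'v) sample \<Rightarrow> ('a \<Rightarrow> nat \<times> nat \<Rightarrow> 'c) \<Rightarrow> 'a measure" where
  "training_network SX SC g w r n s Z = training_algebra w r n s (SX \<Otimes>\<^sub>M SX \<Otimes>\<^sub>M SC \<Otimes>\<^sub>M borel)
     (\<lambda>i j \<omega>. (Xcov s i \<omega>, Xcov s j \<omega>, Z \<omega> (i, j), resp g s i j \<omega>))"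

definition network_covariates ::
  "('x \<Rightarrow> 'x \<Rightarrow> 'e) \<Rightarrow> (real \<Rightarrow> real \<Rightarrow> real) \<Rightarrow> (nat \<Rightarrow> real) \<Rightarrow>
   (nat \<Rightarrow> ('a, 'x, 'z, 'v) sample) \<Rightarrow>
   (nat \<Rightarrow> (nat \<times> nat \<Rightarrow> 'x \<times> 'x \<times> 'e \<times> real) \<Rightarrow> nat \<times> nat \<Rightarrow> 'c) \<Rightarrow>
   nat \<Rightarrow> 'a \<Rightarrow> nat \<times> nat \<Rightarrow> 'c" where
  "network_covariates ecov w \<rho> smp zst n \<omega> = zst n (covariate_array ecov w (\<rho> n) n (smp n) \<omega>)"

definition predicts_with_network ::
  "'x measure \<Rightarrow> 'c measure \<Rightarrow> ('x \<Rightarrow> 'z \<Rightarrow> 'x \<Rightarrow> 'z \<Rightarrow> 'v \<Rightarrow> real) \<Rightarrow> (real \<Rightarrow> real \<Rightarrow> real) \<Rightarrow>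
   (nat \<Rightarrow> real) \<Rightarrow> (nat \<Rightarrow> ('a, 'x, 'z, 'v) sample) \<Rightarrow> (nat \<Rightarrow> 'a \<Rightarrow> nat \<times> nat \<Rightarrow> 'c) \<Rightarrow>
   (nat \<Rightarrow> nat \<Rightarrow> nat \<Rightarrow> 'a \<Rightarrow> real) \<Rightarrow> bool" where
  "predicts_with_network SX SC g w \<rho> smp Z Yhat \<longleftrightarrow>
     (\<exists>hhat. \<forall>n.
        (\<lambda>(\<omega>, x, x', z). hhat n \<omega> x x' z)
          \<in> borel_measurable
              (training_network SX SC g w (\<rho> n) n (smp n) (Z n) \<Otimes>\<^sub>M SX \<Otimes>\<^sub>M SX \<Otimes>\<^sub>M SC) \<and>
        (\<forall>(i, j)\<in>dyads {1..n}. \<forall>\<omega>\<in>space (pspace (smp n)).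
           Yhat n i j \<omega> = hhat n \<omega> (Xcov (smp n) i \<omega>) (Xcov (smp n) j \<omega>) (Z n \<omega> (i, j))))"

section \<open>Conditional probabilities given the surrogate and missingness\<close>

text \<open>
  \<open>cprob_missing w r s T k l E\<close> is the random variable \<open>P(E | T, M\<^sub>k\<^sub>l = 0)\<close>: the conditional
  expectation of the indicator of \<open>E\<close> given the sigma-algebra of \<open>T\<close>, under the measure conditioned
  on the event \<open>M\<^sub>k\<^sub>l = 0\<close>.
\<close>

definition given_missing ::
  "(real \<Rightarrow> real \<Rightarrow> real) \<Rightarrow> real \<Rightarrow> ('a, 'x, 'z, 'v) sample \<Rightarrow> nat \<Rightarrow> nat \<Rightarrow> 'a measure" where
  "given_missing w r s k l =
     uniform_measure (pspace s) {\<omega> \<in> space (pspace s). obs w r s k l \<omega> = 0}"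

definition cprob_missing ::
  "(real \<Rightarrow> real \<Rightarrow> real) \<Rightarrow> real \<Rightarrow> ('a, 'x, 'z, 'v) sample \<Rightarrow> ('a \<Rightarrow> real) \<Rightarrow> nat \<Rightarrow> nat \<Rightarrow>
   'a set \<Rightarrow> 'a \<Rightarrow> real" where
  "cprob_missing w r s T k l E =
     real_cond_exp (given_missing w r s k l) (vimage_algebra (space (pspace s)) T borel)
       (indicator E)"

definition is_pi ::
  "('x \<Rightarrow> 'z \<Rightarrow> 'x \<Rightarrow> 'z \<Rightarrow> 'v \<Rightarrow> real) \<Rightarrow> (real \<Rightarrow> real \<Rightarrow> real) \<Rightarrow> (nat \<Rightarrow> real) \<Rightarrow>
   (nat \<Rightarrow> ('a, 'x, 'z, 'v) sample) \<Rightarrow> (nat \<Rightarrow> nat \<Rightarrow> nat \<Rightarrow> 'a \<Rightarrow> real) \<Rightarrow>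
   (nat \<Rightarrow> real \<Rightarrow> real \<Rightarrow> real) \<Rightarrow> bool" where
  "is_pi g w \<rho> smp Ytil pip \<longleftrightarrow>
     (\<forall>n. even n \<longrightarrow> (\<forall>y\<in>{0, 1}. pip n y \<in> borel_measurable borel \<and>
        (\<forall>(i, j)\<in>dyads (D2 n). AE \<omega> in given_missing w (\<rho> n) (smp n) i j.
           pip n y (Ytil n i j \<omega>) =
           cprob_missing w (\<rho> n) (smp n) (Ytil n i j) i j
             {\<omega> \<in> space (pspace (smp n)). resp g (smp n) i j \<omega> = y} \<omega>)))"

text \<open>\<open>F n y t\<close> stands for the conditional CDF at \<open>y\<close> given that the surrogate equals \<open>t\<close>.\<close>

definition is_continuous_cond_cdf ::
  "('x \<Rightarrow> 'z \<Rightarrow> 'x \<Rightarrow> 'z \<Rightarrow> 'v \<Rightarrow> real) \<Rightarrow> (real \<Rightarrow> real \<Rightarrow> real) \<Rightarrow> (nat \<Rightarrow> real) \<Rightarrow>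
   (nat \<Rightarrow> ('a, 'x, 'z, 'v) sample) \<Rightarrow> (nat \<Rightarrow> nat \<Rightarrow> nat \<Rightarrow> 'a \<Rightarrow> real) \<Rightarrow>
   (nat \<Rightarrow> real \<Rightarrow> real \<Rightarrow> real) \<Rightarrow> bool" where
  "is_continuous_cond_cdf g w \<rho> smp Ytil F \<longleftrightarrow>
     (\<forall>n. even n \<longrightarrow>
        (\<forall>t. mono (\<lambda>y. F n y t) \<and> continuous_on UNIV (\<lambda>y. F n y t) \<and>
             ((\<lambda>y. F n y t) \<longlongrightarrow> 0) at_bot \<and> ((\<lambda>y. F n y t) \<longlongrightarrow> 1) at_top) \<and>
        (\<forall>y. F n y \<in> borel_measurable borel \<and>
           (\<forall>(i, j)\<in>dyads (D2 n). AE \<omega> in given_missing w (\<rho> n) (smp n) i j.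
              F n y (Ytil n i j \<omega>) =
              cprob_missing w (\<rho> n) (smp n) (Ytil n i j) i j
                {\<omega> \<in> space (pspace (smp n)). resp g (smp n) i j \<omega> \<le> y} \<omega>)))"

definition discrete_response ::
  "('x \<Rightarrow> 'z \<Rightarrow> 'x \<Rightarrow> 'z \<Rightarrow> 'v \<Rightarrow> real) \<Rightarrow> (nat \<Rightarrow> ('a, 'x, 'z, 'v) sample) \<Rightarrow> bool" where
  "discrete_response g smp \<longleftrightarrow>
     (\<forall>n. \<forall>(i, j)\<in>dyads {1..n}. \<forall>\<omega>\<in>space (pspace (smp n)). resp g (smp n) i j \<omega> \<in> {0, 1})"

text \<open>
  \<open>P(Y = 1 | Ytil) \<noteq> 1/2\<close> almost surely.  Needed for the discrete score at levels \<open>\<alpha> \<ge> 1/2\<close> only: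
  there the score jumps where the estimated class probability crosses 1/2, and if \<open>Y\<close> is a fair coin
  given \<open>Ytil\<close>, an estimation error that vanishes in \<open>L\<^sup>1\<close> can put both classes on the wrong side of
  the jump.
\<close>

definition no_fair_coin ::
  "('x \<Rightarrow> 'z \<Rightarrow> 'x \<Rightarrow> 'z \<Rightarrow> 'v \<Rightarrow> real) \<Rightarrow> (nat \<Rightarrow> ('a, 'x, 'z, 'v) sample) \<Rightarrow>
   (nat \<Rightarrow> nat \<Rightarrow> nat \<Rightarrow> 'a \<Rightarrow> real) \<Rightarrow> bool" where
  "no_fair_coin g smp Ytil \<longleftrightarrow>
     (\<forall>n. even n \<longrightarrow> (\<forall>(i, j)\<in>dyads (D2 n). AE \<omega> in pspace (smp n).
        real_cond_exp (pspace (smp n)) (vimage_algebra (space (pspace (smp n))) (Ytil n i j) borel)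
          (indicator {\<omega> \<in> space (pspace (smp n)). resp g (smp n) i j \<omega> = 1}) \<omega> \<noteq> 1 / 2))"

section \<open>Estimates, scores and the weighted conformal set\<close>

text \<open>In the following two predicates \<open>G n\<close> is the sigma-algebra of the training data.\<close>

definition fitted_pi ::
  "(nat \<Rightarrow> ('a, 'x, 'z, 'v) sample) \<Rightarrow> (nat \<Rightarrow> 'a measure) \<Rightarrow>
   (nat \<Rightarrow> 'a \<Rightarrow> real \<Rightarrow> real \<Rightarrow> real) \<Rightarrow> bool" where
  "fitted_pi smp G pihat \<longleftrightarrow>
     (\<forall>n. (\<forall>y\<in>{0, 1}. (\<lambda>(\<omega>, u). pihat n \<omega> y u) \<in> borel_measurable (G n \<Otimes>\<^sub>M borel)) \<and>
        (\<forall>\<omega>\<in>space (pspace (smp n)). \<forall>u. pihat n \<omega> 0 u + pihat n \<omega> 1 u = 1))"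

definition fitted_cdf ::
  "(nat \<Rightarrow> 'a measure) \<Rightarrow> (nat \<Rightarrow> 'a \<Rightarrow> real \<Rightarrow> real \<Rightarrow> real) \<Rightarrow> bool" where
  "fitted_cdf G Fhat \<longleftrightarrow>
     (\<forall>n. (\<lambda>(\<omega>, y, u). Fhat n \<omega> y u) \<in> borel_measurable (G n \<Otimes>\<^sub>M borel \<Otimes>\<^sub>M borel))"

definition discrete_score :: "real \<Rightarrow> (real \<Rightarrow> real \<Rightarrow> real) \<Rightarrow> real \<Rightarrow> real \<Rightarrow> real" where
  "discrete_score \<alpha> p y u = max (if p y u \<ge> 1 / 2 then 0 else 1 - p y u) (1 - \<alpha>)"

definition continuous_score :: "(real \<Rightarrow> real \<Rightarrow> real) \<Rightarrow> real \<Rightarrow> real \<Rightarrow> real" where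
  "continuous_score F y u = \<bar>1 / 2 - F y u\<bar>"

definition calibration_set :: "nat \<Rightarrow> (nat \<Rightarrow> nat \<Rightarrow> real) \<Rightarrow> (nat \<times> nat) set" where
  "calibration_set n M = {(i, j) \<in> dyads (D2 n). M i j = 1}"

definition rho_hat :: "nat \<Rightarrow> (nat \<Rightarrow> nat \<Rightarrow> real) \<Rightarrow> real" where
  "rho_hat n M = (\<Sum>(i, j)\<in>dyads (D2 n). M i j) / real ((n div 2) choose 2)"

definition Pi_weighted ::
  "nat \<Rightarrow> (nat \<Rightarrow> nat \<Rightarrow> real) \<Rightarrow> (nat \<Rightarrow> nat \<Rightarrow> real) \<Rightarrow> (nat \<Rightarrow> nat \<Rightarrow> real) \<Rightarrow> nat \<Rightarrow> nat \<Rightarrow> real" where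
  "Pi_weighted n M p S k l =
     1 / (real ((n div 2) choose 2) * (1 - rho_hat n M)) *
     (\<Sum>(i, j)\<in>calibration_set n M \<union> {(k, l)}. (1 - p i j) / p i j * of_bool (S i j \<ge> S k l))"

definition C_weighted ::
  "real set \<Rightarrow> real \<Rightarrow> nat \<Rightarrow> (nat \<Rightarrow> nat \<Rightarrow> real) \<Rightarrow> (nat \<Rightarrow> nat \<Rightarrow> real) \<Rightarrow>
   (real \<Rightarrow> real \<Rightarrow> real) \<Rightarrow> (nat \<Rightarrow> nat \<Rightarrow> real) \<Rightarrow> (nat \<Rightarrow> nat \<Rightarrow> real) \<Rightarrow> nat \<Rightarrow> nat \<Rightarrow> real set" where
  "C_weighted ys \<alpha> n M p score Y Yhat k l =
     {y \<in> ys. Pi_weighted n M p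
        (\<lambda>i j. score (if (i, j) = (k, l) then y else Y i j) (Yhat i j)) k l > \<alpha>}"

text \<open>
  \<open>E|A\<^sub>k\<^sub>l - B\<^sub>k\<^sub>l| = o(r\<^sub>n)\<close> for all sequences of dyads of \<open>D2\<close>.  The expectation is a nonnegative
  integral, so that it is infinite, rather than 0, if the difference is not integrable.
\<close>

definition mean_dist_smallo ::
  "(nat \<Rightarrow> ('a, 'x, 'z, 'v) sample) \<Rightarrow> (nat \<Rightarrow> nat \<Rightarrow> nat \<Rightarrow> 'a \<Rightarrow> real) \<Rightarrow>
   (nat \<Rightarrow> nat \<Rightarrow> nat \<Rightarrow> 'a \<Rightarrow> real) \<Rightarrow> (nat \<Rightarrow> real) \<Rightarrow> bool" where
  "mean_dist_smallo smp A B r \<longleftrightarrow>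
     (\<forall>k l. pair_seq k l \<longrightarrow>
        ((\<lambda>n. (\<integral>\<^sup>+\<omega>. ennreal \<bar>A n (k n) (l n) \<omega> - B n (k n) (l n) \<omega>\<bar> \<partial>pspace (smp n))
              / ennreal (r n)) \<longlongrightarrow> 0) even_top)"

end

theory Submission
  imports Defs
begin

text \<open>
  Coverage needs only one threshold \<open>t\<close>: since the weighted tail count is monotone in the score, a test
  pair with score at most \<open>t\<close> is covered as soon as the weighted count of calibration scores \<open>\<ge> t\<close>
  exceeds \<open>\<alpha>\<close>.  Weighting an observed dyad by \<open>(1 - p) / p\<close> turns it into an unbiased stand-in for a
  missing one, so with oracle scores and weights this count has mean \<open>P(S \<ge> t, M = 0)\<close>; its variance
  is \<open>O(1 / (n\<^sup>2 \<rho>) + 1 / n)\<close> because dyads without a common node are independent.  The errors from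
  \<open>phat\<close> and from the estimated scores vanish in mean, the latter because it is either independent of
  the observation of the dyad (no network covariates) or \<open>o(\<rho>)\<close>.

  Given the surrogate and \<open>M = 0\<close>, the oracle score of the test pair exceeds \<open>t\<close> with probability at
  most \<open>\<alpha> + \<epsilon>\<close>: for a continuous response \<open>F(Y | Ytil)\<close> is uniform, and for a discrete one (\<open>t = 1 - \<alpha>\<close>)
  the score exceeds \<open>t\<close> only for a class of probability below \<open>\<alpha>\<close> and below 1/2.
\<close>

section \<open>Probability preliminaries\<close>

text \<open>The scale \<open>n^2 * \<rho>^3\<close> of the hypothesis on \<open>phat\<close> is the
  price of inverse weighting. With p and q at least c \<rho>, the error |1/q - 1/p| is at most |q -
  p| / (c \<rho>)^2, and about n^2 \<rho> dyads are observed; by Cauchy-Schwarz the total weight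
  error is of order (n^2 \<rho> F)^(1/2) / \<rho>^2 with F the squared Frobenius error, and this is
  o(n^2) if F = o(n^2 \<rho>^3). \<open>phat\<close> may depend on the whole sample, calibration
  dyads included. Therefore the variance bound concerns oracle quantities only, and estimated
  weights and scores are compared with them dyad by dyad. The delicate case is the discrete score at
  \<alpha> \<ge> 1/2. The hypothesis on fair coins is qualitative and speaks of the unconditional
  law, whereas a margin around 1/2 is required that is uniform in n and valid under missingness. It
  exists because the joint law of surrogate and response is the same for all n, and because
  conditioning on an event of probability 1 - O(\<rho>) changes class probabilities little.\<close>

lemma ennreal_divide_mult_self: "0 < s \<Longrightarrow> x / ennreal s * ennreal s = x"
  by (simp add: ennreal_divide_times)

lemma emeasure_uniform_unit_atMost:
  assumes "0 \<le> x" "x \<le> (1::real)"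
  shows "emeasure (uniform_measure lborel {0..1}) {..x} = ennreal x"
proof -
  have "{0..1} \<inter> {..x} = {0..x}" using assms by auto
  then show ?thesis using assms by (simp add: emeasure_uniform_measure divide_ennreal flip: ennreal_1)
qed

text \<open>The two coordinates may have different value types, so independence is assumed on
  rectangles only; this determines the product, since both factors are finite measures.\<close>

lemma (in prob_space) distr_pair_indep:
  assumes X: "X \<in> M \<rightarrow>\<^sub>M S" and Y: "Y \<in> M \<rightarrow>\<^sub>M T"
    and ind: "\<And>A B. A \<in> sets S \<Longrightarrow> B \<in> sets T \<Longrightarrow>
      prob (X -` A \<inter> space M \<inter> (Y -` B \<inter> space M)) = prob (X -` A \<inter> space M) * prob (Y -` B \<inter> space M)"
  shows "distr M S X \<Otimes>\<^sub>M distr M T Y = distr M (S \<Otimes>\<^sub>M T) (\<lambda>\<omega>. (X \<omega>, Y \<omega>))"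
proof (rule pair_measure_eqI)
  interpret X: prob_space "distr M S X" by (rule prob_space_distr) (rule X)
  interpret Y: prob_space "distr M T Y" by (rule prob_space_distr) (rule Y)
  show "sigma_finite_measure (distr M S X)" "sigma_finite_measure (distr M T Y)" by unfold_locales
  show "sets (distr M S X \<Otimes>\<^sub>M distr M T Y) = sets (distr M (S \<Otimes>\<^sub>M T) (\<lambda>\<omega>. (X \<omega>, Y \<omega>)))" by simp
  fix A B assume A: "A \<in> sets (distr M S X)" and B: "B \<in> sets (distr M T Y)"
  have XY: "(\<lambda>\<omega>. (X \<omega>, Y \<omega>)) \<in> M \<rightarrow>\<^sub>M S \<Otimes>\<^sub>M T" using X Y by (rule measurable_Pair)
  have "(\<lambda>\<omega>. (X \<omega>, Y \<omega>)) -` (A \<times> B) \<inter> space M = X -` A \<inter> space M \<inter> (Y -` B \<inter> space M)" by auto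
  then show "emeasure (distr M S X) A * emeasure (distr M T Y) B =
      emeasure (distr M (S \<Otimes>\<^sub>M T) (\<lambda>\<omega>. (X \<omega>, Y \<omega>))) (A \<times> B)"
    using A B ind[of A B] by (simp add: emeasure_distr X Y XY emeasure_eq_measure ennreal_mult)
qed

text \<open>Thinning: \<eta> is uniform and independent of G, so integrating it out first by Fubini
  replaces the event \<eta> \<le> p by its conditional probability p. The nonnegative integral
  spares integrability conditions on f, which will be as large as 1/p.\<close>

lemma nn_integral_thinning:
  fixes \<eta> :: "'a \<Rightarrow> real" and f :: "'a \<Rightarrow> ennreal"
  assumes "prob_space M" and sub: "subalgebra M G"
    and ind: "prob_space.indep_set M (sets G) {\<eta> -` A \<inter> space M | A. A \<in> sets borel}"
    and \<eta>: "\<eta> \<in> borel_measurable M" "distr M borel \<eta> = uniform_measure lborel {0..1}"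
    and p: "p \<in> borel_measurable G" "\<And>\<omega>. \<omega> \<in> space M \<Longrightarrow> 0 \<le> p \<omega> \<and> p \<omega> \<le> 1"
    and f: "f \<in> borel_measurable G"
  shows "(\<integral>\<^sup>+\<omega>. f \<omega> * indicator {\<omega>. \<eta> \<omega> \<le> p \<omega>} \<omega> \<partial>M) = (\<integral>\<^sup>+\<omega>. f \<omega> * ennreal (p \<omega>) \<partial>M)"
proof -
  interpret prob_space M by fact
  note [measurable] = \<eta>(1) p(1) f
  have spG: "space G = space M" and setsG: "sets G \<subseteq> sets M" using sub by (auto simp: subalgebra_def)
  \<comment> \<open>Read as a random element of the coarser space G, the identity turns independence
    of a sigma-algebra and a variable into a product law.\<close>
  have idm: "(\<lambda>x. x) \<in> M \<rightarrow>\<^sub>M G"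
    using setsG sets.sets_into_space[of _ G] spG by (intro measurableI) (auto simp: Int_absorb2)
  have pm: "(\<lambda>x. (x, \<eta> x)) \<in> M \<rightarrow>\<^sub>M G \<Otimes>\<^sub>M borel" using idm \<eta>(1) by (rule measurable_Pair)
  have prod: "distr M G (\<lambda>x. x) \<Otimes>\<^sub>M distr M borel \<eta> = distr M (G \<Otimes>\<^sub>M borel) (\<lambda>x. (x, \<eta> x))"
  proof (rule distr_pair_indep[OF idm \<eta>(1)])
    fix A B assume A: "A \<in> sets G" and B: "B \<in> sets (borel :: real measure)"
    have "(\<lambda>x. x) -` A \<inter> space M = A" using sets.sets_into_space[OF A] spG by auto
    then show "prob ((\<lambda>x. x) -` A \<inter> space M \<inter> (\<eta> -` B \<inter> space M)) =
        prob ((\<lambda>x. x) -` A \<inter> space M) * prob (\<eta> -` B \<inter> space M)"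
      using A B by (auto intro!: indep_setD[OF ind])
  qed
  interpret E: prob_space "distr M borel \<eta>" by (rule prob_space_distr) (rule \<eta>(1))
  let ?h = "\<lambda>(x, e). f x * indicator {(x, e). e \<le> p x} (x, e)"
  have hm: "?h \<in> borel_measurable (G \<Otimes>\<^sub>M borel)" by measurable
  have "(\<integral>\<^sup>+\<omega>. f \<omega> * indicator {\<omega>. \<eta> \<omega> \<le> p \<omega>} \<omega> \<partial>M) = (\<integral>\<^sup>+\<omega>. ?h (\<omega>, \<eta> \<omega>) \<partial>M)"
    by (intro nn_integral_cong) (auto split: split_indicator)
  also have "\<dots> = (\<integral>\<^sup>+z. ?h z \<partial>distr M (G \<Otimes>\<^sub>M borel) (\<lambda>x. (x, \<eta> x)))"
    by (subst nn_integral_distr[OF pm]) (use hm in auto)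
  also have "\<dots> = (\<integral>\<^sup>+z. ?h z \<partial>(distr M G (\<lambda>x. x) \<Otimes>\<^sub>M distr M borel \<eta>))" by (simp add: prod)
  also have "\<dots> = (\<integral>\<^sup>+x. \<integral>\<^sup>+e. ?h (x, e) \<partial>distr M borel \<eta> \<partial>distr M G (\<lambda>x. x))"
    by (rule E.nn_integral_fst[symmetric]) (use hm in \<open>simp cong: measurable_cong_sets\<close>)
  also have "\<dots> = (\<integral>\<^sup>+x. f x * ennreal (p x) \<partial>distr M G (\<lambda>x. x))"
  proof (rule nn_integral_cong)
    fix x assume "x \<in> space (distr M G (\<lambda>x. x))"
    then have x: "x \<in> space M" by (simp add: spG)
    have "(\<integral>\<^sup>+e. ?h (x, e) \<partial>distr M borel \<eta>) = (\<integral>\<^sup>+e. f x * indicator {..p x} e \<partial>distr M borel \<eta>)"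
      by (intro nn_integral_cong) (auto split: split_indicator)
    also have "\<dots> = f x * ennreal (p x)"
      using p(2)[OF x]
      by (simp add: nn_integral_cmult_indicator \<eta>(2) emeasure_uniform_unit_atMost del: emeasure_uniform_measure)
    finally show "(\<integral>\<^sup>+e. ?h (x, e) \<partial>distr M borel \<eta>) = f x * ennreal (p x)" .
  qed
  also have "\<dots> = (\<integral>\<^sup>+\<omega>. f \<omega> * ennreal (p \<omega>) \<partial>M)"
    by (subst nn_integral_distr[OF idm]) auto
  finally show ?thesis .
qed

text \<open>Second-moment method on a dependency graph R of degree at most d. Only related or equal
  indices contribute to the variance, and since the summands are nonnegative, their covariance is at
  most the mean of their product. The diagonal has its own bound a because there it will be larger
  by a factor of order 1/\<rho>.\<close>

lemma (in prob_space) variance_sum_le: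
  fixes T :: "'i \<Rightarrow> 'a \<Rightarrow> real"
  assumes "finite E"
    and T: "\<And>e. e \<in> E \<Longrightarrow> T e \<in> borel_measurable M" "\<And>e \<omega>. e \<in> E \<Longrightarrow> \<omega> \<in> space M \<Longrightarrow> 0 \<le> T e \<omega> \<and> T e \<omega> \<le> K"
    and uncorr: "\<And>e e'. e \<in> E \<Longrightarrow> e' \<in> E \<Longrightarrow> \<not> R e e' \<Longrightarrow>
      expectation (\<lambda>\<omega>. T e \<omega> * T e' \<omega>) = expectation (T e) * expectation (T e')"
    and diag: "\<And>e. e \<in> E \<Longrightarrow> expectation (\<lambda>\<omega>. T e \<omega> * T e \<omega>) \<le> a"
    and offdiag: "\<And>e e'. e \<in> E \<Longrightarrow> e' \<in> E \<Longrightarrow> e \<noteq> e' \<Longrightarrow> R e e' \<Longrightarrow> expectation (\<lambda>\<omega>. T e \<omega> * T e' \<omega>) \<le> b"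
    and deg: "\<And>e. e \<in> E \<Longrightarrow> real (card {e' \<in> E. R e e'}) \<le> d"
    and nn: "0 \<le> a" "0 \<le> b"
  shows "variance (\<lambda>\<omega>. \<Sum>e\<in>E. T e \<omega>) \<le> real (card E) * (a + d * b)"
proof -
  have int: "integrable M (T e)" if "e \<in> E" for e
    using T that by (intro integrable_const_bound[where B=K]) auto
  have prod_le: "\<bar>T e \<omega> * T e' \<omega>\<bar> \<le> K * K" if "e \<in> E" "e' \<in> E" "\<omega> \<in> space M" for e e' \<omega>
    using T(2)[OF that(1,3)] T(2)[OF that(2,3)] by (auto simp: abs_mult intro!: mult_mono)
  have int2: "integrable M (\<lambda>\<omega>. T e \<omega> * T e' \<omega>)" if "e \<in> E" "e' \<in> E" for e e'
    using T that prod_le[OF that] by (intro integrable_const_bound[where B="K * K"]) auto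
  have Enn: "0 \<le> expectation (T e)" if "e \<in> E" for e using T(2) that by (intro integral_nonneg_AE) auto
  define cov where "cov e e' = expectation (\<lambda>\<omega>. T e \<omega> * T e' \<omega>) - expectation (T e) * expectation (T e')" for e e'
  have sq: "(\<Sum>e\<in>E. T e \<omega>)\<^sup>2 = (\<Sum>e\<in>E. \<Sum>e'\<in>E. T e \<omega> * T e' \<omega>)" for \<omega>
    by (simp add: power2_eq_square sum_product)
  have "variance (\<lambda>\<omega>. \<Sum>e\<in>E. T e \<omega>) =
      expectation (\<lambda>\<omega>. (\<Sum>e\<in>E. T e \<omega>)\<^sup>2) - (expectation (\<lambda>\<omega>. \<Sum>e\<in>E. T e \<omega>))\<^sup>2"
    by (rule variance_eq) (auto intro!: int int2 Bochner_Integration.integrable_sum simp: sq)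
  also have "\<dots> = (\<Sum>e\<in>E. \<Sum>e'\<in>E. cov e e')"
    by (simp add: sq int int2 cov_def sum_subtractf power2_eq_square sum_product
        Bochner_Integration.integral_sum Bochner_Integration.integrable_sum)
  \<comment> \<open>A diagonal pair with \<open>R e e\<close> is charged both a and b; this only
    weakens the bound.\<close>
  also have "\<dots> \<le> (\<Sum>e\<in>E. \<Sum>e'\<in>E. of_bool (e = e') * a + of_bool (R e e') * b)"
  proof (intro sum_mono)
    fix e e' assume e: "e \<in> E" "e' \<in> E"
    have le: "cov e e' \<le> expectation (\<lambda>\<omega>. T e \<omega> * T e' \<omega>)" using e Enn by (simp add: cov_def)
    show "cov e e' \<le> of_bool (e = e') * a + of_bool (R e e') * b"
    proof (cases "e = e'")
      case True
      have "0 \<le> of_bool (R e e') * b" using nn by simp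
      then show ?thesis using le diag[OF e(1)] True by simp
    next
      case False
      then show ?thesis
        using uncorr[OF e] offdiag[OF e] le by (cases "R e e'") (auto simp: cov_def)
    qed
  qed
  also have "\<dots> = (\<Sum>e\<in>E. a + real (card {e' \<in> E. R e e'}) * b)"
  proof (rule sum.cong[OF refl])
    fix e assume "e \<in> E"
    then have "(\<Sum>e'\<in>E. of_bool (e = e') * a) = a" using assms(1)
      by (simp add: of_bool_def if_distrib[of "\<lambda>x. x * a"] sum.delta cong: if_cong)
    moreover have "(\<Sum>e'\<in>E. of_bool (R e e') * b) = real (card {e' \<in> E. R e e'}) * b"
      using assms(1) by (simp add: sum_distrib_right[symmetric] of_bool_def sum.If_cases Int_def)
    ultimately show "(\<Sum>e'\<in>E. of_bool (e = e') * a + of_bool (R e e') * b) = a + real (card {e' \<in> E. R e e'}) * b"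
      by (simp add: sum.distrib)
  qed
  also have "\<dots> \<le> (\<Sum>e\<in>E. a + d * b)"
    using deg nn by (intro sum_mono add_left_mono mult_right_mono) auto
  finally show ?thesis by simp
qed

section \<open>The probability integral transform given a second variable\<close>

text \<open>Continuity leaves room to the right of y, where a rational level can be found;
  monotonicity gives the converse. An event such as F Y T < u thus becomes a countable union of
  events in which F is taken at fixed levels.\<close>

lemma less_iff_rational_witness:
  fixes f :: "real \<Rightarrow> real"
  assumes "mono f" "continuous_on UNIV f"
  shows "f y < u \<longleftrightarrow> (\<exists>q\<in>\<rat>. y \<le> q \<and> f q < u)"
proof
  assume "f y < u"
  have "isCont f y" using assms(2) by (simp add: continuous_on_eq_continuous_at)
  then have "\<forall>\<^sub>F x in at y. f x < u" using \<open>f y < u\<close> by (intro order_tendstoD) (auto simp: isCont_def)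
  then obtain d where d: "d > 0" "\<And>x. x \<noteq> y \<Longrightarrow> dist x y < d \<Longrightarrow> f x < u" unfolding eventually_at by auto
  obtain q where "q \<in> \<rat>" "y < q" "q < y + d" using Rats_dense_in_real[of y "y + d"] d(1) by auto
  then show "\<exists>q\<in>\<rat>. y \<le> q \<and> f q < u" using d(2)[of q] by (intro bexI[of _ q]) (auto simp: dist_real_def)
next
  assume "\<exists>q\<in>\<rat>. y \<le> q \<and> f q < u"
  then show "f y < u" using assms(1) by (meson le_less_trans monoD)
qed

text \<open>F is assumed measurable only in its second argument, one level at a time; joint
  measurability along Y and T comes from the rational witnesses.\<close>

lemma measurable_mono_continuous:
  fixes F :: "real \<Rightarrow> 't \<Rightarrow> real"
  assumes [measurable]: "Y \<in> borel_measurable M" "T \<in> M \<rightarrow>\<^sub>M N" "\<And>y. F y \<in> borel_measurable N"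
    and F: "\<And>t. mono (\<lambda>y. F y t)" "\<And>t. continuous_on UNIV (\<lambda>y. F y t)"
  shows "(\<lambda>\<omega>. F (Y \<omega>) (T \<omega>)) \<in> borel_measurable M"
proof (rule borel_measurable_iff_less[THEN iffD2], safe)
  fix u
  have "{\<omega> \<in> space M. F (Y \<omega>) (T \<omega>) < u} = (\<Union>q\<in>\<rat>. {\<omega> \<in> space M. Y \<omega> \<le> q \<and> F q (T \<omega>) < u})"
    using less_iff_rational_witness[OF F, where u=u] by blast
  also have "\<dots> \<in> sets M" by (intro sets.countable_UN') (auto simp: countable_rat)
  finally show "{\<omega> \<in> space M. F (Y \<omega>) (T \<omega>) < u} \<in> sets M" .
qed

text \<open>
  The probability integral transform with side information.  For a finite set of levels, the event
  \<open>\<exists>q\<in>I. Y \<le> q \<and> F q T < u\<close> is an event \<open>Y \<le> q\<close> with \<open>q\<close> a function of \<open>T\<close>; letting \<open>I\<close>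
  exhaust the rationals, it becomes \<open>F Y T < u\<close>.
\<close>

locale continuous_cond_cdf = prob_space +
  fixes Y T :: "'a \<Rightarrow> real" and F :: "real \<Rightarrow> real \<Rightarrow> real"
  assumes Y_measurable [measurable]: "Y \<in> borel_measurable M"
    and T_measurable [measurable]: "T \<in> borel_measurable M"
    and F_mono: "\<And>t. mono (\<lambda>y. F y t)"
    and F_cont: "\<And>t. continuous_on UNIV (\<lambda>y. F y t)"
    and F_bot: "\<And>t. ((\<lambda>y. F y t) \<longlongrightarrow> 0) at_bot"
    and F_top: "\<And>t. ((\<lambda>y. F y t) \<longlongrightarrow> 1) at_top"
    and F_measurable [measurable]: "\<And>y. F y \<in> borel_measurable borel"
    and F_cdf: "\<And>y C. C \<in> sets borel \<Longrightarrow>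
      (\<integral>\<omega>. F y (T \<omega>) * indicator C (T \<omega>) \<partial>M) = prob {\<omega> \<in> space M. Y \<omega> \<le> y \<and> T \<omega> \<in> C}"

context continuous_cond_cdf
begin

lemma F_bounds: "0 \<le> F y t" "F y t \<le> 1"
proof -
  have "\<forall>\<^sub>F x in at_bot. F x t \<le> F y t"
    using eventually_le_at_bot[of y] by eventually_elim (rule monoD[OF F_mono])
  then show "0 \<le> F y t" by (rule tendsto_upperbound[OF F_bot]) simp
  have "\<forall>\<^sub>F x in at_top. F y t \<le> F x t"
    using eventually_ge_at_top[of y] by eventually_elim (rule monoD[OF F_mono])
  then show "F y t \<le> 1" by (rule tendsto_lowerbound[OF F_top]) simp
qed

text \<open>The conditional probability, given T = t, that Y lies below some level of I whose
  F-value is less than u. The inserted 0 is the value if no level qualifies.\<close>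

definition "level I u t = Max (insert 0 ((\<lambda>q. F q t) ` {q\<in>I. F q t < u}))"

text \<open>F is monotone in the level, so a new largest level, if it qualifies, dominates all
  earlier ones. Hence the inductions below add the levels in increasing order.\<close>

lemma level_insert:
  assumes "finite I" "\<forall>a\<in>I. a < b"
  shows "level (insert b I) u t = (if F b t < u then F b t else level I u t)"
proof (cases "F b t < u")
  case True
  have "F q t \<le> F b t" if "q \<in> insert b I" for q
    using that assms(2) by (intro monoD[OF F_mono, of q b t]) (auto simp: less_imp_le)
  then have "level (insert b I) u t = F b t" unfolding level_def
    using assms(1) F_bounds(1)[of b t] True by (intro Max_eqI) auto
  then show ?thesis using True by simp
next
  case False
  then have "{q \<in> insert b I. F q t < u} = {q \<in> I. F q t < u}" by auto
  then show ?thesis using False by (simp add: level_def)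
qed

lemma level_measurable: "finite I \<Longrightarrow> level I u \<in> borel_measurable borel"
proof (induction I rule: finite_linorder_max_induct)
  case empty
  then show ?case by (simp add: level_def)
next
  case (insert b I)
  note [measurable] = insert(3)
  have "level (insert b I) u = (\<lambda>t. if F b t < u then F b t else level I u t)"
    using level_insert[OF insert(1,2)] by auto
  then show ?case by simp
qed

lemma level_bounds:
  assumes "finite I" "0 < u" shows "0 \<le> level I u t" "level I u t < u"
  using assms by (auto simp: level_def)

text \<open>Split C according to whether the largest level b qualifies. Where it does, the event is
  just Y \<le> b, since every other level lies below b; elsewhere b contributes nothing and the
  induction hypothesis applies to the remaining part of C, which is why C is arbitrary in the
  induction.\<close>

lemma prob_finite_levels:
  assumes "finite I" "0 < u" "C \<in> sets borel"
  shows "(\<integral>\<omega>. level I u (T \<omega>) * indicator C (T \<omega>) \<partial>M) =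
    prob {\<omega> \<in> space M. (\<exists>q\<in>I. Y \<omega> \<le> q \<and> F q (T \<omega>) < u) \<and> T \<omega> \<in> C}"
  using assms
proof (induction I arbitrary: C rule: finite_linorder_max_induct)
  case empty
  then show ?case by (simp add: level_def)
next
  case (insert b I)
  note [measurable] = insert(5) level_measurable[OF insert(1)]
  have le: "Y \<omega> \<le> b" if "q \<in> I" "Y \<omega> \<le> q" for q \<omega> using insert(2) that by force
  let ?A = "C \<inter> {t. F b t < u}" and ?B = "C \<inter> {t. \<not> F b t < u}"
  have [measurable]: "?A \<in> sets borel" "?B \<in> sets borel" by measurable
  let ?f = "\<lambda>\<omega>. F b (T \<omega>) * indicator ?A (T \<omega>)" and ?g = "\<lambda>\<omega>. level I u (T \<omega>) * indicator ?B (T \<omega>)"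
  have "integrable M ?f"
    using F_bounds by (intro integrable_const_bound[where B=1]) (auto split: split_indicator)
  moreover have "integrable M ?g"
    using level_bounds[OF insert(1,4)]
    by (intro integrable_const_bound[where B=u]) (auto split: split_indicator simp: insert(4) less_imp_le)
  moreover have "level (insert b I) u (T \<omega>) * indicator C (T \<omega>) = ?f \<omega> + ?g \<omega>" for \<omega>
    by (simp add: level_insert[OF insert(1,2)] split: split_indicator)
  ultimately have "(\<integral>\<omega>. level (insert b I) u (T \<omega>) * indicator C (T \<omega>) \<partial>M) =
      (\<integral>\<omega>. ?f \<omega> \<partial>M) + (\<integral>\<omega>. ?g \<omega> \<partial>M)" by simp
  also have "\<dots> = prob {\<omega> \<in> space M. Y \<omega> \<le> b \<and> T \<omega> \<in> ?A} +
      prob {\<omega> \<in> space M. (\<exists>q\<in>I. Y \<omega> \<le> q \<and> F q (T \<omega>) < u) \<and> T \<omega> \<in> ?B}"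
    using F_cdf[of ?A b] insert(3)[OF insert(4), of ?B] by simp
  also have "\<dots> = prob ({\<omega> \<in> space M. Y \<omega> \<le> b \<and> T \<omega> \<in> ?A} \<union>
      {\<omega> \<in> space M. (\<exists>q\<in>I. Y \<omega> \<le> q \<and> F q (T \<omega>) < u) \<and> T \<omega> \<in> ?B})"
    using insert(1) by (intro finite_measure_Union[symmetric]) auto
  also have "{\<omega> \<in> space M. Y \<omega> \<le> b \<and> T \<omega> \<in> ?A} \<union>
      {\<omega> \<in> space M. (\<exists>q\<in>I. Y \<omega> \<le> q \<and> F q (T \<omega>) < u) \<and> T \<omega> \<in> ?B} =
      {\<omega> \<in> space M. (\<exists>q\<in>insert b I. Y \<omega> \<le> q \<and> F q (T \<omega>) < u) \<and> T \<omega> \<in> C}"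
    using le by blast
  finally show ?case .
qed

lemma F_Y_measurable: "(\<lambda>\<omega>. F (Y \<omega>) (T \<omega>)) \<in> borel_measurable M"
  by (rule measurable_mono_continuous[OF Y_measurable T_measurable F_measurable F_mono F_cont])

text \<open>Initial segments of an enumeration of the rationals: finite, so that
  \<open>level\<close> is a maximum, and increasing, so that probabilities converge along
  them.\<close>

definition "rats m = (\<lambda>i. real_of_rat (nat_to_rat_surj i)) ` {..<m::nat}"

lemma rats: "finite (rats m)" "m \<le> m' \<Longrightarrow> rats m \<subseteq> rats m'" "q \<in> \<rat> \<Longrightarrow> \<exists>m. q \<in> rats m" "rats m \<subseteq> \<rat>"
proof -
  assume "q \<in> \<rat>"
  then obtain r where "q = real_of_rat r" by (auto simp: Rats_def)
  moreover obtain i where "r = nat_to_rat_surj i" using surj_nat_to_rat_surj by (metis surjD)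
  ultimately show "\<exists>m. q \<in> rats m" by (intro exI[of _ "Suc i"]) (auto simp: rats_def)
qed (auto simp: rats_def)

text \<open>For v < u some rational level must have its F-value between v and u: the intermediate
  value theorem gives a point x with F-value inside this gap, and a rational slightly to the right
  of x still has F-value less than u.\<close>

lemma level_rats_tendsto:
  assumes u: "0 < u" "u < 1"
  shows "(\<lambda>m. level (rats m) u t) \<longlonglongrightarrow> u"
proof (rule order_tendstoI)
  fix v assume "u < v"
  then show "\<forall>\<^sub>F m in sequentially. level (rats m) u t < v"
    using level_bounds(2)[OF rats(1) u(1), of _ t] by (intro always_eventually) (auto intro: order.strict_trans)
next
  fix v assume v: "v < u"
  \<comment> \<open>v may be negative, while F only takes values between its limits 0 and 1; the
    midpoint of \<open>max v 0\<close> and u lies strictly between 0 and u, within reach of the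
    intermediate value theorem.\<close>
  define v' where "v' = (max v 0 + u) / 2"
  have v': "v < v'" "0 < v'" "v' < u" using v u by (auto simp: v'_def max_def)
  obtain a where a: "F a t < v'"
    using order_tendstoD(2)[OF F_bot[of t] v'(2)] by (auto simp: eventually_at_bot_linorder)
  obtain b where b: "v' < F b t"
    using order_tendstoD(1)[OF F_top[of t], of v'] v' u by (auto simp: eventually_at_top_linorder)
  have "a \<le> b" using a b monoD[OF F_mono, of b a t] by (cases "a \<le> b") auto
  then obtain x where x: "F x t = v'"
    using IVT'[of "\<lambda>y. F y t" a v' b] a b F_cont continuous_on_subset[of UNIV _ "{a..b}"] by fastforce
  obtain q where q: "q \<in> \<rat>" "x \<le> q" "F q t < u"
    using less_iff_rational_witness[OF F_mono F_cont, of x t u] x v' by auto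
  obtain m where m: "q \<in> rats m" using rats(3)[OF q(1)] ..
  have "v < level (rats m') u t" if "m \<le> m'" for m'
  proof -
    have "F q t \<le> level (rats m') u t"
      unfolding level_def using rats(1)[of m'] q rats(2)[OF that] m by (intro Max_ge) auto
    moreover have "v' \<le> F q t" using monoD[OF F_mono q(2)] x by metis
    ultimately show ?thesis using v' by simp
  qed
  then show "\<forall>\<^sub>F m in sequentially. v < level (rats m) u t" by (auto simp: eventually_sequentially)
qed

text \<open>Holding for every C, this says that F Y T is uniform and independent of T. The
  finite-level identity passes to the limit on both sides: dominated convergence for
  \<open>level\<close>, continuity from below for the events.\<close>

lemma prob_F_less:
  assumes u: "0 < u" "u < 1" and [measurable]: "C \<in> sets borel"
  shows "prob {\<omega> \<in> space M. F (Y \<omega>) (T \<omega>) < u \<and> T \<omega> \<in> C} = u * prob {\<omega> \<in> space M. T \<omega> \<in> C}"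
proof -
  define A where "A m = {\<omega> \<in> space M. (\<exists>q\<in>rats m. Y \<omega> \<le> q \<and> F q (T \<omega>) < u) \<and> T \<omega> \<in> C}" for m
  have [measurable]: "level (rats m) u \<in> borel_measurable borel" for m by (rule level_measurable[OF rats(1)])
  have "(\<lambda>m. \<integral>\<omega>. level (rats m) u (T \<omega>) * indicator C (T \<omega>) \<partial>M) \<longlonglongrightarrow> (\<integral>\<omega>. u * indicator C (T \<omega>) \<partial>M)"
    using level_bounds[OF rats(1) u(1)] u
    by (intro integral_dominated_convergence[where w="\<lambda>_. u"] AE_I2 tendsto_intros level_rats_tendsto)
       (auto split: split_indicator simp: abs_of_nonneg less_imp_le)
  then have "(\<lambda>m. prob (A m)) \<longlonglongrightarrow> (\<integral>\<omega>. u * indicator C (T \<omega>) \<partial>M)"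
    by (simp add: prob_finite_levels[OF rats(1) u(1)] A_def)
  also have "(\<integral>\<omega>. u * indicator C (T \<omega>) \<partial>M) = (\<integral>\<omega>. u * indicator {\<omega> \<in> space M. T \<omega> \<in> C} \<omega> \<partial>M)"
    by (intro Bochner_Integration.integral_cong) (auto split: split_indicator)
  also have "\<dots> = u * prob {\<omega> \<in> space M. T \<omega> \<in> C}" by simp
  finally have 1: "(\<lambda>m. prob (A m)) \<longlonglongrightarrow> u * prob {\<omega> \<in> space M. T \<omega> \<in> C}" .
  have "A m \<in> sets M" for m unfolding A_def using rats(1)[of m] by measurable
  moreover have "incseq A" unfolding A_def incseq_def using rats(2) by blast
  ultimately have "(\<lambda>m. prob (A m)) \<longlonglongrightarrow> prob (\<Union>m. A m)" by (intro finite_Lim_measure_incseq) auto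
  moreover have "(\<Union>m. A m) = {\<omega> \<in> space M. F (Y \<omega>) (T \<omega>) < u \<and> T \<omega> \<in> C}"
  proof (rule set_eqI)
    fix \<omega>
    have "(\<exists>m. \<exists>q\<in>rats m. Y \<omega> \<le> q \<and> F q (T \<omega>) < u) \<longleftrightarrow> (\<exists>q\<in>\<rat>. Y \<omega> \<le> q \<and> F q (T \<omega>) < u)"
      by (meson rats(3,4) subsetD)
    also have "\<dots> \<longleftrightarrow> F (Y \<omega>) (T \<omega>) < u" by (rule less_iff_rational_witness[OF F_mono F_cont, symmetric])
    finally show "\<omega> \<in> (\<Union>m. A m) \<longleftrightarrow> \<omega> \<in> {\<omega> \<in> space M. F (Y \<omega>) (T \<omega>) < u \<and> T \<omega> \<in> C}"
      unfolding A_def by simp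
  qed
  ultimately show ?thesis using 1 LIMSEQ_unique by metis
qed

text \<open>Each of the tails F < 1/2 - s and F \<ge> 1/2 + s has mass 1/2 - s. The strict deviation
  event lies inside their union and the weak one contains it, so the boundary values need no
  attention. The first bound serves the test pair, the second the calibration dyads.\<close>

lemma prob_F_deviation:
  assumes s: "0 < s" "s < 1 / 2" and [measurable]: "C \<in> sets borel"
  shows "prob {\<omega> \<in> space M. \<bar>1 / 2 - F (Y \<omega>) (T \<omega>)\<bar> > s \<and> T \<omega> \<in> C} \<le> (1 - 2 * s) * prob {\<omega> \<in> space M. T \<omega> \<in> C}"
    and "1 - 2 * s \<le> prob {\<omega> \<in> space M. \<bar>1 / 2 - F (Y \<omega>) (T \<omega>)\<bar> \<ge> s}"
proof -
  note [measurable] = F_Y_measurable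
  let ?U = "\<lambda>\<omega>. F (Y \<omega>) (T \<omega>)"
  have tail: "prob {\<omega> \<in> space M. ?U \<omega> \<ge> 1 / 2 + s \<and> T \<omega> \<in> C'} = (1 / 2 - s) * prob {\<omega> \<in> space M. T \<omega> \<in> C'}"
    if [measurable]: "C' \<in> sets borel" for C'
  proof -
    have "prob {\<omega> \<in> space M. T \<omega> \<in> C'} =
        prob ({\<omega> \<in> space M. ?U \<omega> < 1 / 2 + s \<and> T \<omega> \<in> C'} \<union> {\<omega> \<in> space M. ?U \<omega> \<ge> 1 / 2 + s \<and> T \<omega> \<in> C'})"
      by (intro arg_cong[where f=prob]) auto
    also have "\<dots> = prob {\<omega> \<in> space M. ?U \<omega> < 1 / 2 + s \<and> T \<omega> \<in> C'} + prob {\<omega> \<in> space M. ?U \<omega> \<ge> 1 / 2 + s \<and> T \<omega> \<in> C'}"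
      by (rule finite_measure_Union) auto
    finally show ?thesis using prob_F_less[of "1 / 2 + s" C'] s by (simp add: algebra_simps)
  qed
  have "prob {\<omega> \<in> space M. \<bar>1 / 2 - ?U \<omega>\<bar> > s \<and> T \<omega> \<in> C} \<le>
      prob ({\<omega> \<in> space M. ?U \<omega> < 1 / 2 - s \<and> T \<omega> \<in> C} \<union> {\<omega> \<in> space M. ?U \<omega> \<ge> 1 / 2 + s \<and> T \<omega> \<in> C})"
    by (intro finite_measure_mono) auto
  also have "\<dots> \<le> prob {\<omega> \<in> space M. ?U \<omega> < 1 / 2 - s \<and> T \<omega> \<in> C} + prob {\<omega> \<in> space M. ?U \<omega> \<ge> 1 / 2 + s \<and> T \<omega> \<in> C}"
    by (rule measure_Un_le) auto
  also have "\<dots> = (1 - 2 * s) * prob {\<omega> \<in> space M. T \<omega> \<in> C}"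
    using prob_F_less[of "1 / 2 - s" C] tail[of C] s by (simp add: algebra_simps)
  finally show "prob {\<omega> \<in> space M. \<bar>1 / 2 - ?U \<omega>\<bar> > s \<and> T \<omega> \<in> C} \<le> (1 - 2 * s) * prob {\<omega> \<in> space M. T \<omega> \<in> C}" .
  have "1 - 2 * s = prob {\<omega> \<in> space M. ?U \<omega> < 1 / 2 - s \<and> T \<omega> \<in> UNIV} + prob {\<omega> \<in> space M. ?U \<omega> \<ge> 1 / 2 + s \<and> T \<omega> \<in> UNIV}"
    using prob_F_less[of "1 / 2 - s" UNIV] tail[of UNIV] s by (simp add: algebra_simps prob_space)
  also have "\<dots> = prob ({\<omega> \<in> space M. ?U \<omega> < 1 / 2 - s \<and> T \<omega> \<in> UNIV} \<union> {\<omega> \<in> space M. ?U \<omega> \<ge> 1 / 2 + s \<and> T \<omega> \<in> UNIV})"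
    using s by (intro finite_measure_Union[symmetric]) auto
  also have "\<dots> \<le> prob {\<omega> \<in> space M. \<bar>1 / 2 - ?U \<omega>\<bar> \<ge> s}" by (intro finite_measure_mono) auto
  finally show "1 - 2 * s \<le> prob {\<omega> \<in> space M. \<bar>1 / 2 - ?U \<omega>\<bar> \<ge> s}" .
qed

end

section \<open>A single sample\<close>

locale sampled =
  fixes SX :: "'x measure" and SZ :: "'z measure" and D :: "('x \<times> real \<times> 'z) measure"
    and V :: "'v measure" and n :: nat and s :: "('a, 'x, 'z, 'v) sample"
  assumes sample: "dyadic_sample SX SZ D V n s"
begin

sublocale prob_space "pspace s" using sample by (simp add: dyadic_sample_def)

lemma node_measurable: "i \<in> {1..n} \<Longrightarrow> node s i \<in> pspace s \<rightarrow>\<^sub>M node_space SX SZ"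
  and node_distr: "i \<in> {1..n} \<Longrightarrow> distr (pspace s) (node_space SX SZ) (node s i) = D"
  and xi_unit: "i \<in> {1..n} \<Longrightarrow> \<omega> \<in> space (pspace s) \<Longrightarrow> xi s i \<omega> \<in> {0..1}"
  and eta_measurable: "(i, j) \<in> dyads {1..n} \<Longrightarrow> eta s i j \<in> borel_measurable (pspace s)"
  and eta_distr: "(i, j) \<in> dyads {1..n} \<Longrightarrow> distr (pspace s) borel (eta s i j) = uniform_measure lborel {0..1}"
  and nu_measurable: "(i, j) \<in> dyads {1..n} \<Longrightarrow> nu s i j \<in> pspace s \<rightarrow>\<^sub>M V"
  and nu_distr: "(i, j) \<in> dyads {1..n} \<Longrightarrow> distr (pspace s) V (nu s i j) = V"
  and sources_indep: "indep_sets (source_events SX SZ V s) (sources n)"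
  using sample by (auto simp: dyadic_sample_def)

section \<open>Independence of quantities built from disjoint sets of sources\<close>

text \<open>The information carried by a set of sources. Independence claims about the sample are
  reduced to disjointness of the source sets involved.\<close>

definition src_alg :: "source set \<Rightarrow> 'a measure" where
  "src_alg A = sigma (space (pspace s)) (\<Union>a\<in>A. source_events SX SZ V s a)"

lemma source_events_into_space: "source_events SX SZ V s a \<subseteq> Pow (space (pspace s))"
  by (cases a) auto

lemma space_src_alg [simp]: "space (src_alg A) = space (pspace s)"
  unfolding src_alg_def using source_events_into_space by (intro space_measure_of) auto

lemma sets_src_alg: "sets (src_alg A) = sigma_sets (space (pspace s)) (\<Union>a\<in>A. source_events SX SZ V s a)"
  unfolding src_alg_def using source_events_into_space by (intro sets_measure_of) auto

lemma source_events_in_src_alg: "a \<in> A \<Longrightarrow> E \<in> source_events SX SZ V s a \<Longrightarrow> E \<in> sets (src_alg A)"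
  unfolding sets_src_alg by (intro sigma_sets.Basic) auto

lemma src_alg_mono: "A \<subseteq> B \<Longrightarrow> sets (src_alg A) \<subseteq> sets (src_alg B)"
  unfolding sets_src_alg by (intro sigma_sets_mono') auto

lemma src_alg_subalgebra: "A \<subseteq> sources n \<Longrightarrow> subalgebra (pspace s) (src_alg A)"
proof -
  assume A: "A \<subseteq> sources n"
  have "source_events SX SZ V s a \<subseteq> events" if "a \<in> A" for a
    using sources_indep A that by (auto simp: indep_sets_def)
  then have "sets (src_alg A) \<subseteq> events" unfolding sets_src_alg by (intro sets.sigma_sets_subset) blast
  then show ?thesis by (simp add: subalgebra_def)
qed

lemma src_alg_measurable: "f \<in> src_alg A \<rightarrow>\<^sub>M N \<Longrightarrow> A \<subseteq> sources n \<Longrightarrow> f \<in> pspace s \<rightarrow>\<^sub>M N"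
  using measurable_from_subalg[OF src_alg_subalgebra] .

lemma Int_stable_source_events: "Int_stable (source_events SX SZ V s a)"
proof (rule Int_stableI)
  fix E E' assume E: "E \<in> source_events SX SZ V s a" "E' \<in> source_events SX SZ V s a"
  have *: "(f -` B \<inter> U) \<inter> (f -` B' \<inter> U) = f -` (B \<inter> B') \<inter> U" for f :: "'a \<Rightarrow> 'q" and B B' U
    by auto
  show "E \<inter> E' \<in> source_events SX SZ V s a"
  proof (cases a)
    case (Node i)
    then obtain B B' where "E = node s i -` B \<inter> space (pspace s)" "E' = node s i -` B' \<inter> space (pspace s)"
      "B \<in> sets (node_space SX SZ)" "B' \<in> sets (node_space SX SZ)" using E by auto
    then show ?thesis using Node by (auto intro!: exI[of _ "B \<inter> B'"])
  next
    case (Eta i j)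
    then obtain B B' where "E = eta s i j -` B \<inter> space (pspace s)" "E' = eta s i j -` B' \<inter> space (pspace s)"
      "B \<in> sets borel" "B' \<in> sets borel" using E by auto
    then show ?thesis using Eta by (auto intro!: exI[of _ "B \<inter> B'"])
  next
    case (Nu i j)
    then obtain B B' where "E = nu s i j -` B \<inter> space (pspace s)" "E' = nu s i j -` B' \<inter> space (pspace s)"
      "B \<in> sets V" "B' \<in> sets V" using E by auto
    then show ?thesis using Nu by (auto intro!: exI[of _ "B \<inter> B'"])
  qed
qed

text \<open>Each source contributes a pi-system; independent pi-systems may be grouped along
  disjoint index sets without losing independence of the generated sigma-algebras.\<close>

lemma src_alg_indep:
  assumes "A \<subseteq> sources n" "B \<subseteq> sources n" "A \<inter> B = {}"
  shows "indep_set (sets (src_alg A)) (sets (src_alg B))"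
proof -
  have "indep_sets (\<lambda>b. sigma_sets (space (pspace s)) (\<Union>a\<in>case_bool A B b. source_events SX SZ V s a)) UNIV"
  proof (rule indep_sets_collect_sigma)
    show "indep_sets (source_events SX SZ V s) (\<Union>b\<in>UNIV. case_bool A B b)"
      using assms(1,2) by (intro indep_sets_mono_index[OF _ sources_indep]) (auto split: bool.splits)
    show "disjoint_family_on (case_bool A B) UNIV"
      using assms(3) by (auto simp: disjoint_family_on_def split: bool.splits)
  qed (rule Int_stable_source_events)
  then show ?thesis unfolding indep_set_def sets_src_alg
    by (rule indep_sets_mono_sets) (auto split: bool.splits)
qed

lemma Eta_in_sources: "(i, j) \<in> dyads {1..n} \<Longrightarrow> Eta i j \<in> sources n"
  and Nu_in_sources: "(i, j) \<in> dyads {1..n} \<Longrightarrow> Nu i j \<in> sources n"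
  and Node_in_sources: "i \<in> {1..n} \<Longrightarrow> Node i \<in> sources n"
  by (auto simp: sources_def)

lemma measurable_src:
  assumes "f \<in> pspace s \<rightarrow>\<^sub>M N" "a \<in> A"
    and "\<And>B. B \<in> sets N \<Longrightarrow> f -` B \<inter> space (pspace s) \<in> source_events SX SZ V s a"
  shows "f \<in> src_alg A \<rightarrow>\<^sub>M N"
  using assms measurable_space[OF assms(1)] source_events_in_src_alg by (intro measurableI) auto

lemma node_src: "i \<in> {1..n} \<Longrightarrow> Node i \<in> A \<Longrightarrow> node s i \<in> src_alg A \<rightarrow>\<^sub>M node_space SX SZ"
  by (rule measurable_src[OF node_measurable, where a="Node i"]) (simp_all, blast)

lemma eta_src: "(i, j) \<in> dyads {1..n} \<Longrightarrow> Eta i j \<in> A \<Longrightarrow> eta s i j \<in> borel_measurable (src_alg A)"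
  by (rule measurable_src[OF eta_measurable, where a="Eta i j"]) (simp_all, blast)

lemma nu_src: "(i, j) \<in> dyads {1..n} \<Longrightarrow> Nu i j \<in> A \<Longrightarrow> nu s i j \<in> src_alg A \<rightarrow>\<^sub>M V"
  by (rule measurable_src[OF nu_measurable, where a="Nu i j"]) (simp_all, blast)

lemma
  assumes "i \<in> {1..n}" "Node i \<in> A"
  shows Xcov_src: "Xcov s i \<in> src_alg A \<rightarrow>\<^sub>M SX"
    and xi_src: "xi s i \<in> borel_measurable (src_alg A)"
    and zeta_src: "zeta s i \<in> src_alg A \<rightarrow>\<^sub>M SZ"
proof -
  have [measurable]: "node s i \<in> src_alg A \<rightarrow>\<^sub>M SX \<Otimes>\<^sub>M borel \<Otimes>\<^sub>M SZ"
    using node_src[OF assms] by (simp add: node_space_def)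
  have "(\<lambda>\<omega>. fst (node s i \<omega>)) \<in> src_alg A \<rightarrow>\<^sub>M SX" by measurable
  then show "Xcov s i \<in> src_alg A \<rightarrow>\<^sub>M SX" by (simp add: node_def)
  have "(\<lambda>\<omega>. fst (snd (node s i \<omega>))) \<in> borel_measurable (src_alg A)" by measurable
  then show "xi s i \<in> borel_measurable (src_alg A)" by (simp add: node_def)
  have "(\<lambda>\<omega>. snd (snd (node s i \<omega>))) \<in> src_alg A \<rightarrow>\<^sub>M SZ" by measurable
  then show "zeta s i \<in> src_alg A \<rightarrow>\<^sub>M SZ" by (simp add: node_def)
qed

text \<open>The form in which independence enters the thinning identity: whatever is computed from A
  ignores the coin \<open>eta i j\<close> that decides on observation.\<close>

lemma eta_indep:
  assumes "(i, j) \<in> dyads {1..n}" "A \<subseteq> sources n" "Eta i j \<notin> A"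
  shows "indep_set (sets (src_alg A)) {eta s i j -` B \<inter> space (pspace s) | B. B \<in> sets borel}"
proof -
  have "indep_set (sets (src_alg A)) (sets (src_alg {Eta i j}))"
    using assms Eta_in_sources by (intro src_alg_indep) auto
  moreover have "{eta s i j -` B \<inter> space (pspace s) | B. B \<in> sets borel} \<subseteq> sets (src_alg {Eta i j})"
    using source_events_in_src_alg[of "Eta i j" "{Eta i j}"] by auto
  ultimately show ?thesis unfolding indep_sets2_eq by blast
qed

text \<open>Makes the covariance of two dyads without a common node vanish, since such dyads use
  disjoint sets of sources.\<close>

lemma expectation_mult_src:
  fixes f h :: "'a \<Rightarrow> real"
  assumes "A \<subseteq> sources n" "B \<subseteq> sources n" "A \<inter> B = {}"
    and f: "f \<in> borel_measurable (src_alg A)" "integrable (pspace s) f"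
    and h: "h \<in> borel_measurable (src_alg B)" "integrable (pspace s) h"
  shows "expectation (\<lambda>\<omega>. f \<omega> * h \<omega>) = expectation f * expectation h"
proof (rule indep_var_lebesgue_integral)
  have *: "sigma_sets (space (pspace s)) {f -` A \<inter> space (pspace s) | A. A \<in> sets borel} \<subseteq> sets (src_alg A)"
    if "f \<in> borel_measurable (src_alg A)" for f :: "'a \<Rightarrow> real" and A
    using sets.sigma_sets_subset[of "{f -` A \<inter> space (pspace s) | A. A \<in> sets borel}" "src_alg A"]
      measurable_sets[OF that] by auto
  show "indep_var borel f borel h"
    unfolding indep_var_eq
  proof (intro conjI)
    show "f \<in> borel_measurable (pspace s)" "h \<in> borel_measurable (pspace s)"
      using f h assms(1,2) src_alg_measurable by auto
    show "indep_set (sigma_sets (space (pspace s)) {f -` A \<inter> space (pspace s) | A. A \<in> sets borel})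
        (sigma_sets (space (pspace s)) {h -` A \<inter> space (pspace s) | A. A \<in> sets borel})"
      using src_alg_indep[OF assms(1-3)] *[OF f(1)] *[OF h(1)] unfolding indep_sets2_eq by blast
  qed
qed (use f h in auto)

end

text \<open>\<open>sparse\<close> makes the cap at 1 in \<open>obs\<close> void, so that
  \<open>p\<close> itself is the observation probability given the nodes and stays strictly between
  0 and 1. Since \<rho> tends to 0, it holds for all large even n.\<close>

locale model = sampled SX SZ D V n s
  for SX :: "'x measure" and SZ :: "'z measure" and D :: "('x \<times> real \<times> 'z) measure"
    and V :: "'v measure" and n :: nat and s :: "('a, 'x, 'z, 'v) sample" +
  fixes g :: "'x \<Rightarrow> 'z \<Rightarrow> 'x \<Rightarrow> 'z \<Rightarrow> 'v \<Rightarrow> real" and w :: "real \<Rightarrow> real \<Rightarrow> real" and r c C :: real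
  assumes g_measurable: "(\<lambda>(x, z, x', z', v). g x z x' z' v) \<in> borel_measurable (SX \<Otimes>\<^sub>M SZ \<Otimes>\<^sub>M SX \<Otimes>\<^sub>M SZ \<Otimes>\<^sub>M V)"
    and w_measurable: "(\<lambda>(u, v). w u v) \<in> borel_measurable (restrict_space borel ({0..1} \<times> {0..1}))"
    and w_bounds: "\<And>u v. u \<in> {0..1} \<Longrightarrow> v \<in> {0..1} \<Longrightarrow> c \<le> w u v \<and> w u v \<le> C"
    and r_pos: "0 < r" and c_pos: "0 < c" and sparse: "r * C < 1"
begin

abbreviation "p \<equiv> pmat w r s"
abbreviation "obsv \<equiv> obs w r s"
abbreviation "Y \<equiv> resp g s"

lemma C_pos: "0 < C" using w_bounds[of 0 0] c_pos by auto

lemma p_src: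
  assumes "i \<in> {1..n}" "j \<in> {1..n}" "Node i \<in> A" "Node j \<in> A"
  shows "p i j \<in> borel_measurable (src_alg A)"
proof -
  have [measurable]: "xi s i \<in> borel_measurable (src_alg A)" "xi s j \<in> borel_measurable (src_alg A)"
    using xi_src assms by auto
  have "(\<lambda>\<omega>. (xi s i \<omega>, xi s j \<omega>)) \<in> src_alg A \<rightarrow>\<^sub>M restrict_space borel ({0..1} \<times> {0..1})"
    using xi_unit assms by (intro measurable_restrict_space2) auto
  from measurable_compose[OF this w_measurable]
  have [measurable]: "(\<lambda>\<omega>. w (xi s i \<omega>) (xi s j \<omega>)) \<in> borel_measurable (src_alg A)" by simp
  show ?thesis unfolding pmat_def by measurable
qed

lemma p_bounds:
  assumes "i \<in> {1..n}" "j \<in> {1..n}" "\<omega> \<in> space (pspace s)"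
  shows "c * r \<le> p i j \<omega>" "p i j \<omega> \<le> C * r" "0 < p i j \<omega>" "p i j \<omega> < 1"
proof -
  have b: "c \<le> w (xi s i \<omega>) (xi s j \<omega>)" "w (xi s i \<omega>) (xi s j \<omega>) \<le> C"
    using w_bounds xi_unit assms by auto
  show 1: "c * r \<le> p i j \<omega>" and 2: "p i j \<omega> \<le> C * r" using b r_pos by (auto simp: pmat_def mult.commute)
  have "0 < c * r" using c_pos r_pos by simp
  then show "0 < p i j \<omega>" using 1 by simp
  show "p i j \<omega> < 1" using 2 sparse by (simp add: mult.commute)
qed

lemma dyadsD: "(i, j) \<in> dyads A \<Longrightarrow> i \<in> A \<and> j \<in> A \<and> i < j"
  by (auto simp: dyads_def)

lemma obs_eq:
  assumes "(i, j) \<in> dyads {1..n}" "\<omega> \<in> space (pspace s)"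
  shows "obsv i j \<omega> = of_bool (eta s i j \<omega> \<le> p i j \<omega>)"
  using p_bounds[of i j \<omega>] dyadsD[OF assms(1)] assms(2) by (auto simp: obs_def Let_def pmat_def min_def)

lemma obs_values: "obsv i j \<omega> \<in> {0, 1}"
  by (auto simp: obs_def Let_def)

lemma obs_nonneg: "0 \<le> obsv i j \<omega>"
  by (auto simp: obs_def Let_def)

lemma obs_src:
  assumes "(i, j) \<in> dyads {1..n}" "Node i \<in> A" "Node j \<in> A" "Eta i j \<in> A"
  shows "obsv i j \<in> borel_measurable (src_alg A)"
proof -
  have [measurable]: "p i j \<in> borel_measurable (src_alg A)" "eta s i j \<in> borel_measurable (src_alg A)"
    using p_src eta_src dyadsD[OF assms(1)] assms by auto
  have "(\<lambda>\<omega>. of_bool (eta s i j \<omega> \<le> p i j \<omega>) :: real) \<in> borel_measurable (src_alg A)" by measurable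
  then show ?thesis using obs_eq[OF assms(1)] by (subst measurable_cong) auto
qed

lemma resp_src:
  assumes "(i, j) \<in> dyads {1..n}" "Node i \<in> A" "Node j \<in> A" "Nu i j \<in> A"
  shows "Y i j \<in> borel_measurable (src_alg A)"
proof -
  have ij: "i \<in> {1..n}" "j \<in> {1..n}" "i < j" using dyadsD[OF assms(1)] by auto
  note [measurable] = Xcov_src[OF ij(1) assms(2)] Xcov_src[OF ij(2) assms(3)] zeta_src[OF ij(1) assms(2)]
    zeta_src[OF ij(2) assms(3)] nu_src[OF assms(1,4)] g_measurable
  have "(\<lambda>\<omega>. (\<lambda>(x, z, x', z', v). g x z x' z' v) (Xcov s i \<omega>, zeta s i \<omega>, Xcov s j \<omega>, zeta s j \<omega>, nu s i j \<omega>))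
      \<in> borel_measurable (src_alg A)" by measurable
  moreover have "min i j = i" "max i j = j" using ij(3) by auto
  ultimately show ?thesis by (simp add: resp_def[abs_def] Let_def)
qed

lemma prob_eta_le:
  assumes "(i, j) \<in> dyads {1..n}"
  shows "prob {\<omega> \<in> space (pspace s). eta s i j \<omega> \<le> C * r} = C * r"
proof -
  have "emeasure (pspace s) {\<omega> \<in> space (pspace s). eta s i j \<omega> \<le> C * r} =
      emeasure (distr (pspace s) borel (eta s i j)) {..C * r}"
    using eta_measurable[OF assms] by (subst emeasure_distr) (auto intro!: arg_cong[where f="emeasure _"])
  also have "\<dots> = ennreal (C * r)"
    unfolding eta_distr[OF assms] using C_pos r_pos sparse by (intro emeasure_uniform_unit_atMost) (auto simp: mult.commute)
  finally show ?thesis using C_pos r_pos by (simp add: measure_def)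
qed

text \<open>The larger event involves the coin alone, not the nodes of the dyad, so its probability
  factorises against anything that ignores the coin.\<close>

lemma observed_subset:
  assumes "(i, j) \<in> dyads {1..n}"
  shows "{\<omega> \<in> space (pspace s). obsv i j \<omega> = 1} \<subseteq> {\<omega> \<in> space (pspace s). eta s i j \<omega> \<le> C * r}"
  using obs_eq[OF assms] p_bounds dyadsD[OF assms] by (auto split: if_splits intro: order.trans)

lemma obs_measurable [measurable]:
  "(i, j) \<in> dyads {1..n} \<Longrightarrow> obsv i j \<in> borel_measurable (pspace s)"
  using Eta_in_sources[of i j] Node_in_sources dyadsD[of i j]
  by (intro src_alg_measurable[OF obs_src[where A="sources n"]]) blast+

lemma resp_measurable [measurable]:
  "(i, j) \<in> dyads {1..n} \<Longrightarrow> Y i j \<in> borel_measurable (pspace s)"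
  using Nu_in_sources[of i j] Node_in_sources dyadsD[of i j]
  by (intro src_alg_measurable[OF resp_src[where A="sources n"]]) blast+

lemma p_measurable [measurable]:
  "i \<in> {1..n} \<Longrightarrow> j \<in> {1..n} \<Longrightarrow> p i j \<in> borel_measurable (pspace s)"
  using Node_in_sources by (intro src_alg_measurable[OF p_src[where A="sources n"]]) auto

text \<open>Observation forces \<open>eta i j\<close> below C * r, hence costs a factor C * r
  against any event that ignores this coin, even one that depends on the two nodes.\<close>

lemma prob_observed_and_le:
  assumes ij: "(i, j) \<in> dyads {1..n}" and A: "A \<subseteq> sources n" "Eta i j \<notin> A" and B: "B \<in> sets (src_alg A)"
  shows "prob {\<omega> \<in> B. obsv i j \<omega> = 1} \<le> C * r * prob B"
proof -
  have Bm: "B \<in> events" using B src_alg_subalgebra[OF A(1)] by (auto simp: subalgebra_def)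
  note [measurable] = Bm eta_measurable[OF ij]
  have "prob {\<omega> \<in> B. obsv i j \<omega> = 1} \<le> prob (B \<inter> (eta s i j -` {..C * r} \<inter> space (pspace s)))"
    using observed_subset[OF ij] sets.sets_into_space[OF Bm] by (intro finite_measure_mono) auto
  also have "\<dots> = prob B * prob (eta s i j -` {..C * r} \<inter> space (pspace s))"
    by (rule indep_setD[OF eta_indep[OF ij A]]) (use B in \<open>auto intro!: exI[of _ "{..C * r}"]\<close>)
  also have "eta s i j -` {..C * r} \<inter> space (pspace s) = {\<omega> \<in> space (pspace s). eta s i j \<omega> \<le> C * r}" by auto
  finally show ?thesis by (simp add: prob_eta_le[OF ij] mult.commute)
qed

lemma prob_observed_le:
  assumes ij: "(i, j) \<in> dyads {1..n}"
  shows "prob {\<omega> \<in> space (pspace s). obsv i j \<omega> = 1} \<le> C * r"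
  using prob_observed_and_le[OF ij, of "{}" "space (pspace s)"] sets.top[of "src_alg {}"] by (simp add: prob_space)

text \<open>Distinct dyads have distinct coins, so the squared factor also holds for dyads with a
  common node. It cancels the product of two weights, which is of size 1/\<rho>^2, and keeps the
  mixed moments of neighbouring dyads bounded.\<close>

lemma prob_two_observed_le:
  assumes ij: "(i, j) \<in> dyads {1..n}" "(i', j') \<in> dyads {1..n}" "(i, j) \<noteq> (i', j')"
  shows "prob {\<omega> \<in> space (pspace s). obsv i j \<omega> = 1 \<and> obsv i' j' \<omega> = 1} \<le> (C * r)\<^sup>2"
proof -
  let ?B = "{\<omega> \<in> space (pspace s). eta s i j \<omega> \<le> C * r}"
  have [measurable]: "eta s i j \<in> borel_measurable (src_alg {Eta i j})" using ij eta_src by auto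
  have B: "?B \<in> sets (src_alg {Eta i j})" using measurable_sets[of "eta s i j" "src_alg {Eta i j}" borel "{..C * r}"]
    by (simp add: vimage_def Int_def conj_commute)
  then have [measurable]: "?B \<in> events"
    using src_alg_subalgebra[of "{Eta i j}"] Eta_in_sources[OF ij(1)] by (auto simp: subalgebra_def)
  have "prob {\<omega> \<in> space (pspace s). obsv i j \<omega> = 1 \<and> obsv i' j' \<omega> = 1} \<le> prob {\<omega> \<in> ?B. obsv i' j' \<omega> = 1}"
    using observed_subset[OF ij(1)] obs_measurable[OF ij(2)] by (intro finite_measure_mono) auto
  also have "\<dots> \<le> C * r * prob ?B"
    using ij Eta_in_sources by (intro prob_observed_and_le[OF ij(2) _ _ B]) auto
  finally show ?thesis by (simp add: prob_eta_le[OF ij(1)] power2_eq_square)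
qed

text \<open>Both sides equal the mean of 1 - p on B. Thinning with 1/p - 1 on B cancels to 1 - p;
  thinning with the plain indicator of B gives P(B, M = 1) as the mean of p on B, and the rest of B
  is the missing part.\<close>

lemma expectation_weight:
  assumes ij: "(i, j) \<in> dyads {1..n}" and A: "A \<subseteq> sources n" "Eta i j \<notin> A" "Node i \<in> A" "Node j \<in> A"
    and B: "B \<in> sets (src_alg A)"
  shows "expectation (\<lambda>\<omega>. obsv i j \<omega> * (1 / p i j \<omega> - 1) * indicator B \<omega>) = prob {\<omega> \<in> B. obsv i j \<omega> = 0}"
proof -
  have ij': "i \<in> {1..n}" "j \<in> {1..n}" using dyadsD[OF ij] by auto
  have Bm [measurable]: "B \<in> events" using B src_alg_subalgebra[OF A(1)] by (auto simp: subalgebra_def)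
  have p [measurable]: "p i j \<in> borel_measurable (src_alg A)" using p_src ij' A by auto
  have pm [measurable]: "p i j \<in> borel_measurable (pspace s)" "obsv i j \<in> borel_measurable (pspace s)"
    using p_measurable[OF ij'] obs_measurable[OF ij] by auto
  note thin = nn_integral_thinning[OF prob_space_axioms src_alg_subalgebra[OF A(1)] eta_indep[OF ij A(1,2)]
      eta_measurable[OF ij] eta_distr[OF ij] p, of "\<lambda>\<omega>. ennreal (f \<omega>)" for f]
  have pb: "0 \<le> p i j \<omega> \<and> p i j \<omega> \<le> 1" "0 < p i j \<omega>" "p i j \<omega> < 1" "p i j \<omega> \<noteq> 0" if "\<omega> \<in> space (pspace s)" for \<omega>
    using p_bounds[OF ij' that] by auto
  have 1: "(\<integral>\<^sup>+\<omega>. ennreal (obsv i j \<omega> * (1 / p i j \<omega> - 1) * indicator B \<omega>) \<partial>pspace s) =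
      (\<integral>\<^sup>+\<omega>. ennreal ((1 / p i j \<omega> - 1) * indicator B \<omega>) * indicator {\<omega>. eta s i j \<omega> \<le> p i j \<omega>} \<omega> \<partial>pspace s)"
    by (intro nn_integral_cong) (auto simp: obs_eq[OF ij] split: split_indicator)
  also have "\<dots> = (\<integral>\<^sup>+\<omega>. ennreal ((1 / p i j \<omega> - 1) * indicator B \<omega>) * ennreal (p i j \<omega>) \<partial>pspace s)"
    using B pb by (intro thin) auto
  also have "\<dots> = (\<integral>\<^sup>+\<omega>. ennreal ((1 - p i j \<omega>) * indicator B \<omega>) \<partial>pspace s)"
    using pb by (intro nn_integral_cong)
      (auto split: split_indicator simp: field_simps simp flip: ennreal_mult'')
  finally have a: "expectation (\<lambda>\<omega>. obsv i j \<omega> * (1 / p i j \<omega> - 1) * indicator B \<omega>) =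
      expectation (\<lambda>\<omega>. (1 - p i j \<omega>) * indicator B \<omega>)"
    using pb obs_values[of i j]
    using obs_nonneg[of i j]
    by (subst (1 2) integral_eq_nn_integral) (auto intro!: AE_I2 mult_nonneg_nonneg simp: less_imp_le split: split_indicator)
  have "(\<integral>\<^sup>+\<omega>. ennreal (indicator {\<omega> \<in> B. obsv i j \<omega> = 1} \<omega>) \<partial>pspace s) =
      (\<integral>\<^sup>+\<omega>. ennreal (indicator B \<omega>) * indicator {\<omega>. eta s i j \<omega> \<le> p i j \<omega>} \<omega> \<partial>pspace s)"
    using sets.sets_into_space[OF Bm] by (intro nn_integral_cong) (auto simp: obs_eq[OF ij] split: split_indicator)
  also have "\<dots> = (\<integral>\<^sup>+\<omega>. ennreal (indicator B \<omega>) * ennreal (p i j \<omega>) \<partial>pspace s)"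
    using B pb by (intro thin) auto
  also have "\<dots> = (\<integral>\<^sup>+\<omega>. ennreal (p i j \<omega> * indicator B \<omega>) \<partial>pspace s)"
    by (intro nn_integral_cong) (auto split: split_indicator)
  finally have "expectation (indicator {\<omega> \<in> B. obsv i j \<omega> = 1}) = expectation (\<lambda>\<omega>. p i j \<omega> * indicator B \<omega>)"
    using pb by (subst (1 2) integral_eq_nn_integral) (auto intro!: AE_I2 split: split_indicator)
  moreover have "expectation (indicator {\<omega> \<in> B. obsv i j \<omega> = 1}) = prob {\<omega> \<in> B. obsv i j \<omega> = 1}" by simp
  moreover have "expectation (\<lambda>\<omega>. (1 - p i j \<omega>) * indicator B \<omega>) = prob B - expectation (\<lambda>\<omega>. p i j \<omega> * indicator B \<omega>)"
  proof -
    have "integrable (pspace s) (\<lambda>\<omega>. p i j \<omega> * indicator B \<omega>)"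
      using pb by (intro integrable_const_bound[where B=1]) (auto split: split_indicator)
    moreover have "integrable (pspace s) (indicator B :: 'a \<Rightarrow> real)" by (simp add: emeasure_eq_measure)
    ultimately show ?thesis by (simp add: left_diff_distrib)
  qed
  moreover have "prob B = prob {\<omega> \<in> B. obsv i j \<omega> = 1} + prob {\<omega> \<in> B. obsv i j \<omega> = 0}"
  proof -
    have "B = {\<omega> \<in> B. obsv i j \<omega> = 1} \<union> {\<omega> \<in> B. obsv i j \<omega> = 0}" using obs_values[of i j] by auto
    then have "prob B = prob ({\<omega> \<in> B. obsv i j \<omega> = 1} \<union> {\<omega> \<in> B. obsv i j \<omega> = 0})" by simp
    also have "\<dots> = prob {\<omega> \<in> B. obsv i j \<omega> = 1} + prob {\<omega> \<in> B. obsv i j \<omega> = 0}"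
      by (rule finite_measure_Union) auto
    finally show ?thesis .
  qed
  ultimately show ?thesis using a by linarith
qed

end

section \<open>Conditioning on an event, and lower bounds for conditional probabilities\<close>

lemma (in prob_space) conditioned_on_event:
  assumes A: "A \<in> events" "0 < prob A"
  shows "prob_space (uniform_measure M A)"
    and "B \<in> events \<Longrightarrow> measure (uniform_measure M A) B = prob (A \<inter> B) / prob A"
    and "B \<in> events \<Longrightarrow> measure (uniform_measure M A) B \<le> prob B / prob A"
    and "B \<in> events \<Longrightarrow> measure (uniform_measure M A) (B \<inter> A) = measure (uniform_measure M A) B"
proof -
  have e: "emeasure M A \<noteq> 0" "emeasure M A \<noteq> \<infinity>" using A by (auto simp: emeasure_eq_measure)
  show "prob_space (uniform_measure M A)" by (rule prob_space_uniform_measure[OF e])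
  show *: "measure (uniform_measure M A) B = prob (A \<inter> B) / prob A" if "B \<in> events" for B
    using e that by simp
  show "measure (uniform_measure M A) B \<le> prob B / prob A" if "B \<in> events"
    using A that unfolding *[OF that] by (intro divide_right_mono finite_measure_mono) auto
  show "measure (uniform_measure M A) (B \<inter> A) = measure (uniform_measure M A) B" if "B \<in> events"
  proof -
    have "A \<inter> (B \<inter> A) = A \<inter> B" by auto
    then show ?thesis using *[of B] *[of "B \<inter> A"] that A(1) by simp
  qed
qed

text \<open>Events of the sigma-algebra of T are preimages of Borel sets, so averages over them can
  be written with an indicator evaluated at T.\<close>

lemma (in prob_space) cond_exp_given_rv:
  fixes T :: "'a \<Rightarrow> real"
  assumes T: "T \<in> borel_measurable M"
  shows "finite_measure_subalgebra M (vimage_algebra (space M) T borel)"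
    and "sets (vimage_algebra (space M) T borel) = {T -` C \<inter> space M | C. C \<in> sets borel}"
    and "integrable M f \<Longrightarrow> C \<in> sets borel \<Longrightarrow>
      (\<integral>\<omega>. real_cond_exp M (vimage_algebra (space M) T borel) f \<omega> * indicator C (T \<omega>) \<partial>M) =
      (\<integral>\<omega>. f \<omega> * indicator C (T \<omega>) \<partial>M)"
proof -
  show s: "sets (vimage_algebra (space M) T borel) = {T -` C \<inter> space M | C. C \<in> sets borel}"
    by (rule sets_vimage_algebra2) simp
  have "subalgebra M (vimage_algebra (space M) T borel)"
    unfolding subalgebra_def s using T by auto
  then show sub: "finite_measure_subalgebra M (vimage_algebra (space M) T borel)" by unfold_locales
  interpret F: finite_measure_subalgebra M "vimage_algebra (space M) T borel" by (rule sub)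
  assume f: "integrable M f" and C: "C \<in> sets borel"
  have eq: "indicator C (T \<omega>) = indicator (T -` C \<inter> space M) \<omega>" if "\<omega> \<in> space M" for \<omega>
    using that by (auto split: split_indicator)
  have "set_lebesgue_integral M (T -` C \<inter> space M) f =
      set_lebesgue_integral M (T -` C \<inter> space M) (real_cond_exp M (vimage_algebra (space M) T borel) f)"
    using C by (intro F.real_cond_exp_intA f) (auto simp: s)
  then show "(\<integral>\<omega>. real_cond_exp M (vimage_algebra (space M) T borel) f \<omega> * indicator C (T \<omega>) \<partial>M) =
      (\<integral>\<omega>. f \<omega> * indicator C (T \<omega>) \<partial>M)"
    unfolding set_lebesgue_integral_def by (simp add: mult.commute eq cong: Bochner_Integration.integral_cong)
qed

text \<open>
  Testing the conditional probability on the event where it falls below its target avoids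
  conditional expectations of all auxiliary events.
\<close>

lemma (in prob_space) cond_prob_lower_bound:
  fixes T :: "'a \<Rightarrow> real"
  defines "cp \<equiv> \<lambda>A E. real_cond_exp (uniform_measure M A) (vimage_algebra (space M) T borel) (indicator E)"
  assumes A: "A \<in> events" "1 / 2 \<le> prob A" and T [measurable]: "T \<in> borel_measurable M"
    and E: "E \<in> events" and G: "G \<in> events" and H: "H \<in> events"
    and sub: "A - E \<subseteq> G \<union> H" and \<epsilon>: "0 < \<epsilon>"
    and G_le: "\<And>C. C \<in> sets borel \<Longrightarrow> measure (uniform_measure M A) {\<omega> \<in> space M. \<omega> \<in> G \<and> T \<omega> \<in> C}
      \<le> (\<alpha> + \<epsilon>) * measure (uniform_measure M A) {\<omega> \<in> space M. T \<omega> \<in> C}"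
  shows "{\<omega> \<in> space M. cp A E \<omega> < 1 - \<alpha> - 2 * \<epsilon>} \<in> events"
    and "prob {\<omega> \<in> space M. cp A E \<omega> < 1 - \<alpha> - 2 * \<epsilon>} \<le> 2 * prob H / \<epsilon> + prob (space M - A)"
proof -
  let ?Q = "uniform_measure M A"
  have A0: "0 < prob A" using A(2) by linarith
  interpret Q: prob_space ?Q by (rule conditioned_on_event(1)[OF A(1) A0])
  have TQ: "T \<in> borel_measurable ?Q" using T by simp
  let ?F = "vimage_algebra (space M) T borel"
  have cond: "finite_measure_subalgebra ?Q ?F" using Q.cond_exp_given_rv(1)[OF TQ] by simp
  have setsF: "sets ?F = {T -` C \<inter> space M | C. C \<in> sets borel}" using Q.cond_exp_given_rv(2)[OF TQ] by simp
  interpret F: finite_measure_subalgebra ?Q ?F by (rule cond)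
  have cpm: "cp A E \<in> borel_measurable ?F" unfolding cp_def by (rule borel_measurable_cond_exp)
  \<comment> \<open>Where the conditional probability falls short by 2 * \<epsilon>. Being an event
    of the sigma-algebra of T, it has the form T \<in> C for a Borel set C, to which
    \<open>G_le\<close> applies.\<close>
  let ?B = "{\<omega> \<in> space M. cp A E \<omega> < 1 - \<alpha> - 2 * \<epsilon>}"
  have "{\<omega> \<in> space ?F. cp A E \<omega> < 1 - \<alpha> - 2 * \<epsilon>} \<in> sets ?F" using cpm by measurable
  then have BF: "?B \<in> sets ?F" by simp
  then obtain C where C: "C \<in> sets borel" "?B = T -` C \<inter> space M" unfolding setsF by auto
  show Bm: "?B \<in> events" unfolding C(2) using C(1) T by simp
  have BT: "?B = {\<omega> \<in> space M. T \<omega> \<in> C}" using C(2) by auto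
  have iE: "integrable ?Q (indicator E :: 'a \<Rightarrow> real)"
    using E by (intro integrable_real_indicator) (auto simp: Q.emeasure_eq_measure)
  have "measure ?Q (E \<inter> ?B) = (\<integral>\<omega>\<in>?B. indicator E \<omega> \<partial>?Q)"
  proof -
    have "(\<integral>\<omega>\<in>?B. indicator E \<omega> \<partial>?Q) = (\<integral>\<omega>. indicator (E \<inter> ?B) \<omega> \<partial>?Q)"
      unfolding set_lebesgue_integral_def by (intro Bochner_Integration.integral_cong refl) (auto split: split_indicator)
    also have "\<dots> = measure ?Q (E \<inter> ?B)" using E Bm by (simp add: sets.Int_space_eq2)
    finally show ?thesis ..
  qed
  also have "\<dots> = (\<integral>\<omega>\<in>?B. cp A E \<omega> \<partial>?Q)" unfolding cp_def[symmetric] using iE BF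
    unfolding cp_def by (rule F.real_cond_exp_intA)
  also have "\<dots> \<le> (\<integral>\<omega>\<in>?B. 1 - \<alpha> - 2 * \<epsilon> \<partial>?Q)"
  proof (rule set_integral_mono)
    have "integrable ?Q (cp A E)" unfolding cp_def by (rule F.real_cond_exp_int(1)[OF iE])
    then show "set_integrable ?Q ?B (cp A E)"
      unfolding set_integrable_def using Bm by (intro integrable_mult_indicator) auto
    show "set_integrable ?Q ?B (\<lambda>_. 1 - \<alpha> - 2 * \<epsilon>)"
      unfolding set_integrable_def using Bm by (intro integrable_mult_indicator) auto
  qed auto
  also have "\<dots> = (1 - \<alpha> - 2 * \<epsilon>) * measure ?Q ?B" using Bm by (simp add: set_lebesgue_integral_def)
  finally have le1: "measure ?Q (E \<inter> ?B) \<le> (1 - \<alpha> - 2 * \<epsilon>) * measure ?Q ?B" .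
  have "measure ?Q ?B = measure ?Q (?B - E) + measure ?Q (E \<inter> ?B)"
  proof -
    have "?B = (?B - E) \<union> (E \<inter> ?B)" by auto
    then have "measure ?Q ?B = measure ?Q ((?B - E) \<union> (E \<inter> ?B))" by simp
    also have "\<dots> = measure ?Q (?B - E) + measure ?Q (E \<inter> ?B)"
      using E Bm by (intro Q.finite_measure_Union) auto
    finally show ?thesis .
  qed
  also have "measure ?Q (?B - E) = measure ?Q ((?B - E) \<inter> A)"
    using conditioned_on_event(4)[OF A(1) A0, of "?B - E"] Bm E by auto
  also have "\<dots> \<le> measure ?Q ({\<omega> \<in> space M. \<omega> \<in> G \<and> T \<omega> \<in> C} \<union> H)"
    using sub G H C(1) BT by (intro Q.finite_measure_mono) auto
  also have "\<dots> \<le> measure ?Q {\<omega> \<in> space M. \<omega> \<in> G \<and> T \<omega> \<in> C} + measure ?Q H"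
    using G H C(1) by (intro measure_Un_le) auto
  also have "measure ?Q {\<omega> \<in> space M. \<omega> \<in> G \<and> T \<omega> \<in> C} \<le> (\<alpha> + \<epsilon>) * measure ?Q ?B"
    unfolding BT by (rule G_le[OF C(1)])
  \<comment> \<open>On \<open>?B\<close> more than the fraction \<alpha> + \<epsilon> that G
    explains is missed, namely at least \<alpha> + 2 * \<epsilon>; the remaining fraction \<epsilon>
    has to come from H.\<close>
  finally have "\<epsilon> * measure ?Q ?B \<le> measure ?Q H" using le1 by (simp add: algebra_simps)
  also have "\<dots> \<le> prob H / prob A" by (rule conditioned_on_event(3)[OF A(1) A0 H])
  also have "\<dots> \<le> prob H / (1 / 2)" using A A0 by (intro divide_left_mono) auto
  finally have QB: "measure ?Q ?B \<le> 2 * prob H / \<epsilon>" using \<epsilon> by (simp add: field_simps)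
  \<comment> \<open>Outside A the conditional law says nothing, so that part of \<open>?B\<close> is
    charged in full.\<close>
  have "prob ?B \<le> prob ((A \<inter> ?B) \<union> (space M - A))" using A Bm by (intro finite_measure_mono) auto
  also have "\<dots> \<le> prob (A \<inter> ?B) + prob (space M - A)" using A Bm by (intro measure_Un_le) auto
  also have "prob (A \<inter> ?B) \<le> measure ?Q ?B"
    using conditioned_on_event(2)[OF A(1) A0 Bm] A0 prob_le_1[of A]
    by (simp add: pos_le_divide_eq mult_left_le)
  finally show "prob ?B \<le> 2 * prob H / \<epsilon> + prob (space M - A)" using QB by linarith
qed

section \<open>Negligible events along even n, and uniform consequences of smallness in mean\<close>

text \<open>Stated with outer probabilities, so that measurability of the events need not be tracked.\<close>

definition vanishing :: "(nat \<Rightarrow> ('a, 'x, 'z, 'v) sample) \<Rightarrow> (nat \<Rightarrow> 'a set) \<Rightarrow> bool" where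
  "vanishing smp E \<longleftrightarrow> (\<forall>\<epsilon>>0. \<forall>\<^sub>F n in even_top.
     \<exists>A\<in>sets (pspace (smp n)). E n \<subseteq> A \<and> measure (pspace (smp n)) A < \<epsilon>)"

lemma vanishing_Un:
  assumes "vanishing smp E" "vanishing smp E'"
  shows "vanishing smp (\<lambda>n. E n \<union> E' n)"
  unfolding vanishing_def
proof (intro allI impI)
  fix \<epsilon> :: real assume "0 < \<epsilon>"
  then have "0 < \<epsilon> / 2" by simp
  then have "\<forall>\<^sub>F n in even_top. \<exists>A\<in>sets (pspace (smp n)). E n \<subseteq> A \<and> measure (pspace (smp n)) A < \<epsilon> / 2"
    "\<forall>\<^sub>F n in even_top. \<exists>A\<in>sets (pspace (smp n)). E' n \<subseteq> A \<and> measure (pspace (smp n)) A < \<epsilon> / 2"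
    using assms unfolding vanishing_def by blast+
  then show "\<forall>\<^sub>F n in even_top. \<exists>A\<in>sets (pspace (smp n)). E n \<union> E' n \<subseteq> A \<and> measure (pspace (smp n)) A < \<epsilon>"
  proof eventually_elim
    case (elim n)
    then obtain A A' where A: "A \<in> sets (pspace (smp n))" "E n \<subseteq> A" "measure (pspace (smp n)) A < \<epsilon> / 2"
      "A' \<in> sets (pspace (smp n))" "E' n \<subseteq> A'" "measure (pspace (smp n)) A' < \<epsilon> / 2" by blast
    moreover have "measure (pspace (smp n)) (A \<union> A') \<le> measure (pspace (smp n)) A + measure (pspace (smp n)) A'"
      using A by (intro measure_Un_le) auto
    ultimately show ?case by (intro bexI[of _ "A \<union> A'"]) auto
  qed
qed

lemma vanishingI:
  assumes "\<And>\<epsilon>. 0 < \<epsilon> \<Longrightarrow> \<forall>\<^sub>F n in even_top. \<exists>A\<in>sets (pspace (smp n)). E n \<subseteq> A \<and> measure (pspace (smp n)) A < \<epsilon>"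
  shows "vanishing smp E"
  using assms by (simp add: vanishing_def)

lemma even_top_eventually: "eventually P even_top \<longleftrightarrow> (\<exists>m. \<forall>n\<ge>m. even n \<longrightarrow> P n)"
  unfolding even_top_def eventually_inf_principal eventually_sequentially by simp

lemma eventually_even_top: "\<forall>\<^sub>F n in even_top. even n \<and> m \<le> n"
  unfolding even_top_eventually by auto

text \<open>Along a sequence of worst dyads, the hypothesis turns into a uniform bound.\<close>

lemma mean_dist_smallo_uniform:
  assumes "mean_dist_smallo smp A B r" and r: "\<And>n. 0 < r n" and \<epsilon>: "0 < \<epsilon>"
  shows "\<forall>\<^sub>F n in even_top. \<forall>(i, j)\<in>dyads (D2 n).
    (\<integral>\<^sup>+\<omega>. ennreal \<bar>A n i j \<omega> - B n i j \<omega>\<bar> \<partial>pspace (smp n)) \<le> ennreal (\<epsilon> * r n)"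
proof -
  define d where "d n e = (\<integral>\<^sup>+\<omega>. ennreal \<bar>A n (fst e) (snd e) \<omega> - B n (fst e) (snd e) \<omega>\<bar> \<partial>pspace (smp n))" for n e
  define worst where "worst n = (SOME e. e \<in> dyads (D2 n) \<and> (\<forall>e'\<in>dyads (D2 n). d n e' \<le> d n e))" for n
  have worst: "worst n \<in> dyads (D2 n) \<and> (\<forall>e'\<in>dyads (D2 n). d n e' \<le> d n (worst n))" if "even n" "4 \<le> n" for n
  proof -
    have fin: "finite (dyads (D2 n))" by (rule finite_subset[of _ "D2 n \<times> D2 n"]) (auto simp: dyads_def D2_def)
    have "(n div 2 + 1, n div 2 + 2) \<in> dyads (D2 n)" using that by (auto simp: dyads_def D2_def)
    then have ne: "dyads (D2 n) \<noteq> {}" by blast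
    have "Max (d n ` dyads (D2 n)) \<in> d n ` dyads (D2 n)" using fin ne by (intro Max_in) auto
    then obtain e where "e \<in> dyads (D2 n)" "d n e = Max (d n ` dyads (D2 n))" by auto
    moreover have "\<forall>e'\<in>dyads (D2 n). d n e' \<le> Max (d n ` dyads (D2 n))" using fin by auto
    ultimately have "\<exists>e. e \<in> dyads (D2 n) \<and> (\<forall>e'\<in>dyads (D2 n). d n e' \<le> d n e)" by metis
    then show ?thesis unfolding worst_def by (rule someI_ex)
  qed
  have "pair_seq (\<lambda>n. fst (worst n)) (\<lambda>n. snd (worst n))" using worst by (auto simp: pair_seq_def)
  then have lim: "((\<lambda>n. d n (worst n) / ennreal (r n)) \<longlongrightarrow> 0) even_top"
    using assms(1) unfolding mean_dist_smallo_def d_def by blast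
  have "\<forall>\<^sub>F n in even_top. d n (worst n) / ennreal (r n) < ennreal \<epsilon>"
    using order_tendstoD(2)[OF lim, of "ennreal \<epsilon>"] \<epsilon> by simp
  with eventually_even_top[of 4] show ?thesis
  proof eventually_elim
    case (elim n)
    have "d n (worst n) = d n (worst n) / ennreal (r n) * ennreal (r n)"
      by (rule ennreal_divide_mult_self[OF r, symmetric])
    also have "\<dots> \<le> ennreal \<epsilon> * ennreal (r n)" using elim(2) by (intro mult_right_mono) auto
    finally have "d n (worst n) \<le> ennreal (\<epsilon> * r n)" using \<epsilon> r[of n] by (simp add: ennreal_mult)
    then have "d n e \<le> ennreal (\<epsilon> * r n)" if "e \<in> dyads (D2 n)" for e
      using worst[of n] elim(1) that order.trans by blast
    then show ?case unfolding d_def by auto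
  qed
qed

text \<open>Markov's inequality for a nonnegative integral, because the smallness hypotheses do not
  presuppose an integrable difference.\<close>

lemma (in prob_space) prob_gt_le_nn_integral:
  assumes [measurable]: "f \<in> borel_measurable M" and le: "(\<integral>\<^sup>+\<omega>. ennreal \<bar>f \<omega>\<bar> \<partial>M) \<le> ennreal b" and "0 < \<delta>" "0 \<le> b"
  shows "prob {\<omega> \<in> space M. \<bar>f \<omega>\<bar> > \<delta>} \<le> b / \<delta>"
proof -
  have "emeasure M {\<omega> \<in> space M. \<bar>f \<omega>\<bar> > \<delta>} \<le> emeasure M {\<omega> \<in> space M. 1 \<le> ennreal (1 / \<delta>) * ennreal \<bar>f \<omega>\<bar>}"
    using \<open>0 < \<delta>\<close> by (intro emeasure_mono) (auto simp flip: ennreal_mult'')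
  also have "\<dots> \<le> ennreal (1 / \<delta>) * (\<integral>\<^sup>+\<omega>. ennreal \<bar>f \<omega>\<bar> * indicator (space M) \<omega> \<partial>M)"
    by (rule nn_integral_Markov_inequality) auto
  also have "(\<integral>\<^sup>+\<omega>. ennreal \<bar>f \<omega>\<bar> * indicator (space M) \<omega> \<partial>M) = (\<integral>\<^sup>+\<omega>. ennreal \<bar>f \<omega>\<bar> \<partial>M)"
    by (intro nn_integral_cong) auto
  also have "ennreal (1 / \<delta>) * (\<integral>\<^sup>+\<omega>. ennreal \<bar>f \<omega>\<bar> \<partial>M) \<le> ennreal (1 / \<delta>) * ennreal b"
    using le by (intro mult_left_mono) auto
  also have "\<dots> = ennreal (b / \<delta>)" using assms(3,4) by (simp flip: ennreal_mult'')
  finally show ?thesis using assms(3,4) by (simp add: emeasure_eq_measure)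
qed

section \<open>The weighted score distribution in one sample\<close>

lemma finite_dyads: "finite A \<Longrightarrow> finite (dyads A)"
  by (rule finite_subset[of _ "A \<times> A"]) (auto simp: dyads_def)

lemma dyads_mono: "A \<subseteq> B \<Longrightarrow> dyads A \<subseteq> dyads B"
  by (auto simp: dyads_def)

lemma dyads_D2_subset: "dyads (D2 n) \<subseteq> dyads {1..n}"
  by (rule dyads_mono) (auto simp: D2_def)

lemma card_dyads: "finite A \<Longrightarrow> card (dyads A) = card A choose 2"
proof -
  assume "finite A"
  have "bij_betw (\<lambda>(i, j). {i, j}) (dyads A) {B. B \<subseteq> A \<and> card B = 2}"
  proof (rule bij_betwI')
    fix e e' assume "e \<in> dyads A" "e' \<in> dyads A"
    then show "((case e of (i, j) \<Rightarrow> {i, j}) = (case e' of (i, j) \<Rightarrow> {i, j})) = (e = e')"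
      by (auto simp: dyads_def doubleton_eq_iff)
  next
    fix e assume "e \<in> dyads A"
    then show "(case e of (i, j) \<Rightarrow> {i, j}) \<in> {B. B \<subseteq> A \<and> card B = 2}" by (auto simp: dyads_def)
  next
    fix B assume "B \<in> {B. B \<subseteq> A \<and> card B = 2}"
    then obtain x y where xy: "B = {x, y}" "x \<noteq> y" "x \<in> A" "y \<in> A" by (auto simp: card_2_iff)
    then show "\<exists>e\<in>dyads A. B = (case e of (i, j) \<Rightarrow> {i, j})"
      by (intro bexI[of _ "(min x y, max x y)"]) (auto simp: dyads_def min_def max_def)
  qed
  then show ?thesis using \<open>finite A\<close> by (simp add: bij_betw_same_card n_subsets)
qed

lemma card_dyads_D2: "even n \<Longrightarrow> card (dyads (D2 n)) = (n div 2) choose 2"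
  by (auto simp: card_dyads D2_def elim!: evenE)

lemma finite_dyads_D2 [simp]: "finite (dyads (D2 n))"
  by (rule finite_dyads) (simp add: D2_def)

text \<open>The deterministic core: with S k l \<le> t, every dyad of score at least t is counted.
  Replacing the weight 1/q by 1/p costs |1/q - 1/p| per observed dyad, a bad score estimate costs at
  most 1/p, and the test pair itself costs at most 1.\<close>

lemma Pi_weighted_gt:
  fixes n k l :: nat and M p q S :: "nat \<Rightarrow> nat \<Rightarrow> real" and B Bad :: "nat \<times> nat \<Rightarrow> bool"
  defines "E \<equiv> dyads (D2 n)"
  assumes "even n" and kl: "(k, l) \<in> E"
    and M: "\<And>i j. M i j \<in> {0, 1}"
    and p: "\<And>i j. (i, j) \<in> E \<Longrightarrow> 0 < p i j \<and> p i j \<le> 1"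
    and q: "\<And>i j. (i, j) \<in> E \<Longrightarrow> 0 < q i j"
    and S: "S k l \<le> t" "\<And>i j. (i, j) \<in> E \<Longrightarrow> B (i, j) \<Longrightarrow> \<not> Bad (i, j) \<Longrightarrow> t \<le> S i j"
    and dense: "rho_hat n M < 1" and "0 \<le> \<alpha>"
    and large: "\<alpha> * real ((n div 2) choose 2) < (\<Sum>(i, j)\<in>E. M i j * (1 / p i j - 1) * of_bool (B (i, j)))
      - (\<Sum>(i, j)\<in>E. M i j / p i j * of_bool (Bad (i, j))) - (\<Sum>(i, j)\<in>E. M i j * \<bar>1 / q i j - 1 / p i j\<bar>) - 1"
  shows "\<alpha> < Pi_weighted n M q S k l"
proof -
  let ?N = "real ((n div 2) choose 2)"
  let ?cal = "calibration_set n M"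
  let ?f = "\<lambda>(i, j). (1 - q i j) / q i j * of_bool (S i j \<ge> S k l)"
  have finE: "finite E" by (simp add: E_def)
  have cal: "?cal = {e \<in> E. M (fst e) (snd e) = 1}" by (auto simp: calibration_set_def E_def)
  have fin: "finite ?cal" unfolding cal using finE by simp
  have "0 < card E" using kl finE by (auto simp: card_gt_0_iff)
  then have N: "0 < ?N" using card_dyads_D2[OF \<open>even n\<close>] by (simp add: E_def)
  have "(\<Sum>e\<in>E. M (fst e) (snd e) * ?f e) = (\<Sum>e\<in>E. if M (fst e) (snd e) = 1 then ?f e else 0)"
    using M by (intro sum.cong refl) auto
  also have "\<dots> = sum ?f ?cal" unfolding cal by (rule sum.inter_filter[OF finE, symmetric])
  finally have sum_cal: "sum ?f ?cal = (\<Sum>e\<in>E. M (fst e) (snd e) * ?f e)" ..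
  \<comment> \<open>q may exceed 1, so the summand of the test pair can be negative, but not below
    -1; this is the 1 subtracted in \<open>large\<close>.\<close>
  have f_kl: "- 1 \<le> ?f (k, l)" using q[OF kl] by (simp add: field_simps)
  \<comment> \<open>The pair may also be observed, in which case it is already in the calibration
    set and is not counted again.\<close>
  have test: "sum ?f ?cal - 1 \<le> sum ?f (?cal \<union> {(k, l)})"
  proof (cases "(k, l) \<in> ?cal")
    case True
    then have "?cal \<union> {(k, l)} = ?cal" by auto
    then show ?thesis by simp
  next
    case False
    then have "sum ?f (?cal \<union> {(k, l)}) = ?f (k, l) + sum ?f ?cal" using fin by simp
    then show ?thesis using f_kl by linarith
  qed
  have "(\<Sum>(i, j)\<in>E. M i j * (1 / p i j - 1) * of_bool (B (i, j)))
      - (\<Sum>(i, j)\<in>E. M i j / p i j * of_bool (Bad (i, j))) - (\<Sum>(i, j)\<in>E. M i j * \<bar>1 / q i j - 1 / p i j\<bar>)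
      = (\<Sum>(i, j)\<in>E. M i j * (1 / p i j - 1) * of_bool (B (i, j)) - M i j / p i j * of_bool (Bad (i, j))
        - M i j * \<bar>1 / q i j - 1 / p i j\<bar>)"
    by (simp add: case_prod_unfold sum_subtractf)
  also have "\<dots> \<le> (\<Sum>e\<in>E. M (fst e) (snd e) * ?f e)"
  proof (rule sum_mono, unfold split_paired_all prod.case fst_conv snd_conv)
    fix i j assume ij: "(i, j) \<in> E"
    have pos: "0 < 1 / p i j" "1 \<le> 1 / p i j" using p[OF ij] by auto
    have f: "(1 - q i j) / q i j = 1 / q i j - 1" using q[OF ij] by (simp add: diff_divide_distrib)
    \<comment> \<open>P and Q stand for 1/p and 1/q, and b, d, m for reaching t by the oracle, being
      bad and being counted. A counted dyad has left side at most P - 1 - |Q - P|, hence at most Q -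
      1, by P \<ge> 1; for an uncounted one, b forces d, and the subtracted P outweighs P -
      1.\<close>
    have gen: "(P - 1) * of_bool b - P * of_bool d - \<bar>Q - P\<bar> \<le> (Q - 1) * of_bool m"
      if "1 \<le> P" "b \<Longrightarrow> \<not> d \<Longrightarrow> m" for P Q :: real and b d m
      using that by (cases b; cases d; cases m) (auto simp: abs_if)
    have "(1 / p i j - 1) * of_bool (B (i, j)) - 1 / p i j * of_bool (Bad (i, j)) - \<bar>1 / q i j - 1 / p i j\<bar>
        \<le> (1 - q i j) / q i j * of_bool (S i j \<ge> S k l)"
      unfolding f using S(1) S(2)[OF ij] pos(2) by (intro gen) linarith+
    then show "M i j * (1 / p i j - 1) * of_bool (B (i, j)) - M i j / p i j * of_bool (Bad (i, j))
        - M i j * \<bar>1 / q i j - 1 / p i j\<bar> \<le> M i j * ((1 - q i j) / q i j * of_bool (S i j \<ge> S k l))"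
      using M[of i j] by auto
  qed
  also have "\<dots> = sum ?f ?cal" by (rule sum_cal[symmetric])
  finally have big: "\<alpha> * ?N < sum ?f (?cal \<union> {(k, l)})" using test large by linarith
  \<comment> \<open>The normalising factor 1 - \<open>rho_hat\<close> is positive by
    \<open>dense\<close> and at most 1, so a lower bound by \<alpha> times the full number of dyads
    is more than enough.\<close>
  have "0 \<le> rho_hat n M" unfolding rho_hat_def using M N
    by (intro divide_nonneg_pos sum_nonneg) (auto, metis insert_iff empty_iff less_eq_real_def zero_less_one)
  then have "?N * (1 - rho_hat n M) \<le> ?N" "0 < ?N * (1 - rho_hat n M)" using N dense by (auto simp: mult_le_cancel_left1)
  moreover have "\<alpha> * (?N * (1 - rho_hat n M)) \<le> \<alpha> * ?N" using calculation(1) \<open>0 \<le> \<alpha>\<close> by (rule mult_left_mono)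
  ultimately have "\<alpha> < sum ?f (?cal \<union> {(k, l)}) / (?N * (1 - rho_hat n M))"
    using big by (simp add: pos_less_divide_eq)
  then show ?thesis by (simp add: Pi_weighted_def)
qed

text \<open>Everything that the oracle score of a dyad depends on. The coin \<open>Eta i j\<close>
  is left out, so that thinning applies to events of the oracle score.\<close>

definition dyad_sources :: "nat \<Rightarrow> nat \<Rightarrow> source set" where
  "dyad_sources i j = {Node i, Node j, Nu i j}"

section \<open>Moments of the oracle count and the finite-sample bound\<close>

context model
begin

lemma dyad_sources_subset: "(i, j) \<in> dyads {1..n} \<Longrightarrow> insert (Eta i j) (dyad_sources i j) \<subseteq> sources n"
  using dyadsD[of i j "{1..n}"] Eta_in_sources[of i j] Nu_in_sources[of i j] Node_in_sources
  by (simp add: dyad_sources_def)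

lemma Eta_notin_dyad_sources: "Eta i j \<notin> dyad_sources i j" by (simp add: dyad_sources_def)

definition weight :: "'a set \<Rightarrow> nat \<times> nat \<Rightarrow> 'a \<Rightarrow> real" where
  "weight B = (\<lambda>(i, j) \<omega>. obsv i j \<omega> * (1 / p i j \<omega> - 1) * indicator B \<omega>)"

lemma inverse_p_bounds:
  assumes "(i, j) \<in> dyads {1..n}" "\<omega> \<in> space (pspace s)"
  shows "1 \<le> 1 / p i j \<omega>" "1 / p i j \<omega> \<le> 1 / (c * r)"
proof -
  have pb: "c * r \<le> p i j \<omega>" "0 < p i j \<omega>" "p i j \<omega> < 1" using p_bounds[of i j \<omega>] dyadsD[OF assms(1)] assms(2) by auto
  show "1 \<le> 1 / p i j \<omega>" using pb by simp
  have "0 < c * r" using c_pos r_pos by simp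
  then show "1 / p i j \<omega> \<le> 1 / (c * r)" using pb by (intro divide_left_mono) auto
qed

lemma weight_bounds:
  assumes "(i, j) \<in> dyads {1..n}" "\<omega> \<in> space (pspace s)"
  shows "0 \<le> weight B (i, j) \<omega>" "weight B (i, j) \<omega> \<le> 1 / (c * r) * indicator {\<omega>. obsv i j \<omega> = 1} \<omega>"
  using inverse_p_bounds[OF assms] obs_values[of i j \<omega>] c_pos r_pos
  by (auto simp: weight_def split: split_indicator)

lemma weight_src:
  assumes "(i, j) \<in> dyads {1..n}" "B \<in> sets (src_alg (dyad_sources i j))"
  shows "weight B (i, j) \<in> borel_measurable (src_alg (insert (Eta i j) (dyad_sources i j)))"
proof -
  have "B \<in> sets (src_alg (insert (Eta i j) (dyad_sources i j)))" using assms(2) src_alg_mono by blast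
  moreover have "obsv i j \<in> borel_measurable (src_alg (insert (Eta i j) (dyad_sources i j)))"
    using assms(1) by (intro obs_src) (auto simp: dyad_sources_def)
  moreover have "p i j \<in> borel_measurable (src_alg (insert (Eta i j) (dyad_sources i j)))"
    using dyadsD[OF assms(1)] by (intro p_src) (auto simp: dyad_sources_def)
  ultimately show ?thesis unfolding weight_def by simp
qed

lemma weight_measurable:
  assumes "(i, j) \<in> dyads {1..n}" "B \<in> sets (src_alg (dyad_sources i j))"
  shows "weight B (i, j) \<in> borel_measurable (pspace s)"
  using src_alg_measurable[OF weight_src[OF assms] dyad_sources_subset[OF assms(1)]] .

text \<open>A weight is at most 1/(c * r) and vanishes on missing dyads. With probabilities at most
  C * r and (C * r)^2 of observing one and two dyads, squares have mean at most C / (c^2 * r) and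
  mixed products at most (C/c)^2. A dyad shares a node with at most 4 * n dyads, itself
  included.\<close>

lemma variance_weight_sum_le:
  assumes E: "E \<subseteq> dyads {1..n}" and B: "\<And>i j. (i, j) \<in> E \<Longrightarrow> B (i, j) \<in> sets (src_alg (dyad_sources i j))"
  shows "variance (\<lambda>\<omega>. \<Sum>e\<in>E. weight (B e) e \<omega>) \<le> real (card E) * (C / (c\<^sup>2 * r) + 4 * real n * (C / c)\<^sup>2)"
proof (rule variance_sum_le[where K = "1 / (c * r)" and R = "\<lambda>e e'. {fst e, snd e} \<inter> {fst e', snd e'} \<noteq> {}"])
  have cr: "0 < c * r" using c_pos r_pos by simp
  show "finite E" using E finite_dyads[of "{1..n}"] finite_subset by blast
  have meas: "weight (B e) e \<in> borel_measurable (pspace s)" if "e \<in> E" for e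
    using weight_measurable[of "fst e" "snd e" "B e"] B[of "fst e" "snd e"] E that by auto
  then show "weight (B e) e \<in> borel_measurable (pspace s)" if "e \<in> E" for e using that .
  have bounds: "0 \<le> weight (B e) e \<omega>" "weight (B e) e \<omega> \<le> 1 / (c * r) * indicator {\<omega>. obsv (fst e) (snd e) \<omega> = 1} \<omega>"
    if "e \<in> E" "\<omega> \<in> space (pspace s)" for e \<omega>
    using weight_bounds[of "fst e" "snd e" \<omega> "B e"] E that by auto
  have le: "weight (B e) e \<omega> \<le> 1 / (c * r)" if "e \<in> E" "\<omega> \<in> space (pspace s)" for e \<omega>
  proof -
    have "0 \<le> 1 / (c * r)" using cr by simp
    then show ?thesis using bounds(2)[OF that]
      by (cases "obsv (fst e) (snd e) \<omega> = 1") (auto simp: indicator_def intro: order.trans)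
  qed
  show "0 \<le> weight (B e) e \<omega> \<and> weight (B e) e \<omega> \<le> 1 / (c * r)" if "e \<in> E" "\<omega> \<in> space (pspace s)" for e \<omega>
    using bounds(1)[OF that] le[OF that] by simp
  have prod: "expectation (\<lambda>\<omega>. weight (B e) e \<omega> * weight (B e') e' \<omega>) \<le>
      (1 / (c * r))\<^sup>2 * prob {\<omega> \<in> space (pspace s). obsv (fst e) (snd e) \<omega> = 1 \<and> obsv (fst e') (snd e') \<omega> = 1}"
    if e: "e \<in> E" "e' \<in> E" for e e'
  proof -
    have [measurable]: "obsv (fst e) (snd e) \<in> borel_measurable (pspace s)"
      "obsv (fst e') (snd e') \<in> borel_measurable (pspace s)"
      using obs_measurable[of "fst e" "snd e"] obs_measurable[of "fst e'" "snd e'"] e E by auto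
    note [measurable] = meas[OF e(1)] meas[OF e(2)]
    let ?O = "{\<omega> \<in> space (pspace s). obsv (fst e) (snd e) \<omega> = 1 \<and> obsv (fst e') (snd e') \<omega> = 1}"
    have pw: "0 \<le> weight (B e) e \<omega> * weight (B e') e' \<omega>"
      "weight (B e) e \<omega> * weight (B e') e' \<omega> \<le> (1 / (c * r))\<^sup>2 * indicator ?O \<omega>"
      if \<omega>: "\<omega> \<in> space (pspace s)" for \<omega>
    proof -
      show "0 \<le> weight (B e) e \<omega> * weight (B e') e' \<omega>" using bounds(1) e \<omega> by simp
      have "weight (B e) e \<omega> * weight (B e') e' \<omega> \<le>
         (1 / (c * r) * indicator {\<omega>. obsv (fst e) (snd e) \<omega> = 1} \<omega>) * (1 / (c * r) * indicator {\<omega>. obsv (fst e') (snd e') \<omega> = 1} \<omega>)"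
        using bounds e \<omega> cr by (intro mult_mono) auto
      also have "\<dots> = (1 / (c * r))\<^sup>2 * indicator ?O \<omega>" using \<omega> by (auto simp: power2_eq_square split: split_indicator)
      finally show "weight (B e) e \<omega> * weight (B e') e' \<omega> \<le> (1 / (c * r))\<^sup>2 * indicator ?O \<omega>" .
    qed
    have "expectation (\<lambda>\<omega>. weight (B e) e \<omega> * weight (B e') e' \<omega>) \<le> expectation (\<lambda>\<omega>. (1 / (c * r))\<^sup>2 * indicator ?O \<omega>)"
    proof (rule integral_mono)
      have i: "integrable (pspace s) (\<lambda>\<omega>. (1 / (c * r))\<^sup>2 * indicator ?O \<omega> :: real)"
        by (intro integrable_mult_right integrable_real_indicator) (auto simp: emeasure_eq_measure)
      then show "integrable (pspace s) (\<lambda>\<omega>. (1 / (c * r))\<^sup>2 * indicator ?O \<omega> :: real)" .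
      show "integrable (pspace s) (\<lambda>\<omega>. weight (B e) e \<omega> * weight (B e') e' \<omega>)"
        using pw by (intro Bochner_Integration.integrable_bound[OF i]) auto
    qed (rule pw)
    then show ?thesis by simp
  qed
  show "expectation (\<lambda>\<omega>. weight (B e) e \<omega> * weight (B e) e \<omega>) \<le> C / (c\<^sup>2 * r)" if "e \<in> E" for e
  proof -
    have "(1 / (c * r))\<^sup>2 * prob {\<omega> \<in> space (pspace s). obsv (fst e) (snd e) \<omega> = 1} \<le> (1 / (c * r))\<^sup>2 * (C * r)"
      using prob_observed_le[of "fst e" "snd e"] E that by (intro mult_left_mono) auto
    also have "\<dots> = C / (c\<^sup>2 * r)" using c_pos r_pos by (simp add: power2_eq_square field_simps)
    finally show ?thesis using prod[OF that that] by simp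
  qed
  show "expectation (\<lambda>\<omega>. weight (B e) e \<omega> * weight (B e') e' \<omega>) \<le> (C / c)\<^sup>2" if "e \<in> E" "e' \<in> E" "e \<noteq> e'" for e e'
  proof -
    have "(1 / (c * r))\<^sup>2 * prob {\<omega> \<in> space (pspace s). obsv (fst e) (snd e) \<omega> = 1 \<and> obsv (fst e') (snd e') \<omega> = 1}
        \<le> (1 / (c * r))\<^sup>2 * (C * r)\<^sup>2"
      using prob_two_observed_le[of "fst e" "snd e" "fst e'" "snd e'"] E that
      by (intro mult_left_mono) (auto simp: prod_eq_iff)
    also have "\<dots> = (C / c)\<^sup>2" using c_pos r_pos by (simp add: power2_eq_square field_simps)
    finally show ?thesis using prod[OF that(1,2)] by simp
  qed
  show "expectation (\<lambda>\<omega>. weight (B e) e \<omega> * weight (B e') e' \<omega>) = expectation (weight (B e) e) * expectation (weight (B e') e')"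
    if e: "e \<in> E" "e' \<in> E" and disj: "\<not> {fst e, snd e} \<inter> {fst e', snd e'} \<noteq> {}" for e e'
  proof -
    obtain i j i' j' where ee: "e = (i, j)" "e' = (i', j')" by (cases e; cases e')
    have ij: "(i, j) \<in> dyads {1..n}" "(i', j') \<in> dyads {1..n}" using E e ee by auto
    show ?thesis unfolding ee
    proof (rule expectation_mult_src[OF dyad_sources_subset[OF ij(1)] dyad_sources_subset[OF ij(2)]])
      show "insert (Eta i j) (dyad_sources i j) \<inter> insert (Eta i' j') (dyad_sources i' j') = {}"
        using disj by (auto simp: dyad_sources_def ee)
      show "weight (B (i, j)) (i, j) \<in> borel_measurable (src_alg (insert (Eta i j) (dyad_sources i j)))"
        "weight (B (i', j')) (i', j') \<in> borel_measurable (src_alg (insert (Eta i' j') (dyad_sources i' j')))"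
        using weight_src ij B e ee by auto
      show "integrable (pspace s) (weight (B (i, j)) (i, j))" "integrable (pspace s) (weight (B (i', j')) (i', j'))"
        using bounds(1) le meas e unfolding ee by (auto intro!: integrable_const_bound[where B="1 / (c * r)"])
    qed
  qed
  show "real (card {e' \<in> E. {fst e, snd e} \<inter> {fst e', snd e'} \<noteq> {}}) \<le> 4 * real n" if "e \<in> E" for e
  proof -
    obtain i j where e: "e = (i, j)" by (cases e)
    let ?F = "{i, j} \<times> {1..n} \<union> {1..n} \<times> {i, j}"
    have "{e' \<in> E. {fst e, snd e} \<inter> {fst e', snd e'} \<noteq> {}} \<subseteq> ?F"
      using E by (auto simp: e dyads_def)
    then have "card {e' \<in> E. {fst e, snd e} \<inter> {fst e', snd e'} \<noteq> {}} \<le> card ?F"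
      by (intro card_mono) auto
    also have "\<dots> \<le> card ({i, j} \<times> {1..n}) + card ({1..n} \<times> {i, j})" by (rule card_Un_le)
    also have "\<dots> = 2 * (card {i, j} * n)" by (simp add: card_cartesian_product)
    also have "\<dots> \<le> 2 * (2 * n)" by (intro mult_le_mono2 mult_le_mono1) (simp add: card_insert_if)
    finally show ?thesis by linarith
  qed
  show "0 \<le> C / (c\<^sup>2 * r)" "0 \<le> (C / c)\<^sup>2" using C_pos c_pos r_pos by auto
qed

lemma markov_prob:
  assumes "X \<in> borel_measurable (pspace s)" "\<And>\<omega>. \<omega> \<in> space (pspace s) \<Longrightarrow> 0 \<le> X \<omega> \<and> X \<omega> \<le> K"
    and "expectation X \<le> b" "0 < a"
  shows "prob {\<omega> \<in> space (pspace s). a \<le> X \<omega>} \<le> b / a"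
proof -
  have "integrable (pspace s) X" using assms(1,2) by (intro integrable_const_bound[where B=K]) auto
  then have "prob {\<omega> \<in> space (pspace s). a \<le> X \<omega>} \<le> expectation X / a"
    using assms by (intro integral_Markov_inequality_measure[where A="{}"]) auto
  also have "\<dots> \<le> b / a" using assms(3,4) by (intro divide_right_mono) auto
  finally show ?thesis .
qed

lemma expectation_obs_le:
  assumes "E \<subseteq> dyads {1..n}"
  shows "expectation (\<lambda>\<omega>. \<Sum>(i, j)\<in>E. obsv i j \<omega>) \<le> real (card E) * (C * r)"
proof -
  have 1: "expectation (obsv i j) = prob {\<omega> \<in> space (pspace s). obsv i j \<omega> = 1}"
    and 2: "integrable (pspace s) (obsv i j)" if "(i, j) \<in> E" for i j
  proof -
    have ij: "(i, j) \<in> dyads {1..n}" using assms that by auto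
    have [measurable]: "obsv i j \<in> borel_measurable (pspace s)" by (rule obs_measurable[OF ij])
    have "expectation (obsv i j) = expectation (indicator {\<omega> \<in> space (pspace s). obsv i j \<omega> = 1})"
      using obs_values[of i j] by (intro Bochner_Integration.integral_cong refl) (auto split: split_indicator)
    then show "expectation (obsv i j) = prob {\<omega> \<in> space (pspace s). obsv i j \<omega> = 1}" by simp
    show "integrable (pspace s) (obsv i j)"
      by (intro integrable_const_bound[where B=1] AE_I2) (auto simp: obs_def Let_def)
  qed
  have "expectation (\<lambda>\<omega>. \<Sum>(i, j)\<in>E. obsv i j \<omega>) = (\<Sum>(i, j)\<in>E. expectation (obsv i j))"
    using 2 by (subst Bochner_Integration.integral_sum) (auto simp: case_prod_unfold)
  also have "\<dots> \<le> (\<Sum>(i, j)\<in>E. C * r)"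
    using assms prob_observed_le 1 by (intro sum_mono) auto
  finally show ?thesis by (simp add: case_prod_unfold)
qed

text \<open>The gap between \<alpha> and \<beta> is spent in four parts of size \<gamma> * N:
  deviation of the oracle count from its mean, badly scored observed dyads, error of the inverse
  weights, and the 1 for the test pair. The bound collects Chebyshev for the first, Markov for the
  second, two Markov bounds for the third, balanced by the free parameter \<theta>, and C * r for
  the event that all dyads of \<open>D2 n\<close> are observed.\<close>

theorem weighted_set_miss_bound:
  fixes q S :: "nat \<Rightarrow> nat \<Rightarrow> 'a \<Rightarrow> real" and B Bad :: "nat \<times> nat \<Rightarrow> 'a set"
  defines "E \<equiv> dyads (D2 n)" and "N \<equiv> real ((n div 2) choose 2)"
  assumes n: "even n" and kl: "(k, l) \<in> E" and \<alpha>: "0 \<le> \<alpha>"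
    and q: "\<And>i j. (i, j) \<in> E \<Longrightarrow> q i j \<in> borel_measurable (pspace s)"
      "\<And>i j. (i, j) \<in> E \<Longrightarrow> AE \<omega> in pspace s. c * r \<le> q i j \<omega>"
    and frob: "(\<integral>\<^sup>+\<omega>. ennreal (\<Sum>(i, j)\<in>E. (q i j \<omega> - p i j \<omega>)\<^sup>2) \<partial>pspace s) \<le> ennreal f" "0 \<le> f"
    and B: "\<And>i j. (i, j) \<in> E \<Longrightarrow> B (i, j) \<in> sets (src_alg (dyad_sources i j))"
      "\<And>i j. (i, j) \<in> E \<Longrightarrow> \<beta> \<le> prob {\<omega> \<in> B (i, j). obsv i j \<omega> = 0}"
    and Bad: "\<And>i j. (i, j) \<in> E \<Longrightarrow> Bad (i, j) \<in> events"
      "\<And>i j. (i, j) \<in> E \<Longrightarrow> prob {\<omega> \<in> Bad (i, j). obsv i j \<omega> = 1} \<le> r * b"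
    and S: "\<And>i j \<omega>. (i, j) \<in> E \<Longrightarrow> \<omega> \<in> B (i, j) \<Longrightarrow> \<omega> \<notin> Bad (i, j) \<Longrightarrow> t \<le> S i j \<omega>"
    and \<gamma>: "0 < \<gamma>" "\<alpha> + 4 * \<gamma> \<le> \<beta>" "1 \<le> \<gamma> * N" and \<theta>: "0 < \<theta>"
  shows "\<exists>H\<in>events. {\<omega> \<in> space (pspace s). S k l \<omega> \<le> t \<and>
        Pi_weighted n (\<lambda>i j. obsv i j \<omega>) (\<lambda>i j. q i j \<omega>) (\<lambda>i j. S i j \<omega>) k l \<le> \<alpha>} \<subseteq> H \<and>
      prob H \<le> (C / (c\<^sup>2 * r) + 4 * real n * (C / c)\<^sup>2) / (\<gamma>\<^sup>2 * N) + b / (c * \<gamma>)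
        + (\<theta> * C / (\<gamma> * c\<^sup>2) + f / (\<gamma> * N * \<theta> * c\<^sup>2 * r ^ 3)) + C * r"
proof -
  have ED: "E \<subseteq> dyads {1..n}" unfolding E_def by (rule dyads_D2_subset)
  have finE: "finite E" by (simp add: E_def)
  have cardE: "real (card E) = N" using card_dyads_D2[OF n] by (simp add: E_def N_def)
  have cr: "0 < c * r" using c_pos r_pos by simp
  have "0 < card E" using kl finE by (auto simp: card_gt_0_iff)
  then have N: "0 < N" using cardE by simp
  have ij: "i \<in> {1..n}" "j \<in> {1..n}" "(i, j) \<in> dyads {1..n}" if "(i, j) \<in> E" for i j
    using ED that dyadsD[of i j "{1..n}"] by auto
  have om [measurable]: "obsv i j \<in> borel_measurable (pspace s)" if "(i, j) \<in> E" for i j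
    using ij[OF that] by simp
  have pm [measurable]: "p i j \<in> borel_measurable (pspace s)" if "(i, j) \<in> E" for i j
    using ij[OF that] p_measurable by blast
  note [measurable] = q(1)

  \<comment> \<open>X1 is the oracle count; X2 and X3 are the losses caused by estimated scores and
    by estimated weights. The number X4 of observed dyads and the squared error X5 of the estimated
    probabilities together control X3.\<close>
  define X1 where "X1 \<omega> = (\<Sum>e\<in>E. weight (B e) e \<omega>)" for \<omega>
  define X2 where "X2 \<omega> = (\<Sum>(i, j)\<in>E. obsv i j \<omega> / p i j \<omega> * indicator (Bad (i, j)) \<omega>)" for \<omega>
  define X3 where "X3 \<omega> = (\<Sum>(i, j)\<in>E. obsv i j \<omega> * \<bar>1 / q i j \<omega> - 1 / p i j \<omega>\<bar>)" for \<omega>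
  define X4 where "X4 \<omega> = (\<Sum>(i, j)\<in>E. obsv i j \<omega>)" for \<omega>
  define X5 where "X5 \<omega> = (\<Sum>(i, j)\<in>E. (q i j \<omega> - p i j \<omega>)\<^sup>2)" for \<omega>

  have wm: "weight (B e) e \<in> borel_measurable (pspace s)" if "e \<in> E" for e
    using weight_measurable[of "fst e" "snd e" "B e"] B[of "fst e" "snd e"] ED that by auto
  have wb: "0 \<le> weight (B e) e \<omega> \<and> weight (B e) e \<omega> \<le> 1 / (c * r)" if "e \<in> E" "\<omega> \<in> space (pspace s)" for e \<omega>
  proof -
    have "0 \<le> 1 / (c * r)" using cr by simp
    then show ?thesis using weight_bounds[of "fst e" "snd e" \<omega> "B e"] ED that
      by (cases "obsv (fst e) (snd e) \<omega> = 1") (auto simp: indicator_def intro: order.trans)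
  qed
  have wint: "integrable (pspace s) (weight (B e) e)" if "e \<in> E" for e
    using wm wb that by (intro integrable_const_bound[where B="1 / (c * r)"]) auto
  have X1m [measurable]: "X1 \<in> borel_measurable (pspace s)" unfolding X1_def using wm by simp
  have X1b: "0 \<le> X1 \<omega>" "X1 \<omega> \<le> N / (c * r)" if "\<omega> \<in> space (pspace s)" for \<omega>
  proof -
    show "0 \<le> X1 \<omega>" unfolding X1_def using wb that by (intro sum_nonneg) auto
    have "X1 \<omega> \<le> (\<Sum>e\<in>E. 1 / (c * r))" unfolding X1_def using wb that by (intro sum_mono) auto
    then show "X1 \<omega> \<le> N / (c * r)" using cardE by simp
  qed
  have EX1: "N * \<beta> \<le> expectation X1"
  proof -
    have "N * \<beta> = (\<Sum>e\<in>E. \<beta>)" using cardE by simp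
    also have "\<dots> \<le> (\<Sum>e\<in>E. expectation (weight (B e) e))"
    proof (rule sum_mono, clarify)
      fix i j assume e: "(i, j) \<in> E"
      have "expectation (weight (B (i, j)) (i, j)) = prob {\<omega> \<in> B (i, j). obsv i j \<omega> = 0}"
        unfolding weight_def prod.case
        using dyad_sources_subset[OF ij(3)[OF e]] B(1)[OF e]
        by (intro expectation_weight[OF ij(3)[OF e] _ Eta_notin_dyad_sources]) (auto simp: dyad_sources_def)
      then show "\<beta> \<le> expectation (weight (B (i, j)) (i, j))" using B(2)[OF e] by simp
    qed
    also have "\<dots> = expectation X1"
      unfolding X1_def using wint by (subst Bochner_Integration.integral_sum) auto
    finally show ?thesis .
  qed
  have P1: "prob {\<omega> \<in> space (pspace s). \<gamma> * N \<le> \<bar>X1 \<omega> - expectation X1\<bar>} \<le>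
      (C / (c\<^sup>2 * r) + 4 * real n * (C / c)\<^sup>2) / (\<gamma>\<^sup>2 * N)"
  proof -
    have "X1 \<omega> ^ 2 \<le> (N / (c * r))\<^sup>2" if "\<omega> \<in> space (pspace s)" for \<omega>
      using X1b[OF that] by (intro power_mono) auto
    then have "integrable (pspace s) (\<lambda>\<omega>. X1 \<omega> ^ 2)"
      by (intro integrable_const_bound[where B="(N / (c * r))\<^sup>2"]) auto
    then have "prob {\<omega> \<in> space (pspace s). \<gamma> * N \<le> \<bar>X1 \<omega> - expectation X1\<bar>} \<le> variance X1 / (\<gamma> * N)\<^sup>2"
      using \<gamma>(1) N by (intro Chebyshev_inequality) auto
    also have "\<dots> \<le> N * (C / (c\<^sup>2 * r) + 4 * real n * (C / c)\<^sup>2) / (\<gamma> * N)\<^sup>2"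
      using variance_weight_sum_le[OF ED B(1)] cardE unfolding X1_def[abs_def] by (intro divide_right_mono) auto
    also have "\<dots> = (C / (c\<^sup>2 * r) + 4 * real n * (C / c)\<^sup>2) / (\<gamma>\<^sup>2 * N)"
      using N \<gamma>(1) by (simp add: power2_eq_square)
    finally show ?thesis .
  qed

  have X2m [measurable]: "X2 \<in> borel_measurable (pspace s)"
    unfolding X2_def case_prod_unfold using om pm Bad(1)
    by (intro borel_measurable_sum borel_measurable_times borel_measurable_divide borel_measurable_indicator) auto
  have x2b: "0 \<le> obsv i j \<omega> / p i j \<omega> * indicator (Bad (i, j)) \<omega> \<and>
      obsv i j \<omega> / p i j \<omega> * indicator (Bad (i, j)) \<omega> \<le> 1 / (c * r) * indicator {\<omega> \<in> Bad (i, j). obsv i j \<omega> = 1} \<omega>"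
    if "(i, j) \<in> E" "\<omega> \<in> space (pspace s)" for i j \<omega>
    using inverse_p_bounds[OF ij(3)[OF that(1)] that(2)] obs_values[of i j \<omega>] cr
      p_bounds(3)[OF ij(1,2)[OF that(1)] that(2)]
    by (auto split: split_indicator)
  have badm: "{\<omega> \<in> Bad (i, j). obsv i j \<omega> = 1} \<in> events" if "(i, j) \<in> E" for i j
  proof -
    have [measurable]: "Bad (i, j) \<in> events" "obsv i j \<in> borel_measurable (pspace s)" using Bad(1) om that by auto
    show ?thesis by measurable
  qed
  have x2i: "integrable (pspace s) (\<lambda>\<omega>. 1 / (c * r) * indicator {\<omega> \<in> Bad (i, j). obsv i j \<omega> = 1} \<omega> :: real)"
    if "(i, j) \<in> E" for i j
    using badm[OF that] by (intro integrable_mult_right integrable_real_indicator) (auto simp: emeasure_eq_measure)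
  have P2: "prob {\<omega> \<in> space (pspace s). \<gamma> * N \<le> X2 \<omega>} \<le> b / (c * \<gamma>)"
  proof -
    have le: "X2 \<omega> \<le> (\<Sum>(i, j)\<in>E. 1 / (c * r) * indicator {\<omega> \<in> Bad (i, j). obsv i j \<omega> = 1} \<omega>)"
      if "\<omega> \<in> space (pspace s)" for \<omega>
      unfolding X2_def using x2b that by (intro sum_mono) auto
    have le': "(\<Sum>(i, j)\<in>E. 1 / (c * r) * indicator {\<omega> \<in> Bad (i, j). obsv i j \<omega> = 1} \<omega>) \<le> N / (c * r)" for \<omega>
    proof -
      have "(\<Sum>(i, j)\<in>E. 1 / (c * r) * indicator {\<omega> \<in> Bad (i, j). obsv i j \<omega> = 1} \<omega>) \<le> (\<Sum>(i, j)\<in>E. 1 / (c * r))"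
        using cr by (intro sum_mono) (auto split: split_indicator)
      then show ?thesis using cardE by (simp add: case_prod_unfold)
    qed
    have nn: "0 \<le> X2 \<omega>" if "\<omega> \<in> space (pspace s)" for \<omega>
      unfolding X2_def using x2b that by (intro sum_nonneg) auto
    have bound: "0 \<le> X2 \<omega> \<and> X2 \<omega> \<le> N / (c * r)" if "\<omega> \<in> space (pspace s)" for \<omega>
      using nn[OF that] le[OF that] le'[of \<omega>] by linarith
    have "expectation X2 \<le> expectation (\<lambda>\<omega>. \<Sum>(i, j)\<in>E. 1 / (c * r) * indicator {\<omega> \<in> Bad (i, j). obsv i j \<omega> = 1} \<omega>)"
    proof (rule integral_mono)
      show "integrable (pspace s) X2"
        using bound by (intro integrable_const_bound[where B="N / (c * r)"]) auto
    qed (use x2i le in \<open>auto simp: case_prod_unfold intro!: Bochner_Integration.integrable_sum\<close>)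
    also have "\<dots> = (\<Sum>(i, j)\<in>E. 1 / (c * r) * prob {\<omega> \<in> Bad (i, j). obsv i j \<omega> = 1})"
    proof -
      have "{\<omega> \<in> Bad e. obsv (fst e) (snd e) \<omega> = 1} \<inter> space (pspace s) = {\<omega> \<in> Bad e. obsv (fst e) (snd e) \<omega> = 1}"
        if "e \<in> E" for e
        using sets.sets_into_space[OF badm[of "fst e" "snd e"]] that by auto
      then show ?thesis
        using x2i unfolding case_prod_unfold by (subst Bochner_Integration.integral_sum) auto
    qed
    also have "\<dots> \<le> (\<Sum>(i, j)\<in>E. 1 / (c * r) * (r * b))"
    proof (rule sum_mono, unfold split_paired_all prod.case)
      fix i j assume "(i, j) \<in> E"
      from Bad(2)[OF this] show "1 / (c * r) * prob {\<omega> \<in> Bad (i, j). obsv i j \<omega> = 1} \<le> 1 / (c * r) * (r * b)"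
        using cr by (intro mult_left_mono) auto
    qed
    also have "\<dots> = N * b / c" using cardE r_pos by (simp add: case_prod_unfold)
    finally have "prob {\<omega> \<in> space (pspace s). \<gamma> * N \<le> X2 \<omega>} \<le> (N * b / c) / (\<gamma> * N)"
      using bound N \<gamma>(1) by (intro markov_prob[where K="N / (c * r)"]) auto
    then show ?thesis using N by (simp add: mult.commute)
  qed

  have X4m [measurable]: "X4 \<in> borel_measurable (pspace s)"
    unfolding X4_def case_prod_unfold using om by (intro borel_measurable_sum) auto
  have X4b: "0 \<le> X4 \<omega> \<and> X4 \<omega> \<le> N" for \<omega>
  proof
    show "0 \<le> X4 \<omega>" unfolding X4_def using obs_nonneg by (intro sum_nonneg) auto
    have "X4 \<omega> \<le> (\<Sum>e\<in>E. 1)" unfolding X4_def using obs_values by (intro sum_mono) (auto, metis insert_iff empty_iff order.refl zero_le_one)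
    then show "X4 \<omega> \<le> N" using cardE by simp
  qed
  have P4: "prob {\<omega> \<in> space (pspace s). x \<le> X4 \<omega>} \<le> N * (C * r) / x" if "0 < x" for x
    using X4b expectation_obs_le[OF ED] cardE that
    by (intro markov_prob[where K=N] X4m) (auto simp: X4_def[abs_def])

  have X5m [measurable]: "X5 \<in> borel_measurable (pspace s)"
    unfolding X5_def case_prod_unfold using q(1) pm
    by (intro borel_measurable_sum borel_measurable_power borel_measurable_diff) auto
  have P5: "prob {\<omega> \<in> space (pspace s). x \<le> X5 \<omega>} \<le> f / x" if x: "0 < x" for x
  proof -
    have "emeasure (pspace s) {\<omega> \<in> space (pspace s). 1 \<le> ennreal (1 / x) * ennreal (X5 \<omega>)} \<le>
        ennreal (1 / x) * (\<integral>\<^sup>+\<omega>. ennreal (X5 \<omega>) * indicator (space (pspace s)) \<omega> \<partial>pspace s)"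
      by (rule nn_integral_Markov_inequality) auto
    also have "(\<integral>\<^sup>+\<omega>. ennreal (X5 \<omega>) * indicator (space (pspace s)) \<omega> \<partial>pspace s) = (\<integral>\<^sup>+\<omega>. ennreal (X5 \<omega>) \<partial>pspace s)"
      by (intro nn_integral_cong) auto
    also have "ennreal (1 / x) * (\<integral>\<^sup>+\<omega>. ennreal (X5 \<omega>) \<partial>pspace s) \<le> ennreal (1 / x) * ennreal f"
      using frob(1) unfolding X5_def by (intro mult_left_mono) auto
    also have "\<dots> = ennreal (f / x)" using x frob(2) by (simp flip: ennreal_mult'')
    also have "{\<omega> \<in> space (pspace s). 1 \<le> ennreal (1 / x) * ennreal (X5 \<omega>)} = {\<omega> \<in> space (pspace s). x \<le> X5 \<omega>}"
    proof -
      have "1 \<le> ennreal (1 / x) * ennreal (X5 \<omega>) \<longleftrightarrow> x \<le> X5 \<omega>" for \<omega>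
      proof -
        have "0 \<le> X5 \<omega>" unfolding X5_def by (intro sum_nonneg) auto
        then have "ennreal (1 / x) * ennreal (X5 \<omega>) = ennreal (X5 \<omega> / x)" using x by (simp flip: ennreal_mult'')
        then show ?thesis using x \<open>0 \<le> X5 \<omega>\<close> by (simp add: pos_le_divide_eq)
      qed
      then show ?thesis by auto
    qed
    finally show ?thesis using x frob(2) by (simp add: emeasure_eq_measure)
  qed

  \<comment> \<open>Finitely many almost sure lower bounds share one null set.\<close>
  have "AE \<omega> in pspace s. \<forall>e\<in>E. c * r \<le> q (fst e) (snd e) \<omega>"
    using q(2) finE by (subst AE_finite_all) auto
  then obtain H0 where H0: "H0 \<in> null_sets (pspace s)"
      "{\<omega> \<in> space (pspace s). \<not> (\<forall>e\<in>E. c * r \<le> q (fst e) (snd e) \<omega>)} \<subseteq> H0"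
    by (auto elim!: AE_E3 simp: null_sets_def)
  let ?H1 = "{\<omega> \<in> space (pspace s). \<gamma> * N \<le> \<bar>X1 \<omega> - expectation X1\<bar>}"
  let ?H2 = "{\<omega> \<in> space (pspace s). \<gamma> * N \<le> X2 \<omega>}"
  \<comment> \<open>Chosen so that X4 < \<open>?x\<close> and X5 < \<open>?y\<close> make each of
    the two terms that bound X3 less than \<gamma> * N / 2.\<close>
  let ?x = "\<gamma> * N * c\<^sup>2 * r / \<theta>" and ?y = "\<gamma> * N * \<theta> * c\<^sup>2 * r ^ 3"
  let ?H3 = "{\<omega> \<in> space (pspace s). ?x \<le> X4 \<omega>}"
  let ?H4 = "{\<omega> \<in> space (pspace s). ?y \<le> X5 \<omega>}"
  \<comment> \<open>All dyads observed, the only way for \<open>rho_hat\<close> to reach 1.\<close>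
  let ?H5 = "{\<omega> \<in> space (pspace s). N \<le> X4 \<omega>}"
  let ?H = "H0 \<union> ?H1 \<union> ?H2 \<union> (?H3 \<union> ?H4) \<union> ?H5"
  have xy: "0 < ?x" "0 < ?y" using \<gamma> N c_pos r_pos \<theta> by auto
  have H0m: "H0 \<in> events" "prob H0 = 0" using H0(1) by (auto simp: measure_eq_0_null_sets)
  have Hm: "?H1 \<in> events" "?H2 \<in> events" "?H3 \<in> events" "?H4 \<in> events" "?H5 \<in> events" by measurable
  have "prob ?H \<le> prob (H0 \<union> ?H1 \<union> ?H2 \<union> (?H3 \<union> ?H4)) + prob ?H5"
    using H0m Hm by (intro measure_Un_le) auto
  also have "prob (H0 \<union> ?H1 \<union> ?H2 \<union> (?H3 \<union> ?H4)) \<le> prob (H0 \<union> ?H1 \<union> ?H2) + prob (?H3 \<union> ?H4)"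
    using H0m Hm by (intro measure_Un_le) auto
  also have "prob (H0 \<union> ?H1 \<union> ?H2) \<le> prob (H0 \<union> ?H1) + prob ?H2"
    using H0m Hm by (intro measure_Un_le) auto
  also have "prob (H0 \<union> ?H1) \<le> prob H0 + prob ?H1" using H0m Hm by (intro measure_Un_le) auto
  also have "prob (?H3 \<union> ?H4) \<le> prob ?H3 + prob ?H4" using Hm by (intro measure_Un_le) auto
  finally have PH: "prob ?H \<le> prob ?H1 + prob ?H2 + (prob ?H3 + prob ?H4) + prob ?H5" using H0m(2) by simp
  have P3': "prob ?H3 \<le> \<theta> * C / (\<gamma> * c\<^sup>2)"
    using P4[OF xy(1)] N r_pos c_pos \<theta> \<gamma>(1) by (simp add: field_simps)
  have P5': "prob ?H5 \<le> C * r" using P4[OF N] N by simp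
  have small: "prob ?H \<le> (C / (c\<^sup>2 * r) + 4 * real n * (C / c)\<^sup>2) / (\<gamma>\<^sup>2 * N) + b / (c * \<gamma>)
        + (\<theta> * C / (\<gamma> * c\<^sup>2) + f / (\<gamma> * N * \<theta> * c\<^sup>2 * r ^ 3)) + C * r"
    using PH P1 P2 P3' P5[OF xy(2)] P5' by linarith
  have "\<alpha> < Pi_weighted n (\<lambda>i j. obsv i j \<omega>) (\<lambda>i j. q i j \<omega>) (\<lambda>i j. S i j \<omega>) k l"
    if \<omega>: "\<omega> \<in> space (pspace s)" "\<omega> \<notin> ?H" "S k l \<omega> \<le> t" for \<omega>
  proof -
    have qpos: "c * r \<le> q i j \<omega>" if "(i, j) \<in> E" for i j using H0(2) \<omega>(1,2) that by force
    have h: "\<bar>X1 \<omega> - expectation X1\<bar> < \<gamma> * N" "X2 \<omega> < \<gamma> * N" "X4 \<omega> < ?x" "X5 \<omega> < ?y" "X4 \<omega> < N"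
      using \<omega>(1,2) by auto
    have X3: "X3 \<omega> \<le> \<theta> / (2 * c\<^sup>2 * r) * X4 \<omega> + 1 / (2 * \<theta> * c\<^sup>2 * r ^ 3) * X5 \<omega>"
    proof -
      have "obsv i j \<omega> * \<bar>1 / q i j \<omega> - 1 / p i j \<omega>\<bar> \<le>
          \<theta> / (2 * c\<^sup>2 * r) * obsv i j \<omega> + 1 / (2 * \<theta> * c\<^sup>2 * r ^ 3) * (q i j \<omega> - p i j \<omega>)\<^sup>2" if e: "(i, j) \<in> E" for i j
      proof -
        have pb: "c * r \<le> p i j \<omega>" using p_bounds(1)[OF ij(1,2)[OF e] \<omega>(1)] .
        let ?d = "\<bar>q i j \<omega> - p i j \<omega>\<bar>"
        have pos: "0 < p i j \<omega>" "0 < q i j \<omega>" using pb qpos[OF e] cr by linarith+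
        have "1 / q i j \<omega> - 1 / p i j \<omega> = (p i j \<omega> - q i j \<omega>) / (q i j \<omega> * p i j \<omega>)"
          using pos by (simp add: field_simps)
        then have "\<bar>1 / q i j \<omega> - 1 / p i j \<omega>\<bar> = ?d / (q i j \<omega> * p i j \<omega>)"
          using pos by (simp add: abs_mult)
        also have "\<dots> \<le> ?d / ((c * r) * (c * r))"
          using pb qpos[OF e] pos cr c_pos r_pos
          by (intro divide_left_mono mult_mono mult_pos_pos) linarith+
        \<comment> \<open>Young's inequality in place of Cauchy-Schwarz, to keep the bound dyad by
          dyad. The scale \<theta> * r makes the first term, summed over observed dyads, whose
          number is of order N * r, of order \<theta> * N.\<close>
        also have "\<dots> \<le> (\<theta> * r / 2 + ?d\<^sup>2 / (2 * (\<theta> * r))) / ((c * r) * (c * r))"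
        proof (rule divide_right_mono)
          have "0 \<le> (?d - \<theta> * r)\<^sup>2 / (2 * (\<theta> * r))" using \<theta> r_pos by simp
          also have "\<dots> = \<theta> * r / 2 + ?d\<^sup>2 / (2 * (\<theta> * r)) - ?d"
            using \<theta> r_pos by (simp add: power2_eq_square field_simps)
          finally show "?d \<le> \<theta> * r / 2 + ?d\<^sup>2 / (2 * (\<theta> * r))" by simp
        qed (use cr in simp)
        also have "\<dots> = \<theta> / (2 * c\<^sup>2 * r) + 1 / (2 * \<theta> * c\<^sup>2 * r ^ 3) * (q i j \<omega> - p i j \<omega>)\<^sup>2"
          using \<theta> r_pos c_pos by (simp add: power2_eq_square power3_eq_cube field_simps)
        finally have "\<bar>1 / q i j \<omega> - 1 / p i j \<omega>\<bar> \<le> \<theta> / (2 * c\<^sup>2 * r) + 1 / (2 * \<theta> * c\<^sup>2 * r ^ 3) * (q i j \<omega> - p i j \<omega>)\<^sup>2" .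
        \<comment> \<open>In the squared error the indicator of observation is dropped, so the error
          over all dyads appears, which the Frobenius norm bounds.\<close>
        moreover have "0 \<le> 1 / (2 * \<theta> * c\<^sup>2 * r ^ 3) * (q i j \<omega> - p i j \<omega>)\<^sup>2" using \<theta> r_pos by simp
        ultimately show ?thesis using obs_values[of i j \<omega>] by auto
      qed
      then have "X3 \<omega> \<le> (\<Sum>(i, j)\<in>E. \<theta> / (2 * c\<^sup>2 * r) * obsv i j \<omega> + 1 / (2 * \<theta> * c\<^sup>2 * r ^ 3) * (q i j \<omega> - p i j \<omega>)\<^sup>2)"
        unfolding X3_def by (intro sum_mono) auto
      then show ?thesis unfolding X4_def X5_def by (simp only: case_prod_unfold sum.distrib sum_distrib_left)
    qed
    also have "\<dots> < \<gamma> * N / 2 + \<gamma> * N / 2"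
    proof (rule add_strict_mono)
      have "\<theta> / (2 * c\<^sup>2 * r) * X4 \<omega> < \<theta> / (2 * c\<^sup>2 * r) * ?x"
        using h(3) \<theta> r_pos c_pos by (intro mult_strict_left_mono) auto
      then show "\<theta> / (2 * c\<^sup>2 * r) * X4 \<omega> < \<gamma> * N / 2" using \<theta> r_pos c_pos by simp
      have "1 / (2 * \<theta> * c\<^sup>2 * r ^ 3) * X5 \<omega> < 1 / (2 * \<theta> * c\<^sup>2 * r ^ 3) * ?y"
        using h(4) \<theta> r_pos c_pos by (intro mult_strict_left_mono) auto
      then show "1 / (2 * \<theta> * c\<^sup>2 * r ^ 3) * X5 \<omega> < \<gamma> * N / 2" using \<theta> r_pos c_pos by simp
    qed
    finally have X3: "X3 \<omega> < \<gamma> * N" by (simp add: mult.commute)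
    have "(\<alpha> + 4 * \<gamma>) * N \<le> N * \<beta>" using \<gamma>(2) N by (simp add: mult.commute)
    then have X1: "\<alpha> * N + 3 * (\<gamma> * N) < X1 \<omega>" using h(1) EX1 by (simp add: algebra_simps abs_if split: if_splits)
    show ?thesis
    proof (rule Pi_weighted_gt[OF n])
      show "(k, l) \<in> dyads (D2 n)" using kl by (simp add: E_def)
      show "obsv i j \<omega> \<in> {0, 1}" for i j by (rule obs_values)
      show "0 < p i j \<omega> \<and> p i j \<omega> \<le> 1" if "(i, j) \<in> dyads (D2 n)" for i j
        using p_bounds[OF ij(1,2)[of i j] \<omega>(1)] that by (auto simp: E_def)
      show "0 < q i j \<omega>" if "(i, j) \<in> dyads (D2 n)" for i j
        using qpos[of i j] that cr by (simp add: E_def)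
      show "S k l \<omega> \<le> t" by fact
      show "t \<le> S i j \<omega>" if "(i, j) \<in> dyads (D2 n)" "\<omega> \<in> B (i, j)" "\<not> \<omega> \<in> Bad (i, j)" for i j
        using S that by (simp add: E_def)
      show "rho_hat n (\<lambda>i j. obsv i j \<omega>) < 1"
        using h(5) N by (simp add: rho_hat_def X4_def E_def N_def)
      have "\<alpha> * N < X1 \<omega> - X2 \<omega> - X3 \<omega> - 1" using X1 h(2) X3 \<gamma>(3) by linarith
      then show "\<alpha> * real ((n div 2) choose 2) <
          (\<Sum>(i, j)\<in>dyads (D2 n). obsv i j \<omega> * (1 / p i j \<omega> - 1) * of_bool (\<omega> \<in> B (i, j)))
          - (\<Sum>(i, j)\<in>dyads (D2 n). obsv i j \<omega> / p i j \<omega> * of_bool (\<omega> \<in> Bad (i, j)))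
          - (\<Sum>(i, j)\<in>dyads (D2 n). obsv i j \<omega> * \<bar>1 / q i j \<omega> - 1 / p i j \<omega>\<bar>) - 1"
        unfolding X1_def X2_def X3_def E_def N_def weight_def indicator_def by (simp add: case_prod_unfold)
    qed (rule \<alpha>)
  qed
  then have "{\<omega> \<in> space (pspace s). S k l \<omega> \<le> t \<and>
        Pi_weighted n (\<lambda>i j. obsv i j \<omega>) (\<lambda>i j. q i j \<omega>) (\<lambda>i j. S i j \<omega>) k l \<le> \<alpha>} \<subseteq> ?H"
    by (auto simp flip: not_less)
  moreover have "?H \<in> events" using H0m Hm by auto
  ultimately show ?thesis using small by blast
qed

end

section \<open>Asymptotics\<close>

locale model_array =
  fixes SX :: "'x measure" and SZ :: "'z measure" and D :: "('x \<times> real \<times> 'z) measure"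
    and V :: "'v measure" and g :: "'x \<Rightarrow> 'z \<Rightarrow> 'x \<Rightarrow> 'z \<Rightarrow> 'v \<Rightarrow> real" and w :: "real \<Rightarrow> real \<Rightarrow> real"
    and \<rho> :: "nat \<Rightarrow> real" and smp :: "nat \<Rightarrow> ('a, 'x, 'z, 'v) sample"
    and phat :: "nat \<Rightarrow> nat \<Rightarrow> nat \<Rightarrow> 'a \<Rightarrow> real" and c C :: real
  assumes dyadic_model: "dyadic_model SX SZ D V g w \<rho> smp"
    and c_pos: "0 < c"
    and w_bounds: "\<And>u v. u \<in> {0..1} \<Longrightarrow> v \<in> {0..1} \<Longrightarrow> c \<le> w u v \<and> w u v \<le> C"
    and phat_measurable:
      "\<And>n i j. i \<in> {1..n} \<Longrightarrow> j \<in> {1..n} \<Longrightarrow> phat n i j \<in> borel_measurable (pspace (smp n))"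
    and phat_lower:
      "\<And>n i j. i \<in> {1..n} \<Longrightarrow> j \<in> {1..n} \<Longrightarrow> AE \<omega> in pspace (smp n). phat n i j \<omega> / \<rho> n \<ge> c"
    and rho_large: "filterlim (\<lambda>n. \<rho> n / (sqrt (ln (real n)) / real n)) at_top even_top"
    and phat_consistent: "((\<lambda>n. (\<integral>\<^sup>+\<omega>. ennreal ((frobenius_norm n
          (\<lambda>i j. phat n i j \<omega> - pmat w (\<rho> n) (smp n) i j \<omega>))\<^sup>2) \<partial>pspace (smp n))
        / ennreal ((real n)\<^sup>2 * \<rho> n ^ 3)) \<longlongrightarrow> 0) even_top"
begin

lemma rho_pos: "0 < \<rho> n" using dyadic_model by (simp add: dyadic_model_def)

lemma C_pos: "0 < C" using w_bounds[of 0 0] c_pos by auto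

lemma rho_small: "0 < \<epsilon> \<Longrightarrow> \<forall>\<^sub>F n in even_top. C * \<rho> n < \<epsilon>"
proof -
  assume "0 < \<epsilon>"
  have "((\<lambda>n. C * \<rho> n) \<longlongrightarrow> C * 0) even_top"
    using dyadic_model by (intro tendsto_mult tendsto_const) (simp add: dyadic_model_def)
  then show ?thesis using \<open>0 < \<epsilon>\<close> by (intro order_tendstoD(2)) auto
qed

lemma sampled_smp: "sampled SX SZ D V n (smp n)"
  using dyadic_model by unfold_locales (simp add: dyadic_model_def)

lemma eventually_model: "\<forall>\<^sub>F n in even_top. model SX SZ D V n (smp n) g w (\<rho> n) c C"
  using rho_small[of 1]
proof (rule eventually_mono)
  fix n assume "C * \<rho> n < 1"
  then show "model SX SZ D V n (smp n) g w (\<rho> n) c C"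
    using sampled_smp[of n] dyadic_model w_bounds c_pos
    by (auto simp: model_def model_axioms_def dyadic_model_def mult.commute)
qed simp

text \<open>Turns the growth hypothesis into 1 / \<rho> \<le> n, which makes the Chebyshev term of
  order 1/n; the logarithm is at least 1 from n = 3 on.\<close>

lemma n_rho_ge_1: "\<forall>\<^sub>F n in even_top. 1 \<le> real n * \<rho> n"
proof -
  have "\<forall>\<^sub>F n in even_top. 1 \<le> \<rho> n / (sqrt (ln (real n)) / real n)"
    using rho_large by (simp add: filterlim_at_top)
  with eventually_even_top[of 3] show ?thesis
  proof eventually_elim
    case (elim n)
    have "1 \<le> ln (real n)" using elim(1) exp_le by (subst ln_ge_iff) auto
    then have 1: "1 \<le> sqrt (ln (real n))" by simp
    have "0 < sqrt (ln (real n)) / real n" using 1 elim(1) by (intro divide_pos_pos) linarith+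
    then have "sqrt (ln (real n)) / real n \<le> \<rho> n" using elim(2) by (metis mult_1 pos_le_divide_eq)
    then have "sqrt (ln (real n)) \<le> real n * \<rho> n" using elim(1) by (simp add: divide_le_eq mult.commute)
    then show ?case using 1 by linarith
  qed
qed

lemma frobenius_small:
  assumes "0 < \<epsilon>"
  shows "\<forall>\<^sub>F n in even_top. (\<integral>\<^sup>+\<omega>. ennreal (\<Sum>(i, j)\<in>dyads (D2 n). (phat n i j \<omega> - pmat w (\<rho> n) (smp n) i j \<omega>)\<^sup>2) \<partial>pspace (smp n))
    \<le> ennreal (\<epsilon> * ((real n)\<^sup>2 * \<rho> n ^ 3))"
proof -
  have "\<forall>\<^sub>F n in even_top. (\<integral>\<^sup>+\<omega>. ennreal ((frobenius_norm n
          (\<lambda>i j. phat n i j \<omega> - pmat w (\<rho> n) (smp n) i j \<omega>))\<^sup>2) \<partial>pspace (smp n))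
        / ennreal ((real n)\<^sup>2 * \<rho> n ^ 3) < ennreal \<epsilon>"
    using order_tendstoD(2)[OF phat_consistent, of "ennreal \<epsilon>"] assms by simp
  with eventually_even_top[of 1] show ?thesis
  proof eventually_elim
    case (elim n)
    let ?F = "\<integral>\<^sup>+\<omega>. ennreal ((frobenius_norm n (\<lambda>i j. phat n i j \<omega> - pmat w (\<rho> n) (smp n) i j \<omega>))\<^sup>2) \<partial>pspace (smp n)"
    let ?s = "(real n)\<^sup>2 * \<rho> n ^ 3"
    have s: "0 < ?s" using elim(1) rho_pos[of n] by simp
    have "(\<integral>\<^sup>+\<omega>. ennreal (\<Sum>(i, j)\<in>dyads (D2 n). (phat n i j \<omega> - pmat w (\<rho> n) (smp n) i j \<omega>)\<^sup>2) \<partial>pspace (smp n)) \<le> ?F"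
    proof (intro nn_integral_mono ennreal_leI)
      fix \<omega>
      let ?d = "\<lambda>i j. phat n i j \<omega> - pmat w (\<rho> n) (smp n) i j \<omega>"
      have "(frobenius_norm n ?d)\<^sup>2 = (\<Sum>i\<in>{1..n}. \<Sum>j\<in>{1..n}. (?d i j)\<^sup>2)"
        unfolding frobenius_norm_def by (intro real_sqrt_pow2 sum_nonneg) auto
      also have "\<dots> = (\<Sum>(i, j)\<in>{1..n} \<times> {1..n}. (?d i j)\<^sup>2)" by (rule sum.cartesian_product)
      also have "(\<Sum>(i, j)\<in>dyads (D2 n). (?d i j)\<^sup>2) \<le> \<dots>"
        by (intro sum_mono2) (auto simp: dyads_def D2_def)
      finally show "(\<Sum>(i, j)\<in>dyads (D2 n). (?d i j)\<^sup>2) \<le> (frobenius_norm n ?d)\<^sup>2" .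
    qed
    also have "?F = ?F / ennreal ?s * ennreal ?s"
      by (rule ennreal_divide_mult_self[OF s, symmetric])
    also have "\<dots> \<le> ennreal \<epsilon> * ennreal ?s" using elim(2) by (intro mult_right_mono) auto
    also have "\<dots> = ennreal (\<epsilon> * ?s)" using assms s by (simp add: ennreal_mult)
    finally show ?case .
  qed
qed

text \<open>From m - 1 \<ge> m / 2 for n = 2 * m with m \<ge> 2; the crude constant 16 reappears in
  the choice of constants below.\<close>

lemma choose_2_lower:
  assumes "even n" "4 \<le> n"
  shows "(real n)\<^sup>2 / 16 \<le> real ((n div 2) choose 2)"
proof -
  obtain m where m: "n = 2 * m" using assms(1) by (rule evenE)
  have "2 \<le> m" using m assms(2) by simp
  have "real (m choose 2) = real m * (real m - 1) / 2"
    using \<open>2 \<le> m\<close> by (simp add: binomial_gbinomial gbinomial_prod_rev numeral_2_eq_2 field_simps)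
  moreover have "real m * (real m / 2) \<le> real m * (real m - 1)" using \<open>2 \<le> m\<close> by (intro mult_left_mono) auto
  ultimately show ?thesis by (simp add: m power2_eq_square)
qed

text \<open>Interface between the finite-sample bound and the two kinds of score: only the
  threshold, the oracle events \<open>B\<close> and the error events \<open>Bad\<close> depend on
  the setting.\<close>

theorem vanishing_miss:
  fixes S :: "nat \<Rightarrow> nat \<Rightarrow> nat \<Rightarrow> 'a \<Rightarrow> real" and B Bad :: "nat \<Rightarrow> nat \<times> nat \<Rightarrow> 'a set"
  assumes kl: "pair_seq k l" and \<alpha>: "0 \<le> \<alpha>" "\<alpha> < \<beta>"
    and B: "\<forall>\<^sub>F n in even_top. \<forall>(i, j)\<in>dyads (D2 n).
        B n (i, j) \<in> sets (sampled.src_alg SX SZ V (smp n) (dyad_sources i j)) \<and>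
        \<beta> \<le> measure (pspace (smp n)) {\<omega> \<in> B n (i, j). obs w (\<rho> n) (smp n) i j \<omega> = 0}"
    and Bad: "\<And>b. 0 < b \<Longrightarrow> \<forall>\<^sub>F n in even_top. \<forall>(i, j)\<in>dyads (D2 n).
        Bad n (i, j) \<in> sets (pspace (smp n)) \<and>
        measure (pspace (smp n)) {\<omega> \<in> Bad n (i, j). obs w (\<rho> n) (smp n) i j \<omega> = 1} \<le> \<rho> n * b"
    and S: "\<And>n i j \<omega>. even n \<Longrightarrow> (i, j) \<in> dyads (D2 n) \<Longrightarrow> \<omega> \<in> B n (i, j) \<Longrightarrow> \<omega> \<notin> Bad n (i, j) \<Longrightarrow> t \<le> S n i j \<omega>"
  shows "vanishing smp (\<lambda>n. {\<omega> \<in> space (pspace (smp n)). S n (k n) (l n) \<omega> \<le> t \<and>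
    Pi_weighted n (\<lambda>i j. obs w (\<rho> n) (smp n) i j \<omega>) (\<lambda>i j. phat n i j \<omega>) (\<lambda>i j. S n i j \<omega>) (k n) (l n) \<le> \<alpha>})"
proof (rule vanishingI)
  fix \<epsilon> :: real assume \<epsilon>: "0 < \<epsilon>"
  \<comment> \<open>Each of the five terms of the finite-sample bound is to be at most \<epsilon> /
    6. \<theta> is fixed before \<epsilon>', as the Frobenius term has \<theta> in its denominator.
    The 16 in K is the constant of \<open>choose_2_lower\<close>, and 96 is 6 * 16; n > 4 / \<gamma>
    yields \<gamma> * N \<ge> 1.\<close>
  define \<gamma> where "\<gamma> = (\<beta> - \<alpha>) / 4"
  define b where "b = c * \<gamma> * \<epsilon> / 6"
  define \<theta> where "\<theta> = \<gamma> * c\<^sup>2 * \<epsilon> / (6 * C)"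
  define \<epsilon>' where "\<epsilon>' = \<gamma> * \<theta> * c\<^sup>2 * \<epsilon> / 96"
  define K where "K = 16 * (C / c\<^sup>2 + 4 * (C / c)\<^sup>2) / \<gamma>\<^sup>2"
  have \<gamma>: "0 < \<gamma>" "\<alpha> + 4 * \<gamma> \<le> \<beta>" using \<alpha> by (auto simp: \<gamma>_def field_simps)
  have pos: "0 < b" "0 < \<theta>" "0 < \<epsilon>'" using \<gamma> c_pos C_pos \<epsilon> by (auto simp: b_def \<theta>_def \<epsilon>'_def)
  obtain m where m: "max (6 * K / \<epsilon>) (4 / \<gamma>) < real m" using reals_Archimedean2 by blast
  have "0 < \<epsilon> / 6" using \<epsilon> by simp
  from eventually_even_top[of "max 4 m"] eventually_model n_rho_ge_1 frobenius_small[OF pos(3)] B Bad[OF pos(1)] rho_small[OF this]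
  show "\<forall>\<^sub>F n in even_top. \<exists>A\<in>sets (pspace (smp n)). {\<omega> \<in> space (pspace (smp n)). S n (k n) (l n) \<omega> \<le> t \<and>
      Pi_weighted n (\<lambda>i j. obs w (\<rho> n) (smp n) i j \<omega>) (\<lambda>i j. phat n i j \<omega>) (\<lambda>i j. S n i j \<omega>) (k n) (l n) \<le> \<alpha>} \<subseteq> A \<and>
      measure (pspace (smp n)) A < \<epsilon>"
  proof eventually_elim
    case (elim n)
    interpret model SX SZ D V n "smp n" g w "\<rho> n" c C by (rule elim(2))
    let ?N = "real ((n div 2) choose 2)" and ?n = "real n"
    have n: "even n" "4 \<le> n" "m \<le> n" using elim(1) by auto
    have klD: "(k n, l n) \<in> dyads (D2 n)" using kl n by (simp add: pair_seq_def)
    have N: "?n\<^sup>2 / 16 \<le> ?N" by (rule choose_2_lower[OF n(1,2)])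
    have n0: "0 < ?n" using n by simp
    have N0: "0 < ?N" using N n0 by (smt (verit) divide_pos_pos zero_less_power)
    have mn: "6 * K / \<epsilon> < ?n" "4 / \<gamma> < ?n" using m n(3) by auto
    have \<gamma>N: "1 \<le> \<gamma> * ?N"
    proof -
      have "1 \<le> \<gamma> * (?n * 4 / 16)" using mn(2) \<gamma>(1) by (simp add: divide_less_eq mult.commute)
      also have "\<dots> \<le> \<gamma> * (?n * ?n / 16)" using \<gamma>(1) n(2) by (intro mult_left_mono divide_right_mono) auto
      also have "\<dots> \<le> \<gamma> * ?N" using N \<gamma>(1) by (intro mult_left_mono) (auto simp: power2_eq_square)
      finally show ?thesis .
    qed
    have rn: "1 / \<rho> n \<le> ?n" using elim(3) rho_pos[of n] by (simp add: divide_le_eq)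
    have q: "phat n i j \<in> borel_measurable (pspace (smp n))" "AE \<omega> in pspace (smp n). c * \<rho> n \<le> phat n i j \<omega>"
      if "(i, j) \<in> dyads (D2 n)" for i j
    proof -
      have ij: "i \<in> {1..n}" "j \<in> {1..n}" using that by (auto simp: dyads_def D2_def)
      show "phat n i j \<in> borel_measurable (pspace (smp n))" by (rule phat_measurable[OF ij])
      show "AE \<omega> in pspace (smp n). c * \<rho> n \<le> phat n i j \<omega>"
        using phat_lower[OF ij] by eventually_elim (use rho_pos[of n] in \<open>simp add: le_divide_eq\<close>)
    qed
    have f0: "0 \<le> \<epsilon>' * (?n\<^sup>2 * \<rho> n ^ 3)" using pos rho_pos[of n] by simp
    obtain H where H: "H \<in> events" "{\<omega> \<in> space (pspace (smp n)). S n (k n) (l n) \<omega> \<le> t \<and>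
        Pi_weighted n (\<lambda>i j. obs w (\<rho> n) (smp n) i j \<omega>) (\<lambda>i j. phat n i j \<omega>) (\<lambda>i j. S n i j \<omega>) (k n) (l n) \<le> \<alpha>} \<subseteq> H"
      "prob H \<le> (C / (c\<^sup>2 * \<rho> n) + 4 * ?n * (C / c)\<^sup>2) / (\<gamma>\<^sup>2 * ?N) + b / (c * \<gamma>)
        + (\<theta> * C / (\<gamma> * c\<^sup>2) + \<epsilon>' * (?n\<^sup>2 * \<rho> n ^ 3) / (\<gamma> * ?N * \<theta> * c\<^sup>2 * \<rho> n ^ 3)) + C * \<rho> n"
      using weighted_set_miss_bound[OF n(1) klD \<alpha>(1) q elim(4) f0, of "B n" \<beta> "Bad n" b t "S n" \<gamma> \<theta>]
        elim(5,6) S[OF n(1)] \<gamma> \<gamma>N pos(2) by blast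
    have "(C / (c\<^sup>2 * \<rho> n) + 4 * ?n * (C / c)\<^sup>2) / (\<gamma>\<^sup>2 * ?N) \<le>
        ((C / c\<^sup>2) * ?n + 4 * ?n * (C / c)\<^sup>2) / (\<gamma>\<^sup>2 * (?n\<^sup>2 / 16))"
    proof (rule frac_le)
      have "C / (c\<^sup>2 * \<rho> n) = (C / c\<^sup>2) * (1 / \<rho> n)" by simp
      also have "\<dots> \<le> (C / c\<^sup>2) * ?n" using rn C_pos by (intro mult_left_mono) auto
      finally show "C / (c\<^sup>2 * \<rho> n) + 4 * ?n * (C / c)\<^sup>2 \<le> (C / c\<^sup>2) * ?n + 4 * ?n * (C / c)\<^sup>2" by simp
      show "0 \<le> C / c\<^sup>2 * ?n + 4 * ?n * (C / c)\<^sup>2" using C_pos by simp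
      show "0 < \<gamma>\<^sup>2 * (?n\<^sup>2 / 16)" using \<gamma>(1) n0 by simp
      show "\<gamma>\<^sup>2 * (?n\<^sup>2 / 16) \<le> \<gamma>\<^sup>2 * ?N" using N by (intro mult_left_mono) auto
    qed
    also have "\<dots> = K / ?n" using n0 \<gamma>(1) by (simp add: K_def power2_eq_square field_simps)
    also have "\<dots> < \<epsilon> / 6" using mn(1) n0 \<epsilon> by (simp add: field_simps)
    finally have t1: "(C / (c\<^sup>2 * \<rho> n) + 4 * ?n * (C / c)\<^sup>2) / (\<gamma>\<^sup>2 * ?N) < \<epsilon> / 6" .
    have t2: "b / (c * \<gamma>) = \<epsilon> / 6" using c_pos \<gamma>(1) by (simp add: b_def)
    have t3: "\<theta> * C / (\<gamma> * c\<^sup>2) = \<epsilon> / 6" using c_pos \<gamma>(1) C_pos by (simp add: \<theta>_def)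
    have "\<epsilon>' * (?n\<^sup>2 * \<rho> n ^ 3) / (\<gamma> * ?N * \<theta> * c\<^sup>2 * \<rho> n ^ 3) = \<epsilon>' * ?n\<^sup>2 / (\<gamma> * \<theta> * c\<^sup>2 * ?N)"
      using rho_pos[of n] by simp
    also have "\<dots> \<le> \<epsilon>' * ?n\<^sup>2 / (\<gamma> * \<theta> * c\<^sup>2 * (?n\<^sup>2 / 16))"
      using N N0 pos \<gamma>(1) c_pos n0 by (intro divide_left_mono mult_left_mono mult_pos_pos) auto
    also have "\<dots> = \<epsilon> / 6" using \<gamma>(1) c_pos n0 pos(2) by (simp add: \<epsilon>'_def)
    finally have t4: "\<epsilon>' * (?n\<^sup>2 * \<rho> n ^ 3) / (\<gamma> * ?N * \<theta> * c\<^sup>2 * \<rho> n ^ 3) \<le> \<epsilon> / 6" .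
    have add: "h < 6 * x" if "h \<le> a1 + a2 + (a3 + a4) + a5" "a1 < x" "a2 = x" "a3 = x" "a4 \<le> x" "a5 < x" "0 < x"
      for h x a1 a2 a3 a4 a5 :: real
      using that by linarith
    have "0 < \<epsilon> / 6" using \<epsilon> by simp
    then have "prob H < \<epsilon>" using add[OF H(3) t1 t2 t3 t4 elim(7)] by simp
    then show ?case using H(1,2) by blast
  qed
qed

text \<open>R is the positive part of the shortfall of the conditional coverage, so the inequality
  holds by construction and the content is convergence to 0 in probability. For that,
  \<open>key\<close> splits the uncovered missing pairs into G, whose conditional probability given
  T is at most \<alpha> + \<epsilon>, and a negligible H.\<close>

theorem coverage:
  fixes E :: "nat \<Rightarrow> 'a set" and T :: "nat \<Rightarrow> 'a \<Rightarrow> real"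
  assumes kl: "pair_seq k l" and "\<alpha> < 1"
    and T: "\<And>n. even n \<Longrightarrow> 4 \<le> n \<Longrightarrow> T n \<in> borel_measurable (pspace (smp n))"
    and E: "\<forall>\<^sub>F n in even_top. E n \<in> sets (pspace (smp n))"
    and key: "\<And>\<epsilon>. 0 < \<epsilon> \<Longrightarrow> \<epsilon> < 1 - \<alpha> \<Longrightarrow> \<exists>G H. vanishing smp H \<and> (\<forall>\<^sub>F n in even_top.
        G n \<in> sets (pspace (smp n)) \<and>
        {\<omega> \<in> space (pspace (smp n)). obs w (\<rho> n) (smp n) (k n) (l n) \<omega> = 0} - E n \<subseteq> G n \<union> H n \<and>
        (\<forall>C\<in>sets borel. measure (given_missing w (\<rho> n) (smp n) (k n) (l n)) {\<omega> \<in> space (pspace (smp n)). \<omega> \<in> G n \<and> T n \<omega> \<in> C}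
          \<le> (\<alpha> + \<epsilon>) * measure (given_missing w (\<rho> n) (smp n) (k n) (l n)) {\<omega> \<in> space (pspace (smp n)). T n \<omega> \<in> C}))"
  shows "\<exists>R :: nat \<Rightarrow> 'a \<Rightarrow> real.
      (\<forall>n. R n \<in> borel_measurable (pspace (smp n))) \<and>
      (\<forall>n \<omega>. 0 \<le> R n \<omega>) \<and>
      (\<forall>\<epsilon>>0. ((\<lambda>n. measure (pspace (smp n)) {\<omega> \<in> space (pspace (smp n)). R n \<omega> > \<epsilon>}) \<longlongrightarrow> 0) even_top) \<and>
      (\<forall>n. even n \<and> 4 \<le> n \<longrightarrow>
        (AE \<omega> in given_missing w (\<rho> n) (smp n) (k n) (l n).
          cprob_missing w (\<rho> n) (smp n) (T n) (k n) (l n) (E n) \<omega> \<ge> 1 - \<alpha> - R n \<omega>))"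
proof -
  define cp where "cp n = cprob_missing w (\<rho> n) (smp n) (T n) (k n) (l n) (E n)" for n
  \<comment> \<open>For odd or small n, \<open>pair_seq\<close> promises no dyad and T need not be
    measurable; R is set to 0 there.\<close>
  define R where "R n \<omega> = (if even n \<and> 4 \<le> n then max 0 (1 - \<alpha> - cp n \<omega>) else 0)" for n \<omega>
  have cpm: "cp n \<in> borel_measurable (pspace (smp n))" if "even n" "4 \<le> n" for n
  proof -
    have "cp n \<in> borel_measurable (vimage_algebra (space (pspace (smp n))) (T n) borel)"
      unfolding cp_def cprob_missing_def by (rule borel_measurable_cond_exp)
    moreover have "subalgebra (pspace (smp n)) (vimage_algebra (space (pspace (smp n))) (T n) borel)"
      using T[OF that] by (auto simp: subalgebra_def sets_vimage_algebra2)
    ultimately show ?thesis using measurable_from_subalg by blast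
  qed
  have "R n \<in> borel_measurable (pspace (smp n))" for n
  proof (cases "even n \<and> 4 \<le> n")
    case True
    then have "R n = (\<lambda>\<omega>. max 0 (1 - \<alpha> - cp n \<omega>))" by (auto simp: R_def)
    then show ?thesis using cpm[of n] True by simp
  next
    case False
    then have "R n = (\<lambda>\<omega>. 0)" by (auto simp: R_def)
    then show ?thesis by simp
  qed
  moreover have "0 \<le> R n \<omega>" for n \<omega> by (simp add: R_def)
  moreover have "((\<lambda>n. measure (pspace (smp n)) {\<omega> \<in> space (pspace (smp n)). R n \<omega> > \<epsilon>}) \<longlongrightarrow> 0) even_top"
    if \<epsilon>: "0 < \<epsilon>" for \<epsilon>
  proof (rule order_tendstoI)
    fix \<delta> :: real assume "\<delta> < 0"
    then show "\<forall>\<^sub>F n in even_top. \<delta> < measure (pspace (smp n)) {\<omega> \<in> space (pspace (smp n)). R n \<omega> > \<epsilon>}"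
      by (intro always_eventually allI) (rule less_le_trans[OF _ measure_nonneg])
  next
    fix \<delta> :: real assume \<delta>: "0 < \<delta>"
    \<comment> \<open>2 * e \<le> \<epsilon> places the event R > \<epsilon> inside the event of a
      shortfall by 2 * e; the other bound keeps e in the range where \<open>key\<close>
      applies.\<close>
    define e where "e = min (\<epsilon> / 2) ((1 - \<alpha>) / 2)"
    have e: "0 < e" "e < 1 - \<alpha>" "2 * e \<le> \<epsilon>" using \<epsilon> \<open>\<alpha> < 1\<close> by (auto simp: e_def min_def)
    obtain G H where H: "vanishing smp H" and GH: "\<forall>\<^sub>F n in even_top.
        G n \<in> sets (pspace (smp n)) \<and>
        {\<omega> \<in> space (pspace (smp n)). obs w (\<rho> n) (smp n) (k n) (l n) \<omega> = 0} - E n \<subseteq> G n \<union> H n \<and>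
        (\<forall>C\<in>sets borel. measure (given_missing w (\<rho> n) (smp n) (k n) (l n)) {\<omega> \<in> space (pspace (smp n)). \<omega> \<in> G n \<and> T n \<omega> \<in> C}
          \<le> (\<alpha> + e) * measure (given_missing w (\<rho> n) (smp n) (k n) (l n)) {\<omega> \<in> space (pspace (smp n)). T n \<omega> \<in> C})"
      using key[OF e(1,2)] by blast
    \<comment> \<open>The shortfall has probability at most 2 P(A) / e + C * \<rho>, so this choice
      leaves \<delta> / 2 for the first term.\<close>
    have "\<forall>\<^sub>F n in even_top. \<exists>A\<in>sets (pspace (smp n)). H n \<subseteq> A \<and> measure (pspace (smp n)) A < \<delta> * e / 4"
    proof -
      have "0 < \<delta> * e / 4" using \<delta> e(1) by simp
      then show ?thesis using H unfolding vanishing_def by blast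
    qed
    moreover have "\<forall>\<^sub>F n in even_top. C * \<rho> n < min (1 / 2) (\<delta> / 4)" using \<delta> by (intro rho_small) simp
    moreover note eventually_even_top[of 4] eventually_model E GH
    ultimately show "\<forall>\<^sub>F n in even_top. measure (pspace (smp n)) {\<omega> \<in> space (pspace (smp n)). R n \<omega> > \<epsilon>} < \<delta>"
    proof eventually_elim
      case (elim n)
      interpret model SX SZ D V n "smp n" g w "\<rho> n" c C by (rule elim(4))
      obtain A where A: "A \<in> events" "H n \<subseteq> A" "prob A < \<delta> * e / 4" using elim(1) by blast
      have n: "even n" "4 \<le> n" using elim(3) by auto
      have kln: "(k n, l n) \<in> dyads {1..n}" using kl n dyads_D2_subset by (auto simp: pair_seq_def)
      let ?M = "{\<omega> \<in> space (pspace (smp n)). obs w (\<rho> n) (smp n) (k n) (l n) \<omega> = 0}"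
      let ?M1 = "{\<omega> \<in> space (pspace (smp n)). obs w (\<rho> n) (smp n) (k n) (l n) \<omega> = 1}"
      note [measurable] = obs_measurable[OF kln]
      have Mm: "?M \<in> events" by measurable
      have compl: "space (pspace (smp n)) - ?M = ?M1" using obs_values[of "k n" "l n"] by auto
      have M1: "prob (space (pspace (smp n)) - ?M) \<le> C * \<rho> n" unfolding compl by (rule prob_observed_le[OF kln])
      then have M0: "1 / 2 \<le> prob ?M" using prob_compl[OF Mm] elim(2) by simp
      have sub: "?M - E n \<subseteq> G n \<union> A" using elim(6) A(2) by blast
      have G: "G n \<in> events" using elim(6) by blast
      note bound = cond_prob_lower_bound[OF Mm M0 T[OF n] elim(5) G A(1) sub e(1), of \<alpha>]
      let ?X = "{\<omega> \<in> space (pspace (smp n)). cp n \<omega> < 1 - \<alpha> - 2 * e}"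
      have GT: "\<And>B. B \<in> sets borel \<Longrightarrow> measure (uniform_measure (pspace (smp n)) ?M) {\<omega> \<in> space (pspace (smp n)). \<omega> \<in> G n \<and> T n \<omega> \<in> B}
          \<le> (\<alpha> + e) * measure (uniform_measure (pspace (smp n)) ?M) {\<omega> \<in> space (pspace (smp n)). T n \<omega> \<in> B}"
        using elim(6) unfolding given_missing_def by blast
      have X: "?X \<in> events" "prob ?X \<le> 2 * prob A / e + prob (space (pspace (smp n)) - ?M)"
        unfolding cp_def cprob_missing_def given_missing_def using bound[OF GT] by blast+
      have "{\<omega> \<in> space (pspace (smp n)). R n \<omega> > \<epsilon>} \<subseteq> ?X" using e(3) \<epsilon> n by (auto simp: R_def)
      then have "prob {\<omega> \<in> space (pspace (smp n)). R n \<omega> > \<epsilon>} \<le> prob ?X" using X(1) by (rule finite_measure_mono)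
      also have "\<dots> \<le> 2 * prob A / e + C * \<rho> n" using X(2) M1 by linarith
      also have "2 * prob A / e < \<delta> / 2" using A(3) e(1) by (simp add: field_simps)
      finally show ?case using elim(2) \<delta> by simp
    qed
  qed
  moreover have "AE \<omega> in given_missing w (\<rho> n) (smp n) (k n) (l n). cp n \<omega> \<ge> 1 - \<alpha> - R n \<omega>"
    if "even n \<and> 4 \<le> n" for n
    using that by (intro AE_I2) (auto simp: R_def)
  ultimately show ?thesis unfolding cp_def by (intro exI[of _ R]) blast
qed

end

section \<open>Measurability of the fitted quantities\<close>

text \<open>Inserting the true response as candidate restores the actual scores, so coverage is an
  inequality for the weighted tail at these scores.\<close>

lemma resp_in_C_weighted_iff:
  "Y k l \<in> C_weighted ys \<alpha> n M p score Y Yhat k l \<longleftrightarrow>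
    Y k l \<in> ys \<and> \<alpha> < Pi_weighted n M p (\<lambda>i j. score (Y i j) (Yhat i j)) k l"
proof -
  have "(\<lambda>i j. score (if (i, j) = (k, l) then Y k l else Y i j) (Yhat i j)) = (\<lambda>i j. score (Y i j) (Yhat i j))"
    by (intro ext) auto
  then show ?thesis by (simp add: C_weighted_def)
qed

lemma D1_D2_subset: "D1 n \<subseteq> {1..n}" "D2 n \<subseteq> {1..n}" "D1 n \<inter> D2 n = {}"
  by (auto simp: D1_def D2_def)

context model
begin

text \<open>The calibration set is random; a sum over all dyads of \<open>D2 n\<close> with a case
  distinction has a fixed index set.\<close>

lemma Pi_weighted_measurable:
  assumes kl: "(k, l) \<in> dyads (D2 n)"
    and q: "\<And>i j. (i, j) \<in> dyads (D2 n) \<Longrightarrow> q i j \<in> borel_measurable (pspace s)"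
    and S: "\<And>i j. (i, j) \<in> dyads (D2 n) \<Longrightarrow> S i j \<in> borel_measurable (pspace s)"
  shows "(\<lambda>\<omega>. Pi_weighted n (\<lambda>i j. obsv i j \<omega>) (\<lambda>i j. q i j \<omega>) (\<lambda>i j. S i j \<omega>) k l) \<in> borel_measurable (pspace s)"
proof -
  let ?E = "dyads (D2 n)"
  have om: "obsv (fst e) (snd e) \<in> borel_measurable (pspace s)" if "e \<in> ?E" for e
    using that subsetD[OF dyads_D2_subset that] obs_measurable[of "fst e" "snd e"] by simp
  have eq: "(\<Sum>(i, j)\<in>calibration_set n (\<lambda>i j. obsv i j \<omega>) \<union> {(k, l)}. (1 - q i j \<omega>) / q i j \<omega> * of_bool (S i j \<omega> \<ge> S k l \<omega>)) =
     (\<Sum>e\<in>?E. if obsv (fst e) (snd e) \<omega> = 1 \<or> e = (k, l)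
        then (1 - q (fst e) (snd e) \<omega>) / q (fst e) (snd e) \<omega> * of_bool (S (fst e) (snd e) \<omega> \<ge> S k l \<omega>) else 0)" for \<omega>
  proof -
    have "calibration_set n (\<lambda>i j. obsv i j \<omega>) \<union> {(k, l)} = {e \<in> ?E. obsv (fst e) (snd e) \<omega> = 1 \<or> e = (k, l)}"
      using kl by (auto simp: calibration_set_def)
    then show ?thesis by (simp only: sum.inter_filter[OF finite_dyads_D2] case_prod_unfold)
  qed
  have [measurable]: "(\<lambda>\<omega>. rho_hat n (\<lambda>i j. obsv i j \<omega>)) \<in> borel_measurable (pspace s)"
    unfolding rho_hat_def case_prod_unfold using om by (intro borel_measurable_divide borel_measurable_sum) auto
  have [measurable]: "(\<lambda>\<omega>. \<Sum>e\<in>?E. if obsv (fst e) (snd e) \<omega> = 1 \<or> e = (k, l)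
        then (1 - q (fst e) (snd e) \<omega>) / q (fst e) (snd e) \<omega> * of_bool (S (fst e) (snd e) \<omega> \<ge> S k l \<omega>) else 0) \<in> borel_measurable (pspace s)"
  proof (rule borel_measurable_sum)
    fix e assume e: "e \<in> ?E"
    have [measurable]: "obsv (fst e) (snd e) \<in> borel_measurable (pspace s)" by (rule om[OF e])
    have [measurable]: "q (fst e) (snd e) \<in> borel_measurable (pspace s)" "S (fst e) (snd e) \<in> borel_measurable (pspace s)"
      "S k l \<in> borel_measurable (pspace s)"
      using q S e kl by auto
    show "(\<lambda>\<omega>. if obsv (fst e) (snd e) \<omega> = 1 \<or> e = (k, l)
        then (1 - q (fst e) (snd e) \<omega>) / q (fst e) (snd e) \<omega> * of_bool (S (fst e) (snd e) \<omega> \<ge> S k l \<omega>) else 0) \<in> borel_measurable (pspace s)"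
      by measurable
  qed
  show ?thesis unfolding Pi_weighted_def eq by measurable
qed

text \<open>Measurability of the identity says that the training data are determined by the sources
  in A; in this form it composes with fitted maps, which take the sample point as their first
  argument.\<close>

lemma training_algebra_measurable:
  assumes "\<And>i j. (i, j) \<in> dyads (D1 n) \<Longrightarrow> obsv i j \<in> borel_measurable (src_alg A)"
    and "\<And>i j. (i, j) \<in> dyads (D1 n) \<Longrightarrow> d i j \<in> src_alg A \<rightarrow>\<^sub>M SD"
  shows "(\<lambda>\<omega>. \<omega>) \<in> src_alg A \<rightarrow>\<^sub>M training_algebra w r n s SD d"
  unfolding training_algebra_def
proof (rule measurable_measure_of)
  show "{{\<omega> \<in> space (pspace s). obs w r s i j \<omega> = 1 \<and> d i j \<omega> \<in> B} |i j B. (i, j) \<in> dyads (D1 n) \<and> B \<in> sets SD}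
      \<subseteq> Pow (space (pspace s))" by blast
  fix G assume "G \<in> {{\<omega> \<in> space (pspace s). obs w r s i j \<omega> = 1 \<and> d i j \<omega> \<in> B} |i j B. (i, j) \<in> dyads (D1 n) \<and> B \<in> sets SD}"
  then obtain i j B where G: "G = {\<omega> \<in> space (pspace s). obsv i j \<omega> = 1 \<and> d i j \<omega> \<in> B}"
    and ij: "(i, j) \<in> dyads (D1 n)" and [measurable]: "B \<in> sets SD" by blast
  note [measurable] = assms(1)[OF ij] assms(2)[OF ij]
  have "{\<omega> \<in> space (src_alg A). obsv i j \<omega> = 1 \<and> d i j \<omega> \<in> B} \<in> sets (src_alg A)" by measurable
  then show "(\<lambda>\<omega>. \<omega>) -` G \<inter> space (src_alg A) \<in> sets (src_alg A)" by (simp add: G Int_def conj_commute conj_left_commute)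
qed auto

lemma dyad_in_sources:
  assumes "(i, j) \<in> dyads {1..n}"
  shows "Node i \<in> sources n" "Node j \<in> sources n" "Eta i j \<in> sources n" "Nu i j \<in> sources n"
  using dyad_sources_subset[OF assms] by (auto simp: dyad_sources_def)

text \<open>The node split at work: training dyads lie in \<open>D1 n\<close>, so the coin of a dyad
  of \<open>D2 n\<close> is none of theirs.\<close>

lemma plain_measurable:
  assumes ij: "(i, j) \<in> dyads (D2 n)"
  shows "(\<lambda>\<omega>. \<omega>) \<in> src_alg (sources n - {Eta i j}) \<rightarrow>\<^sub>M training_plain SX g w r n s"
  unfolding training_plain_def
proof (rule training_algebra_measurable)
  fix a b assume ab: "(a, b) \<in> dyads (D1 n)"
  have ab': "(a, b) \<in> dyads {1..n}" using ab dyads_mono[OF D1_D2_subset(1)] by blast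
  have ne: "Eta a b \<noteq> Eta i j" using ab ij D1_D2_subset(3)[of n] by (auto simp: dyads_def)
  show "obsv a b \<in> borel_measurable (src_alg (sources n - {Eta i j}))"
    using dyad_in_sources[OF ab'] ne by (intro obs_src[OF ab']) auto
  have [measurable]: "Xcov s a \<in> src_alg (sources n - {Eta i j}) \<rightarrow>\<^sub>M SX"
    "Xcov s b \<in> src_alg (sources n - {Eta i j}) \<rightarrow>\<^sub>M SX"
    "Y a b \<in> borel_measurable (src_alg (sources n - {Eta i j}))"
    using dyad_in_sources[OF ab'] dyadsD[OF ab'] by (auto intro!: Xcov_src resp_src[OF ab'])
  show "(\<lambda>\<omega>. (Xcov s a \<omega>, Xcov s b \<omega>, Y a b \<omega>)) \<in> src_alg (sources n - {Eta i j}) \<rightarrow>\<^sub>M SX \<Otimes>\<^sub>M SX \<Otimes>\<^sub>M borel"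
    by measurable
qed

text \<open>The covariate array runs over all ordered pairs, hence also over the diagonal, where
  \<open>obs\<close> is 0, and over reversed dyads.\<close>

lemma obs_src_all:
  assumes "i \<in> {1..n}" "j \<in> {1..n}"
  shows "obsv i j \<in> borel_measurable (src_alg (sources n))"
proof -
  consider "i = j" | "i < j" | "j < i" by linarith
  then show ?thesis
  proof cases
    case 1
    then have "obsv i j = (\<lambda>_. 0)" by (auto simp: obs_def Let_def)
    then show ?thesis by simp
  next
    case 2
    then have "(i, j) \<in> dyads {1..n}" using assms by (simp add: dyads_def)
    then show ?thesis using dyad_in_sources by (intro obs_src) auto
  next
    case 3
    then have ji: "(j, i) \<in> dyads {1..n}" using assms by (simp add: dyads_def)
    have "obsv i j = obsv j i" using 3 by (auto simp: obs_def Let_def min.commute max.commute)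
    then show ?thesis using dyad_in_sources[OF ji] by (simp add: obs_src[OF ji])
  qed
qed

lemma covariate_array_measurable:
  assumes [measurable]: "(\<lambda>(x, x'). ecov x x') \<in> SX \<Otimes>\<^sub>M SX \<rightarrow>\<^sub>M SE"
  shows "covariate_array ecov w r n s \<in> src_alg (sources n) \<rightarrow>\<^sub>M
    PiM ({1..n} \<times> {1..n}) (\<lambda>_. SX \<Otimes>\<^sub>M SX \<Otimes>\<^sub>M SE \<Otimes>\<^sub>M borel)"
proof -
  have "(\<lambda>\<omega>. \<lambda>e\<in>{1..n} \<times> {1..n}. (Xcov s (fst e) \<omega>, Xcov s (snd e) \<omega>,
      ecov (Xcov s (fst e) \<omega>) (Xcov s (snd e) \<omega>), obsv (fst e) (snd e) \<omega>)) \<in> src_alg (sources n) \<rightarrow>\<^sub>M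
    PiM ({1..n} \<times> {1..n}) (\<lambda>_. SX \<Otimes>\<^sub>M SX \<Otimes>\<^sub>M SE \<Otimes>\<^sub>M borel)"
  proof (rule measurable_restrict)
    fix e assume "e \<in> {1..n} \<times> {1..n}"
    then have e: "fst e \<in> {1..n}" "snd e \<in> {1..n}" by auto
    note [measurable] = obs_src_all[OF e] Xcov_src[OF e(1) Node_in_sources[OF e(1)]] Xcov_src[OF e(2) Node_in_sources[OF e(2)]]
    have "(\<lambda>\<omega>. (\<lambda>(x, x'). ecov x x') (Xcov s (fst e) \<omega>, Xcov s (snd e) \<omega>)) \<in> src_alg (sources n) \<rightarrow>\<^sub>M SE"
      by measurable
    then have [measurable]: "(\<lambda>\<omega>. ecov (Xcov s (fst e) \<omega>) (Xcov s (snd e) \<omega>)) \<in> src_alg (sources n) \<rightarrow>\<^sub>M SE"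
      by simp
    show "(\<lambda>\<omega>. (Xcov s (fst e) \<omega>, Xcov s (snd e) \<omega>, ecov (Xcov s (fst e) \<omega>) (Xcov s (snd e) \<omega>), obsv (fst e) (snd e) \<omega>))
        \<in> src_alg (sources n) \<rightarrow>\<^sub>M SX \<Otimes>\<^sub>M SX \<Otimes>\<^sub>M SE \<Otimes>\<^sub>M borel"
      by measurable
  qed
  then show ?thesis by (simp add: covariate_array_def[abs_def] case_prod_unfold)
qed

text \<open>Network statistics may use the observation pattern of the whole graph, including that of
  \<open>D2 n\<close>, so all coins are kept among the sources here.\<close>

lemma network_measurable:
  assumes Z: "\<And>i j. (i, j) \<in> dyads {1..n} \<Longrightarrow> (\<lambda>\<omega>. Z \<omega> (i, j)) \<in> src_alg (sources n) \<rightarrow>\<^sub>M SC"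
  shows "(\<lambda>\<omega>. \<omega>) \<in> src_alg (sources n) \<rightarrow>\<^sub>M training_network SX SC g w r n s Z"
  unfolding training_network_def
proof (rule training_algebra_measurable)
  fix a b assume ab: "(a, b) \<in> dyads (D1 n)"
  have ab': "(a, b) \<in> dyads {1..n}" using ab dyads_mono[OF D1_D2_subset(1)] by blast
  show "obsv a b \<in> borel_measurable (src_alg (sources n))"
    using dyad_in_sources[OF ab'] by (intro obs_src[OF ab']) auto
  have [measurable]: "Xcov s a \<in> src_alg (sources n) \<rightarrow>\<^sub>M SX"
    "Xcov s b \<in> src_alg (sources n) \<rightarrow>\<^sub>M SX"
    "Y a b \<in> borel_measurable (src_alg (sources n))"
    using dyad_in_sources[OF ab'] dyadsD[OF ab'] by (auto intro!: Xcov_src resp_src[OF ab'])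
  note [measurable] = Z[OF ab']
  show "(\<lambda>\<omega>. (Xcov s a \<omega>, Xcov s b \<omega>, Z \<omega> (a, b), Y a b \<omega>)) \<in> src_alg (sources n) \<rightarrow>\<^sub>M SX \<Otimes>\<^sub>M SX \<Otimes>\<^sub>M SC \<Otimes>\<^sub>M borel"
    by measurable
qed

section \<open>The law given that a dyad is missing\<close>

lemma given_missing_prob:
  assumes "(i, j) \<in> dyads {1..n}"
  shows "{\<omega> \<in> space (pspace s). obsv i j \<omega> = 0} \<in> events"
    and "1 - C * r \<le> prob {\<omega> \<in> space (pspace s). obsv i j \<omega> = 0}"
    and "prob_space (given_missing w r s i j)"
    and "B \<in> events \<Longrightarrow> measure (given_missing w r s i j) B =
      prob {\<omega> \<in> B. obsv i j \<omega> = 0} / prob {\<omega> \<in> space (pspace s). obsv i j \<omega> = 0}"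
proof -
  note [measurable] = obs_measurable[OF assms]
  let ?M = "{\<omega> \<in> space (pspace s). obsv i j \<omega> = 0}"
  show M: "?M \<in> events" by measurable
  have "space (pspace s) - ?M = {\<omega> \<in> space (pspace s). obsv i j \<omega> = 1}" using obs_values[of i j] by auto
  then have "1 - prob ?M \<le> C * r" using prob_compl[OF M] prob_observed_le[OF assms] by simp
  then show le: "1 - C * r \<le> prob ?M" by simp
  then have M0: "0 < prob ?M" using sparse by (simp add: mult.commute)
  show "prob_space (given_missing w r s i j)"
    unfolding given_missing_def by (rule conditioned_on_event(1)[OF M M0])
  assume B: "B \<in> events"
  have "?M \<inter> B = {\<omega> \<in> B. obsv i j \<omega> = 0}" using sets.sets_into_space[OF B] by auto
  then show "measure (given_missing w r s i j) B = prob {\<omega> \<in> B. obsv i j \<omega> = 0} / prob ?M"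
    unfolding given_missing_def using conditioned_on_event(2)[OF M M0 B] by simp
qed

lemma given_missing_sets [simp]:
  "sets (given_missing w r s i j) = events" "space (given_missing w r s i j) = space (pspace s)"
  by (simp_all add: given_missing_def)

text \<open>Trades an almost sure identification of f with a conditional probability for an identity
  of integrals over sets of surrogate values, the form in which both response types use it.\<close>

lemma integral_cprob_missing:
  assumes ij: "(i, j) \<in> dyads {1..n}" and T: "T \<in> borel_measurable (pspace s)" and E: "E \<in> events" and B: "B \<in> sets borel"
    and version: "AE \<omega> in given_missing w r s i j. f \<omega> = cprob_missing w r s T i j E \<omega>"
    and f: "f \<in> borel_measurable (pspace s)"
  shows "(\<integral>\<omega>. f \<omega> * indicator B (T \<omega>) \<partial>given_missing w r s i j) =
    measure (given_missing w r s i j) {\<omega> \<in> space (pspace s). \<omega> \<in> E \<and> T \<omega> \<in> B}"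
proof -
  let ?Q = "given_missing w r s i j"
  interpret Q: prob_space ?Q by (rule given_missing_prob(3)[OF ij])
  have cong: "borel_measurable ?Q = (borel_measurable (pspace s) :: ('a \<Rightarrow> real) set)"
    by (rule measurable_cong_sets) simp_all
  have TQ: "T \<in> borel_measurable ?Q" and fQ: "f \<in> borel_measurable ?Q" using T f cong by auto
  have cm: "cprob_missing w r s T i j E \<in> borel_measurable ?Q"
    unfolding cprob_missing_def by (rule borel_measurable_cond_exp2)
  have iE: "integrable ?Q (indicator E :: 'a \<Rightarrow> real)"
    using E by (intro integrable_real_indicator) (auto simp: Q.emeasure_eq_measure)
  have iT: "(\<lambda>\<omega>. indicator B (T \<omega>) :: real) \<in> borel_measurable ?Q" using TQ B by measurable
  have "(\<integral>\<omega>. f \<omega> * indicator B (T \<omega>) \<partial>?Q) = (\<integral>\<omega>. cprob_missing w r s T i j E \<omega> * indicator B (T \<omega>) \<partial>?Q)"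
  proof (rule integral_cong_AE)
    show "AE \<omega> in ?Q. f \<omega> * indicator B (T \<omega>) = cprob_missing w r s T i j E \<omega> * indicator B (T \<omega>)"
      using version by eventually_elim simp
  qed (use fQ cm iT in simp_all)
  also have "\<dots> = (\<integral>\<omega>. indicator E \<omega> * indicator B (T \<omega>) \<partial>?Q)"
    using Q.cond_exp_given_rv(3)[OF TQ iE B] by (simp add: cprob_missing_def)
  also have "\<dots> = (\<integral>\<omega>. indicator {\<omega> \<in> space (pspace s). \<omega> \<in> E \<and> T \<omega> \<in> B} \<omega> \<partial>?Q)"
    by (intro Bochner_Integration.integral_cong refl) (auto split: split_indicator)
  also have "\<dots> = measure ?Q {\<omega> \<in> space (pspace s). \<omega> \<in> E \<and> T \<omega> \<in> B}"
    by (simp add: Int_absorb2)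
  finally show ?thesis .
qed

end

section \<open>Two kinds of prediction and the size of the estimation error\<close>

context model_array
begin

abbreviation "src n \<equiv> sampled.src_alg SX SZ V (smp n)"

text \<open>Common interface of both kinds of prediction: \<open>A n i j\<close> are the sources
  that the fitted quantities for the dyad may use. They include those of the oracle score, so that
  the two can be compared within one sigma-algebra.\<close>

definition adapted :: "(nat \<Rightarrow> nat \<Rightarrow> nat \<Rightarrow> source set) \<Rightarrow> (nat \<Rightarrow> 'a measure) \<Rightarrow> (nat \<Rightarrow> nat \<Rightarrow> nat \<Rightarrow> 'a \<Rightarrow> real) \<Rightarrow> bool" where
  "adapted A G Yhat \<longleftrightarrow> (\<forall>\<^sub>F n in even_top. \<forall>(i, j)\<in>dyads (D2 n).
     A n i j \<subseteq> sources n \<and> dyad_sources i j \<subseteq> A n i j \<and>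
     (\<lambda>\<omega>. \<omega>) \<in> src n (A n i j) \<rightarrow>\<^sub>M G n \<and> Yhat n i j \<in> borel_measurable (src n (A n i j)))"

lemma adapted_plain:
  assumes "predicts_without_network SX g w \<rho> smp Yhat"
  shows "adapted (\<lambda>n i j. sources n - {Eta i j}) (\<lambda>n. training_plain SX g w (\<rho> n) n (smp n)) Yhat"
  unfolding adapted_def using eventually_model
proof eventually_elim
  case (elim n)
  interpret model SX SZ D V n "smp n" g w "\<rho> n" c C by (rule elim)
  obtain hhat where hh [measurable]: "(\<lambda>(\<omega>, x, x'). hhat n \<omega> x x')
          \<in> borel_measurable (training_plain SX g w (\<rho> n) n (smp n) \<Otimes>\<^sub>M SX \<Otimes>\<^sub>M SX)"
    and Yhat: "\<And>i j \<omega>. (i, j) \<in> dyads {1..n} \<Longrightarrow> \<omega> \<in> space (pspace (smp n)) \<Longrightarrow>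
           Yhat n i j \<omega> = hhat n \<omega> (Xcov (smp n) i \<omega>) (Xcov (smp n) j \<omega>)"
    using assms unfolding predicts_without_network_def by fast
  show ?case
  proof (intro ballI, unfold split_paired_all prod.case, intro conjI)
    fix i j assume ij: "(i, j) \<in> dyads (D2 n)"
    then have ij': "(i, j) \<in> dyads {1..n}" using dyads_D2_subset by blast
    let ?A = "sources n - {Eta i j}"
    show "?A \<subseteq> sources n" by blast
    show "dyad_sources i j \<subseteq> ?A" using dyad_in_sources[OF ij'] by (auto simp: dyad_sources_def)
    show [measurable]: "(\<lambda>\<omega>. \<omega>) \<in> src_alg ?A \<rightarrow>\<^sub>M training_plain SX g w (\<rho> n) n (smp n)"
      by (rule plain_measurable[OF ij])
    have [measurable]: "Xcov (smp n) i \<in> src_alg ?A \<rightarrow>\<^sub>M SX" "Xcov (smp n) j \<in> src_alg ?A \<rightarrow>\<^sub>M SX"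
      using dyad_in_sources[OF ij'] dyadsD[OF ij'] by (auto intro!: Xcov_src)
    have "(\<lambda>\<omega>. (\<lambda>(\<omega>, x, x'). hhat n \<omega> x x') (\<omega>, Xcov (smp n) i \<omega>, Xcov (smp n) j \<omega>)) \<in> borel_measurable (src_alg ?A)"
      by measurable
    then show "Yhat n i j \<in> borel_measurable (src_alg ?A)"
      using Yhat[OF ij'] by (subst measurable_cong) auto
  qed
qed

lemma adapted_network:
  fixes zst :: "nat \<Rightarrow> (nat \<times> nat \<Rightarrow> 'x \<times> 'x \<times> 'e \<times> real) \<Rightarrow> nat \<times> nat \<Rightarrow> 'c"
  assumes stat: "network_statistic SX SE SC ecov w \<rho> smp zst"
    and "predicts_with_network SX SC g w \<rho> smp (network_covariates ecov w \<rho> smp zst) Yhat"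
  shows "adapted (\<lambda>n i j. sources n)
    (\<lambda>n. training_network SX SC g w (\<rho> n) n (smp n) (network_covariates ecov w \<rho> smp zst n)) Yhat"
  unfolding adapted_def using eventually_model
proof eventually_elim
  case (elim n)
  interpret model SX SZ D V n "smp n" g w "\<rho> n" c C by (rule elim)
  let ?Z = "network_covariates ecov w \<rho> smp zst n"
  let ?G = "training_network SX SC g w (\<rho> n) n (smp n) ?Z"
  obtain hhat where hh [measurable]: "(\<lambda>(\<omega>, x, x', z). hhat n \<omega> x x' z) \<in> borel_measurable (?G \<Otimes>\<^sub>M SX \<Otimes>\<^sub>M SX \<Otimes>\<^sub>M SC)"
    and Yhat: "\<And>i j \<omega>. (i, j) \<in> dyads {1..n} \<Longrightarrow> \<omega> \<in> space (pspace (smp n)) \<Longrightarrow>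
           Yhat n i j \<omega> = hhat n \<omega> (Xcov (smp n) i \<omega>) (Xcov (smp n) j \<omega>) (?Z \<omega> (i, j))"
    using assms(2) unfolding predicts_with_network_def by fast
  have Z: "(\<lambda>\<omega>. ?Z \<omega> (i, j)) \<in> src_alg (sources n) \<rightarrow>\<^sub>M SC" if "(i, j) \<in> dyads {1..n}" for i j
  proof -
    have cov: "covariate_array ecov w (\<rho> n) n (smp n) \<in> src_alg (sources n) \<rightarrow>\<^sub>M
        PiM ({1..n} \<times> {1..n}) (\<lambda>_. SX \<Otimes>\<^sub>M SX \<Otimes>\<^sub>M SE \<Otimes>\<^sub>M borel)"
      using stat by (intro covariate_array_measurable) (simp add: network_statistic_def)
    have zst: "zst n \<in> PiM ({1..n} \<times> {1..n}) (\<lambda>_. SX \<Otimes>\<^sub>M SX \<Otimes>\<^sub>M SE \<Otimes>\<^sub>M borel) \<rightarrow>\<^sub>M PiM ({1..n} \<times> {1..n}) (\<lambda>_. SC)"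
      using stat by (simp add: network_statistic_def)
    have "(\<lambda>z. z (i, j)) \<in> PiM ({1..n} \<times> {1..n}) (\<lambda>_. SC) \<rightarrow>\<^sub>M SC"
      using dyadsD[OF that] by (intro measurable_component_singleton) auto
    from measurable_compose[OF measurable_compose[OF cov zst] this]
    show ?thesis by (simp add: network_covariates_def)
  qed
  show ?case
  proof (intro ballI, unfold split_paired_all prod.case, intro conjI)
    fix i j assume ij: "(i, j) \<in> dyads (D2 n)"
    then have ij': "(i, j) \<in> dyads {1..n}" using dyads_D2_subset by blast
    show "sources n \<subseteq> sources n" by blast
    show "dyad_sources i j \<subseteq> sources n" using dyad_in_sources[OF ij'] by (auto simp: dyad_sources_def)
    show [measurable]: "(\<lambda>\<omega>. \<omega>) \<in> src_alg (sources n) \<rightarrow>\<^sub>M ?G" by (rule network_measurable[where Z="?Z", OF Z])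
    have [measurable]: "Xcov (smp n) i \<in> src_alg (sources n) \<rightarrow>\<^sub>M SX" "Xcov (smp n) j \<in> src_alg (sources n) \<rightarrow>\<^sub>M SX"
      using dyad_in_sources[OF ij'] dyadsD[OF ij'] by (auto intro!: Xcov_src)
    note [measurable] = Z[OF ij']
    have "(\<lambda>\<omega>. (\<lambda>(\<omega>, x, x', z). hhat n \<omega> x x' z) (\<omega>, Xcov (smp n) i \<omega>, Xcov (smp n) j \<omega>, ?Z \<omega> (i, j)))
        \<in> borel_measurable (src_alg (sources n))"
      by measurable
    then show "Yhat n i j \<in> borel_measurable (src_alg (sources n))"
      using Yhat[OF ij'] by (subst measurable_cong) auto
  qed
qed

text \<open>
  Observed dyads are a fraction of order \<open>\<rho>\<close>.  An estimation error that ignores \<open>eta i j\<close> is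
  independent of whether \<open>(i, j)\<close> is observed; otherwise its probability itself has to be \<open>o(\<rho>)\<close>.
\<close>

definition rate_ok where
  "rate_ok A X1 X2 \<longleftrightarrow> (\<forall>n i j. Eta i j \<notin> A n i j) \<and> mean_dist_smallo smp X1 X2 (\<lambda>_. 1) \<or> mean_dist_smallo smp X1 X2 \<rho>"

text \<open>An observed calibration dyad has weight of order 1/\<rho>, so errors must be o(\<rho>)
  jointly with observation; for the single test pair it suffices that they vanish. Both follow from
  Markov's inequality, uniformly over the dyads.\<close>

lemma estimation_error_small:
  fixes A :: "nat \<Rightarrow> nat \<Rightarrow> nat \<Rightarrow> source set" and X1 X2 :: "nat \<Rightarrow> nat \<Rightarrow> nat \<Rightarrow> 'a \<Rightarrow> real"
  assumes rate: "rate_ok A X1 X2"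
    and meas: "\<forall>\<^sub>F n in even_top. \<forall>(i, j)\<in>dyads (D2 n). A n i j \<subseteq> sources n \<and>
      X1 n i j \<in> borel_measurable (src n (A n i j)) \<and> X2 n i j \<in> borel_measurable (src n (A n i j))"
    and \<delta>: "0 < \<delta>"
  defines "Bad \<equiv> \<lambda>n (i, j). {\<omega> \<in> space (pspace (smp n)). \<bar>X1 n i j \<omega> - X2 n i j \<omega>\<bar> > \<delta>}"
  shows "0 < b \<Longrightarrow> \<forall>\<^sub>F n in even_top. \<forall>(i, j)\<in>dyads (D2 n).
        Bad n (i, j) \<in> sets (pspace (smp n)) \<and>
        measure (pspace (smp n)) {\<omega> \<in> Bad n (i, j). obs w (\<rho> n) (smp n) i j \<omega> = 1} \<le> \<rho> n * b"
    and "pair_seq k l \<Longrightarrow> vanishing smp (\<lambda>n. Bad n (k n, l n))"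
proof -
  have BadS: "\<forall>\<^sub>F n in even_top. \<forall>(i, j)\<in>dyads (D2 n). A n i j \<subseteq> sources n \<and> Bad n (i, j) \<in> sets (src n (A n i j))"
    using meas eventually_model
  proof eventually_elim
    case (elim n)
    interpret model SX SZ D V n "smp n" g w "\<rho> n" c C by (rule elim)
    show ?case
    proof (intro ballI, unfold split_paired_all prod.case, intro conjI)
      fix i j assume ij: "(i, j) \<in> dyads (D2 n)"
      show "A n i j \<subseteq> sources n" using elim ij by blast
      have [measurable]: "X1 n i j \<in> borel_measurable (src_alg (A n i j))" "X2 n i j \<in> borel_measurable (src_alg (A n i j))"
        using elim ij by blast+
      have "{\<omega> \<in> space (src_alg (A n i j)). \<bar>X1 n i j \<omega> - X2 n i j \<omega>\<bar> > \<delta>} \<in> sets (src_alg (A n i j))" by measurable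
      then show "Bad n (i, j) \<in> sets (src_alg (A n i j))" by (simp add: Bad_def)
    qed
  qed
  have prob: "\<forall>\<^sub>F n in even_top. \<forall>(i, j)\<in>dyads (D2 n). Bad n (i, j) \<in> sets (pspace (smp n)) \<and>
      measure (pspace (smp n)) (Bad n (i, j)) \<le> e * R n"
    if R: "mean_dist_smallo smp X1 X2 R" "\<And>n. 0 < R n" and e: "0 < e" for R e
  proof -
    \<comment> \<open>Markov's inequality divides by \<delta>, so the mean is asked to be at most e
      * \<delta> times the rate.\<close>
    have "0 < e * \<delta>" using e \<delta> by simp
    from mean_dist_smallo_uniform[OF R this] meas eventually_model BadS show ?thesis
    proof eventually_elim
      case (elim n)
      interpret model SX SZ D V n "smp n" g w "\<rho> n" c C by (rule elim)
      show ?case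
      proof (intro ballI, unfold split_paired_all prod.case, intro conjI)
        fix i j assume ij: "(i, j) \<in> dyads (D2 n)"
        have A: "A n i j \<subseteq> sources n" using elim ij by blast
        have "Bad n (i, j) \<in> sets (src_alg (A n i j))" using elim ij by blast
        then show "Bad n (i, j) \<in> events" using src_alg_subalgebra[OF A] by (auto simp: subalgebra_def)
        have [measurable]: "X1 n i j \<in> borel_measurable (pspace (smp n))" "X2 n i j \<in> borel_measurable (pspace (smp n))"
          using elim ij src_alg_measurable[OF _ A] by blast+
        have "prob {\<omega> \<in> space (pspace (smp n)). \<bar>X1 n i j \<omega> - X2 n i j \<omega>\<bar> > \<delta>} \<le> (e * \<delta> * R n) / \<delta>"
          using elim(1) ij \<delta> e R(2)[of n] by (intro prob_gt_le_nn_integral) auto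
        then show "prob (Bad n (i, j)) \<le> e * R n" using \<delta> by (simp add: Bad_def)
      qed
    qed
  qed
  show "\<forall>\<^sub>F n in even_top. \<forall>(i, j)\<in>dyads (D2 n).
        Bad n (i, j) \<in> sets (pspace (smp n)) \<and>
        measure (pspace (smp n)) {\<omega> \<in> Bad n (i, j). obs w (\<rho> n) (smp n) i j \<omega> = 1} \<le> \<rho> n * b" if b: "0 < b"
    using rate unfolding rate_ok_def
  proof (elim disjE conjE)
    assume Eta: "\<forall>n i j. Eta i j \<notin> A n i j" and R: "mean_dist_smallo smp X1 X2 (\<lambda>_. 1)"
    have "0 < b / C" using b C_pos by simp
    from prob[OF R zero_less_one this] BadS eventually_model show ?thesis
    proof eventually_elim
      case (elim n)
      interpret model SX SZ D V n "smp n" g w "\<rho> n" c C by (rule elim)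
      show ?case
      proof (intro ballI, unfold split_paired_all prod.case, intro conjI)
        fix i j assume ij: "(i, j) \<in> dyads (D2 n)"
        show "Bad n (i, j) \<in> events" using elim ij by blast
        have le: "prob (Bad n (i, j)) \<le> b / C" using elim(1) ij by auto
        have "prob {\<omega> \<in> Bad n (i, j). obsv i j \<omega> = 1} \<le> C * \<rho> n * prob (Bad n (i, j))"
          using elim(2) ij Eta dyads_D2_subset by (intro prob_observed_and_le[where A="A n i j"]) blast+
        also have "\<dots> \<le> C * \<rho> n * (b / C)" using le C_pos rho_pos[of n] by (intro mult_left_mono) auto
        finally show "prob {\<omega> \<in> Bad n (i, j). obsv i j \<omega> = 1} \<le> \<rho> n * b" using C_pos by simp
      qed
    qed
  next
    assume R: "mean_dist_smallo smp X1 X2 \<rho>"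
    from prob[OF R rho_pos b] eventually_model show ?thesis
    proof eventually_elim
      case (elim n)
      interpret model SX SZ D V n "smp n" g w "\<rho> n" c C by (rule elim)
      show ?case
      proof (intro ballI, unfold split_paired_all prod.case, intro conjI)
        fix i j assume ij: "(i, j) \<in> dyads (D2 n)"
        show B: "Bad n (i, j) \<in> events" using elim ij by blast
        have "prob {\<omega> \<in> Bad n (i, j). obsv i j \<omega> = 1} \<le> prob (Bad n (i, j))"
          using B by (intro finite_measure_mono) auto
        also have "\<dots> \<le> b * \<rho> n" using elim(1) ij by auto
        finally show "prob {\<omega> \<in> Bad n (i, j). obsv i j \<omega> = 1} \<le> \<rho> n * b" by (simp add: mult.commute)
      qed
    qed
  qed
  show "vanishing smp (\<lambda>n. Bad n (k n, l n))" if kl: "pair_seq k l"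
  proof (rule vanishingI)
    fix e :: real assume e: "0 < e"
    have small: "\<forall>\<^sub>F n in even_top. \<forall>(i, j)\<in>dyads (D2 n). Bad n (i, j) \<in> sets (pspace (smp n)) \<and>
      measure (pspace (smp n)) (Bad n (i, j)) < e"
      using rate unfolding rate_ok_def
    proof (elim disjE conjE)
      assume R: "mean_dist_smallo smp X1 X2 (\<lambda>_. 1)"
      have "0 < e / 2" using e by simp
      from prob[OF R zero_less_one this] show ?thesis
        by (rule eventually_mono) (use e in fastforce)
    next
      assume R: "mean_dist_smallo smp X1 X2 \<rho>"
      have "0 < C * e" using C_pos e by simp
      from prob[OF R rho_pos C_pos] rho_small[OF e] show ?thesis
        by eventually_elim fastforce
    qed
    with eventually_even_top[of 4]
    show "\<forall>\<^sub>F n in even_top. \<exists>A\<in>sets (pspace (smp n)). Bad n (k n, l n) \<subseteq> A \<and> measure (pspace (smp n)) A < e"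
    proof eventually_elim
      case (elim n)
      then have "(k n, l n) \<in> dyads (D2 n)" using kl by (simp add: pair_seq_def)
      then show ?case using elim(2) by (intro bexI[of _ "Bad n (k n, l n)"]) auto
    qed
  qed
qed

end

section \<open>Continuous response\<close>

context model_array
begin

definition "coverage_event ys \<alpha> score Yhat k l n = {\<omega> \<in> space (pspace (smp n)).
  resp g (smp n) (k n) (l n) \<omega> \<in> C_weighted ys \<alpha> n (\<lambda>i j. obs w (\<rho> n) (smp n) i j \<omega>) (\<lambda>i j. phat n i j \<omega>)
    (score n \<omega>) (\<lambda>i j. resp g (smp n) i j \<omega>) (\<lambda>i j. Yhat n i j \<omega>) (k n) (l n)}"

definition "asymptotic_coverage \<alpha> T k l E \<longleftrightarrow> (\<exists>R :: nat \<Rightarrow> 'a \<Rightarrow> real.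
      (\<forall>n. R n \<in> borel_measurable (pspace (smp n))) \<and>
      (\<forall>n \<omega>. 0 \<le> R n \<omega>) \<and>
      (\<forall>\<epsilon>>0. ((\<lambda>n. measure (pspace (smp n)) {\<omega> \<in> space (pspace (smp n)). R n \<omega> > \<epsilon>}) \<longlongrightarrow> 0) even_top) \<and>
      (\<forall>n. even n \<and> 4 \<le> n \<longrightarrow>
        (AE \<omega> in given_missing w (\<rho> n) (smp n) (k n) (l n).
          cprob_missing w (\<rho> n) (smp n) (T n) (k n) (l n) (E n) \<omega> \<ge> 1 - \<alpha> - R n \<omega>)))"

lemma coverage_event_eq:
  assumes "\<And>\<omega>. \<omega> \<in> space (pspace (smp n)) \<Longrightarrow> resp g (smp n) (k n) (l n) \<omega> \<in> ys"
  shows "coverage_event ys \<alpha> score Yhat k l n = {\<omega> \<in> space (pspace (smp n)).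
    \<alpha> < Pi_weighted n (\<lambda>i j. obs w (\<rho> n) (smp n) i j \<omega>) (\<lambda>i j. phat n i j \<omega>)
      (\<lambda>i j. score n \<omega> (resp g (smp n) i j \<omega>) (Yhat n i j \<omega>)) (k n) (l n)}"
  using assms unfolding coverage_event_def
    resp_in_C_weighted_iff[where Y="\<lambda>i j. resp g (smp n) i j \<omega>" for \<omega>, simplified]
  by blast

lemma coverage_event_measurable:
  assumes kl: "pair_seq k l"
    and ys: "\<forall>\<^sub>F n in even_top. \<forall>\<omega>\<in>space (pspace (smp n)). resp g (smp n) (k n) (l n) \<omega> \<in> ys"
    and S: "\<forall>\<^sub>F n in even_top. \<forall>(i, j)\<in>dyads (D2 n).
      (\<lambda>\<omega>. score n \<omega> (resp g (smp n) i j \<omega>) (Yhat n i j \<omega>)) \<in> borel_measurable (pspace (smp n))"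
  shows "\<forall>\<^sub>F n in even_top. coverage_event ys \<alpha> score Yhat k l n \<in> sets (pspace (smp n))"
  using ys S eventually_model eventually_even_top[of 4]
proof eventually_elim
  case (elim n)
  interpret model SX SZ D V n "smp n" g w "\<rho> n" c C by (rule elim)
  have kln: "(k n, l n) \<in> dyads (D2 n)" using kl elim by (simp add: pair_seq_def)
  have q: "phat n i j \<in> borel_measurable (pspace (smp n))" if "(i, j) \<in> dyads (D2 n)" for i j
    using that by (intro phat_measurable) (auto simp: dyads_def D2_def)
  have [measurable]: "(\<lambda>\<omega>. Pi_weighted n (\<lambda>i j. obsv i j \<omega>) (\<lambda>i j. phat n i j \<omega>)
      (\<lambda>i j. score n \<omega> (Y i j \<omega>) (Yhat n i j \<omega>)) (k n) (l n)) \<in> borel_measurable (pspace (smp n))"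
    using elim(2) by (intro Pi_weighted_measurable[OF kln q]) auto
  show ?case using elim(1) by (subst coverage_event_eq) simp_all
qed

text \<open>Under the law given M = 0, the integral identity of the locale is the defining property
  of the conditional CDF, tested on preimages of Borel sets. Hence F at the response and the
  surrogate is uniform given the surrogate.\<close>

lemma continuous_cond_cdf_given_missing:
  assumes m: "model SX SZ D V n (smp n) g w (\<rho> n) c C" and n: "even n" and ij: "(i, j) \<in> dyads (D2 n)"
    and T: "Ytil n i j \<in> borel_measurable (pspace (smp n))"
    and cdf: "is_continuous_cond_cdf g w \<rho> smp Ytil F"
  shows "continuous_cond_cdf (given_missing w (\<rho> n) (smp n) i j) (resp g (smp n) i j) (Ytil n i j) (F n)"
proof -
  interpret model SX SZ D V n "smp n" g w "\<rho> n" c C by (rule m)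
  have ij': "(i, j) \<in> dyads {1..n}" using ij dyads_D2_subset by blast
  let ?Q = "given_missing w (\<rho> n) (smp n) i j"
  have cong: "borel_measurable ?Q = (borel_measurable (pspace (smp n)) :: ('a \<Rightarrow> real) set)"
    by (rule measurable_cong_sets) simp_all
  have F: "mono (\<lambda>y. F n y t)" "continuous_on UNIV (\<lambda>y. F n y t)"
    "((\<lambda>y. F n y t) \<longlongrightarrow> 0) at_bot" "((\<lambda>y. F n y t) \<longlongrightarrow> 1) at_top" "F n y \<in> borel_measurable borel" for t y
    using cdf n by (simp_all add: is_continuous_cond_cdf_def)
  have version: "AE \<omega> in ?Q. F n y (Ytil n i j \<omega>) =
      cprob_missing w (\<rho> n) (smp n) (Ytil n i j) i j {\<omega> \<in> space (pspace (smp n)). Y i j \<omega> \<le> y} \<omega>" for y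
  proof -
    have "\<forall>(i, j)\<in>dyads (D2 n). AE \<omega> in given_missing w (\<rho> n) (smp n) i j. F n y (Ytil n i j \<omega>) =
        cprob_missing w (\<rho> n) (smp n) (Ytil n i j) i j {\<omega> \<in> space (pspace (smp n)). resp g (smp n) i j \<omega> \<le> y} \<omega>"
      using cdf n by (simp add: is_continuous_cond_cdf_def)
    then show ?thesis using ij by auto
  qed
  note [measurable] = resp_measurable[OF ij'] T F(5)
  interpret Q: prob_space ?Q by (rule given_missing_prob(3)[OF ij'])
  show ?thesis
  proof unfold_locales
    show "Y i j \<in> borel_measurable ?Q" "Ytil n i j \<in> borel_measurable ?Q" unfolding cong by measurable
    fix y and B :: "real set" assume B: "B \<in> sets borel"
    have E: "{\<omega> \<in> space (pspace (smp n)). Y i j \<omega> \<le> y} \<in> events" by measurable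
    have f: "(\<lambda>\<omega>. F n y (Ytil n i j \<omega>)) \<in> borel_measurable (pspace (smp n))" by measurable
    have "(\<integral>\<omega>. F n y (Ytil n i j \<omega>) * indicator B (Ytil n i j \<omega>) \<partial>?Q) =
        measure ?Q {\<omega> \<in> space (pspace (smp n)). \<omega> \<in> {\<omega> \<in> space (pspace (smp n)). Y i j \<omega> \<le> y} \<and> Ytil n i j \<omega> \<in> B}"
      by (rule integral_cprob_missing[OF ij' T E B version f])
    also have "{\<omega> \<in> space (pspace (smp n)). \<omega> \<in> {\<omega> \<in> space (pspace (smp n)). Y i j \<omega> \<le> y} \<and> Ytil n i j \<omega> \<in> B} =
        {\<omega> \<in> space ?Q. Y i j \<omega> \<le> y \<and> Ytil n i j \<omega> \<in> B}" by auto
    finally show "(\<integral>\<omega>. F n y (Ytil n i j \<omega>) * indicator B (Ytil n i j \<omega>) \<partial>?Q) =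
        measure ?Q {\<omega> \<in> space ?Q. Y i j \<omega> \<le> y \<and> Ytil n i j \<omega> \<in> B}" .
  qed (rule F)+
qed

text \<open>For uniform U the score |1/2 - U| exceeds (1 - \<alpha>) / 2 with probability \<alpha>.
  A threshold slightly below this quantile gives the calibration scores a tail above \<alpha>, while
  the test score exceeds it with conditional probability only slightly larger than \<alpha>.\<close>

theorem continuous_coverage:
  assumes kl: "pair_seq k l" and \<alpha>: "0 < \<alpha>" "\<alpha> < 1"
    and T: "\<And>n i j. i \<in> {1..n} \<Longrightarrow> j \<in> {1..n} \<Longrightarrow> Ytil n i j \<in> borel_measurable (pspace (smp n))"
    and T_src: "\<And>n i j A. even n \<Longrightarrow> (i, j) \<in> dyads (D2 n) \<Longrightarrow> dyad_sources i j \<subseteq> A \<Longrightarrow> Ytil n i j \<in> borel_measurable (src n A)"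
    and cdf: "is_continuous_cond_cdf g w \<rho> smp Ytil F"
    and ad: "adapted A G Yhat" and fit: "fitted_cdf G Fhat"
    and rate: "rate_ok A (\<lambda>n k l \<omega>. Fhat n \<omega> (resp g (smp n) k l \<omega>) (Yhat n k l \<omega>))
       (\<lambda>n k l \<omega>. F n (resp g (smp n) k l \<omega>) (Ytil n k l \<omega>))"
  shows "asymptotic_coverage \<alpha> (\<lambda>n. Ytil n (k n) (l n)) k l
    (coverage_event UNIV \<alpha> (\<lambda>n \<omega>. continuous_score (Fhat n \<omega>)) Yhat k l)"
proof -
  let ?X1 = "\<lambda>n k l \<omega>. Fhat n \<omega> (resp g (smp n) k l \<omega>) (Yhat n k l \<omega>)"
  let ?X2 = "\<lambda>n k l \<omega>. F n (resp g (smp n) k l \<omega>) (Ytil n k l \<omega>)"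
  let ?S = "\<lambda>n i j \<omega>. continuous_score (Fhat n \<omega>) (resp g (smp n) i j \<omega>) (Yhat n i j \<omega>)"
  have F: "mono (\<lambda>y. F n y t)" "continuous_on UNIV (\<lambda>y. F n y t)" "F n y \<in> borel_measurable borel"
    if "even n" for n t y
    using cdf that by (simp_all add: is_continuous_cond_cdf_def)
  have X2: "?X2 n i j \<in> borel_measurable (src n A')"
    if "model SX SZ D V n (smp n) g w (\<rho> n) c C" "even n" "(i, j) \<in> dyads (D2 n)" "dyad_sources i j \<subseteq> A'" for n i j A'
  proof -
    interpret model SX SZ D V n "smp n" g w "\<rho> n" c C by (rule that)
    have "(i, j) \<in> dyads {1..n}" using that dyads_D2_subset by blast
    then have "Y i j \<in> borel_measurable (src_alg A')"
      using that(4) by (intro resp_src) (auto simp: dyad_sources_def)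
    then show ?thesis
      by (rule measurable_mono_continuous[OF _ T_src[OF that(2,3,4)] F(3)[OF that(2)] F(1,2)[OF that(2)]])
  qed
  have meas: "\<forall>\<^sub>F n in even_top. \<forall>(i, j)\<in>dyads (D2 n). A n i j \<subseteq> sources n \<and>
      ?X1 n i j \<in> borel_measurable (src n (A n i j)) \<and> ?X2 n i j \<in> borel_measurable (src n (A n i j))"
    using ad[unfolded adapted_def] eventually_model eventually_even_top[of 4]
  proof eventually_elim
    case (elim n)
    interpret model SX SZ D V n "smp n" g w "\<rho> n" c C by (rule elim)
    show ?case
    proof (intro ballI, unfold split_paired_all prod.case, intro conjI)
      fix i j assume ij: "(i, j) \<in> dyads (D2 n)"
      have ij': "(i, j) \<in> dyads {1..n}" using ij dyads_D2_subset by blast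
      show "A n i j \<subseteq> sources n" using elim(1) ij by blast
      have sub: "dyad_sources i j \<subseteq> A n i j" using elim(1) ij by blast
      have [measurable]: "(\<lambda>\<omega>. \<omega>) \<in> src_alg (A n i j) \<rightarrow>\<^sub>M G n" "Yhat n i j \<in> borel_measurable (src_alg (A n i j))"
        using elim(1) ij by blast+
      have [measurable]: "Y i j \<in> borel_measurable (src_alg (A n i j))"
        using sub by (intro resp_src[OF ij']) (auto simp: dyad_sources_def)
      have [measurable]: "(\<lambda>(\<omega>, y, u). Fhat n \<omega> y u) \<in> borel_measurable (G n \<Otimes>\<^sub>M borel \<Otimes>\<^sub>M borel)"
        using fit by (simp add: fitted_cdf_def)
      have "(\<lambda>\<omega>. (\<lambda>(\<omega>, y, u). Fhat n \<omega> y u) (\<omega>, Y i j \<omega>, Yhat n i j \<omega>)) \<in> borel_measurable (src_alg (A n i j))"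
        by measurable
      then show "?X1 n i j \<in> borel_measurable (src_alg (A n i j))" by simp
      show "?X2 n i j \<in> borel_measurable (src_alg (A n i j))"
        using X2[OF elim(2) _ ij sub] elim(3) by blast
    qed
  qed
  have Sm: "\<forall>\<^sub>F n in even_top. \<forall>(i, j)\<in>dyads (D2 n). ?S n i j \<in> borel_measurable (pspace (smp n))"
    using meas eventually_model
  proof eventually_elim
    case (elim n)
    interpret model SX SZ D V n "smp n" g w "\<rho> n" c C by (rule elim)
    show ?case
    proof (intro ballI, unfold split_paired_all prod.case)
      fix i j assume ij: "(i, j) \<in> dyads (D2 n)"
      have [measurable]: "?X1 n i j \<in> borel_measurable (pspace (smp n))"
        using elim(1) ij src_alg_measurable by blast
      show "?S n i j \<in> borel_measurable (pspace (smp n))" unfolding continuous_score_def by measurable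
    qed
  qed
  show ?thesis
    unfolding asymptotic_coverage_def
  proof (rule coverage[OF kl \<alpha>(2)])
    show "Ytil n (k n) (l n) \<in> borel_measurable (pspace (smp n))" if "even n" "4 \<le> n" for n
      using kl that by (intro T) (auto simp: pair_seq_def dyads_def D2_def)
    show "\<forall>\<^sub>F n in even_top. coverage_event UNIV \<alpha> (\<lambda>n \<omega>. continuous_score (Fhat n \<omega>)) Yhat k l n \<in> sets (pspace (smp n))"
      using Sm by (intro coverage_event_measurable[OF kl]) auto
    fix \<epsilon> :: real assume \<epsilon>: "0 < \<epsilon>" "\<epsilon> < 1 - \<alpha>"
    \<comment> \<open>Lowering the quantile by \<epsilon> / 4 adds \<epsilon> / 2 to the tail, and
      \<delta> shifts it by \<epsilon> / 8: the tail is \<alpha> + 5 \<epsilon> / 8 at t - \<delta>,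
      for the test pair, and \<alpha> + 3 \<epsilon> / 8 at t + \<delta>, for the calibration
      dyads.\<close>
    define t where "t = (1 - \<alpha>) / 2 - \<epsilon> / 4"
    define \<delta> where "\<delta> = \<epsilon> / 16"
    have \<delta>: "0 < \<delta>" using \<epsilon> by (simp add: \<delta>_def)
    have t: "0 < t - \<delta>" "t - \<delta> < 1 / 2" "0 < t + \<delta>" "t + \<delta> < 1 / 2"
      "1 - 2 * (t - \<delta>) \<le> \<alpha> + \<epsilon>" "1 - 2 * (t + \<delta>) = \<alpha> + 3 * \<epsilon> / 8"
      using \<epsilon> \<alpha> by (auto simp: t_def \<delta>_def field_simps)
    let ?dev = "\<lambda>n i j \<omega>. \<bar>1 / 2 - ?X2 n i j \<omega>\<bar>"
    define B where "B n = (\<lambda>(i, j). {\<omega> \<in> space (pspace (smp n)). ?dev n i j \<omega> \<ge> t + \<delta>})" for n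
    define Bad where "Bad n = (\<lambda>(i, j). {\<omega> \<in> space (pspace (smp n)). \<bar>?X1 n i j \<omega> - ?X2 n i j \<omega>\<bar> > \<delta>})" for n
    define Gb where "Gb n = {\<omega> \<in> space (pspace (smp n)). ?dev n (k n) (l n) \<omega> > t - \<delta>}" for n
    define miss where "miss n = {\<omega> \<in> space (pspace (smp n)). ?S n (k n) (l n) \<omega> \<le> t \<and>
      Pi_weighted n (\<lambda>i j. obs w (\<rho> n) (smp n) i j \<omega>) (\<lambda>i j. phat n i j \<omega>) (\<lambda>i j. ?S n i j \<omega>) (k n) (l n) \<le> \<alpha>}" for n
    note Bad_small = estimation_error_small[OF rate meas \<delta>, folded Bad_def]
    have "vanishing smp miss"
      unfolding miss_def
    proof (rule vanishing_miss[OF kl, where \<beta>="\<alpha> + \<epsilon> / 4" and B=B and Bad=Bad])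
      show "0 \<le> \<alpha>" "\<alpha> < \<alpha> + \<epsilon> / 4" using \<alpha> \<epsilon> by auto
      have "0 < \<epsilon> / 8" using \<epsilon> by simp
      from eventually_model eventually_even_top[of 4] rho_small[OF this]
      show "\<forall>\<^sub>F n in even_top. \<forall>(i, j)\<in>dyads (D2 n).
        B n (i, j) \<in> sets (src n (dyad_sources i j)) \<and>
        \<alpha> + \<epsilon> / 4 \<le> measure (pspace (smp n)) {\<omega> \<in> B n (i, j). obs w (\<rho> n) (smp n) i j \<omega> = 0}"
      proof eventually_elim
        case (elim n)
        interpret model SX SZ D V n "smp n" g w "\<rho> n" c C by (rule elim)
        have n: "even n" using elim by simp
        show ?case
        proof (intro ballI, unfold split_paired_all prod.case, intro conjI)
          fix i j assume ij: "(i, j) \<in> dyads (D2 n)"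
          then have ij': "(i, j) \<in> dyads {1..n}" using dyads_D2_subset by blast
          have [measurable]: "?X2 n i j \<in> borel_measurable (src_alg (dyad_sources i j))" by (rule X2[OF elim(1) n ij order.refl])
          have "{\<omega> \<in> space (src_alg (dyad_sources i j)). ?dev n i j \<omega> \<ge> t + \<delta>} \<in> sets (src_alg (dyad_sources i j))"
            by measurable
          then show Bs: "B n (i, j) \<in> sets (src_alg (dyad_sources i j))" by (simp add: B_def)
          then have Bm: "B n (i, j) \<in> events"
            using src_alg_subalgebra[of "dyad_sources i j"] dyad_sources_subset[OF ij'] by (auto simp: subalgebra_def)
          interpret U: continuous_cond_cdf "given_missing w (\<rho> n) (smp n) i j" "Y i j" "Ytil n i j" "F n"
            using T dyadsD[OF ij'] by (intro continuous_cond_cdf_given_missing[OF elim(1) n ij _ cdf]) auto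
          let ?M = "prob {\<omega> \<in> space (pspace (smp n)). obsv i j \<omega> = 0}"
          have M: "1 - \<epsilon> / 8 < ?M" using given_missing_prob(2)[OF ij'] elim(3) by simp
          then have M0: "0 < ?M" using \<epsilon> \<alpha> by linarith
          have "\<alpha> + 3 * \<epsilon> / 8 \<le> measure (given_missing w (\<rho> n) (smp n) i j) (B n (i, j))"
            using U.prob_F_deviation(2)[OF t(3,4), of UNIV] t(6) by (simp add: B_def)
          also have "\<dots> = prob {\<omega> \<in> B n (i, j). obsv i j \<omega> = 0} / ?M" by (rule given_missing_prob(4)[OF ij' Bm])
          finally have "(\<alpha> + 3 * \<epsilon> / 8) * ?M \<le> prob {\<omega> \<in> B n (i, j). obsv i j \<omega> = 0}"
            using M0 by (simp add: pos_le_divide_eq)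
          moreover have "(\<alpha> + 3 * \<epsilon> / 8) * (1 - \<epsilon> / 8) \<le> (\<alpha> + 3 * \<epsilon> / 8) * ?M"
            using M \<alpha> \<epsilon> by (intro mult_left_mono) auto
          \<comment> \<open>The tail \<alpha> + 3 \<epsilon> / 8 is at most 1, so restricting to
            missing dyads loses at most \<epsilon> / 8 of it.\<close>
          moreover have "\<alpha> + \<epsilon> / 4 \<le> (\<alpha> + 3 * \<epsilon> / 8) * (1 - \<epsilon> / 8)"
          proof -
            have "(\<alpha> + 3 * \<epsilon> / 8) * (\<epsilon> / 8) \<le> 1 * (\<epsilon> / 8)" using \<epsilon> \<alpha> by (intro mult_right_mono) auto
            then show ?thesis by (simp add: algebra_simps)
          qed
          ultimately show "\<alpha> + \<epsilon> / 4 \<le> prob {\<omega> \<in> B n (i, j). obsv i j \<omega> = 0}" by linarith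
        qed
      qed
      show "t \<le> ?S n i j \<omega>" if "even n" "(i, j) \<in> dyads (D2 n)" "\<omega> \<in> B n (i, j)" "\<omega> \<notin> Bad n (i, j)" for n i j \<omega>
        using that by (auto simp: B_def Bad_def continuous_score_def)
    qed (rule Bad_small)
    then have van: "vanishing smp (\<lambda>n. miss n \<union> Bad n (k n, l n))"
      using Bad_small(2)[OF kl] by (rule vanishing_Un)
    show "\<exists>G H. vanishing smp H \<and> (\<forall>\<^sub>F n in even_top.
        G n \<in> sets (pspace (smp n)) \<and>
        {\<omega> \<in> space (pspace (smp n)). obs w (\<rho> n) (smp n) (k n) (l n) \<omega> = 0}
          - coverage_event UNIV \<alpha> (\<lambda>n \<omega>. continuous_score (Fhat n \<omega>)) Yhat k l n \<subseteq> G n \<union> H n \<and>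
        (\<forall>C\<in>sets borel. measure (given_missing w (\<rho> n) (smp n) (k n) (l n)) {\<omega> \<in> space (pspace (smp n)). \<omega> \<in> G n \<and> Ytil n (k n) (l n) \<omega> \<in> C}
          \<le> (\<alpha> + \<epsilon>) * measure (given_missing w (\<rho> n) (smp n) (k n) (l n)) {\<omega> \<in> space (pspace (smp n)). Ytil n (k n) (l n) \<omega> \<in> C}))"
    proof (intro exI conjI, rule van)
      from eventually_model eventually_even_top[of 4]
      show "\<forall>\<^sub>F n in even_top. Gb n \<in> sets (pspace (smp n)) \<and>
        {\<omega> \<in> space (pspace (smp n)). obs w (\<rho> n) (smp n) (k n) (l n) \<omega> = 0}
          - coverage_event UNIV \<alpha> (\<lambda>n \<omega>. continuous_score (Fhat n \<omega>)) Yhat k l n \<subseteq> Gb n \<union> (miss n \<union> Bad n (k n, l n)) \<and>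
        (\<forall>C\<in>sets borel. measure (given_missing w (\<rho> n) (smp n) (k n) (l n)) {\<omega> \<in> space (pspace (smp n)). \<omega> \<in> Gb n \<and> Ytil n (k n) (l n) \<omega> \<in> C}
          \<le> (\<alpha> + \<epsilon>) * measure (given_missing w (\<rho> n) (smp n) (k n) (l n)) {\<omega> \<in> space (pspace (smp n)). Ytil n (k n) (l n) \<omega> \<in> C})"
      proof eventually_elim
        case (elim n)
        interpret model SX SZ D V n "smp n" g w "\<rho> n" c C by (rule elim)
        have n: "even n" using elim by simp
        have ij: "(k n, l n) \<in> dyads (D2 n)" using kl elim by (simp add: pair_seq_def)
        then have ij': "(k n, l n) \<in> dyads {1..n}" using dyads_D2_subset by blast
        interpret U: continuous_cond_cdf "given_missing w (\<rho> n) (smp n) (k n) (l n)" "Y (k n) (l n)" "Ytil n (k n) (l n)" "F n"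
          using T dyadsD[OF ij'] by (intro continuous_cond_cdf_given_missing[OF elim(1) n ij _ cdf]) auto
        have [measurable]: "?X2 n (k n) (l n) \<in> borel_measurable (pspace (smp n))"
          using dyad_sources_subset[OF ij'] by (intro src_alg_measurable[OF X2[OF elim(1) n ij order.refl]]) auto
        show ?case
        proof (intro conjI ballI)
          show "Gb n \<in> events" unfolding Gb_def by measurable
          \<comment> \<open>With estimated score at most t an uncovered pair belongs to
            \<open>miss\<close>; with a larger one its oracle deviation exceeds t - \<delta>, unless
            the estimation error exceeds \<delta>.\<close>
          show "{\<omega> \<in> space (pspace (smp n)). obsv (k n) (l n) \<omega> = 0}
            - coverage_event UNIV \<alpha> (\<lambda>n \<omega>. continuous_score (Fhat n \<omega>)) Yhat k l n \<subseteq> Gb n \<union> (miss n \<union> Bad n (k n, l n))"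
            by (subst coverage_event_eq) (auto simp: Gb_def miss_def Bad_def continuous_score_def)
          fix C' :: "real set" assume C': "C' \<in> sets borel"
          have "{\<omega> \<in> space (pspace (smp n)). \<omega> \<in> Gb n \<and> Ytil n (k n) (l n) \<omega> \<in> C'} =
              {\<omega> \<in> space (pspace (smp n)). ?dev n (k n) (l n) \<omega> > t - \<delta> \<and> Ytil n (k n) (l n) \<omega> \<in> C'}"
            by (auto simp: Gb_def)
          then have "measure (given_missing w (\<rho> n) (smp n) (k n) (l n)) {\<omega> \<in> space (pspace (smp n)). \<omega> \<in> Gb n \<and> Ytil n (k n) (l n) \<omega> \<in> C'}
            \<le> (1 - 2 * (t - \<delta>)) * measure (given_missing w (\<rho> n) (smp n) (k n) (l n)) {\<omega> \<in> space (pspace (smp n)). Ytil n (k n) (l n) \<omega> \<in> C'}"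
            using U.prob_F_deviation(1)[OF t(1,2) C'] by simp
          also have "\<dots> \<le> (\<alpha> + \<epsilon>) * measure (given_missing w (\<rho> n) (smp n) (k n) (l n)) {\<omega> \<in> space (pspace (smp n)). Ytil n (k n) (l n) \<omega> \<in> C'}"
            using t(5) by (intro mult_right_mono) auto
          finally show "measure (given_missing w (\<rho> n) (smp n) (k n) (l n)) {\<omega> \<in> space (pspace (smp n)). \<omega> \<in> Gb n \<and> Ytil n (k n) (l n) \<omega> \<in> C'}
            \<le> (\<alpha> + \<epsilon>) * measure (given_missing w (\<rho> n) (smp n) (k n) (l n)) {\<omega> \<in> space (pspace (smp n)). Ytil n (k n) (l n) \<omega> \<in> C'}" .
        qed
      qed
    qed
  qed
qed

end

section \<open>Discrete response\<close>

text \<open>The version sought is the Radon-Nikodym density of the measure P(E, T \<in> C) in C with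
  respect to the law of T. A function of the surrogate value, instead of a random variable on one
  sample space, is wanted because it will be carried over to the other samples of the array.\<close>

lemma (in prob_space) cond_prob_version:
  fixes T :: "'a \<Rightarrow> real"
  assumes T: "T \<in> borel_measurable M" and E: "E \<in> events"
  obtains \<phi> :: "real \<Rightarrow> real" where "\<phi> \<in> borel_measurable borel" "\<And>t. 0 \<le> \<phi> t" "\<And>t. \<phi> t \<le> 1"
    "AE \<omega> in M. real_cond_exp M (vimage_algebra (space M) T borel) (indicator E) \<omega> = \<phi> (T \<omega>)"
    "\<And>C. C \<in> sets borel \<Longrightarrow> (\<integral>\<omega>. \<phi> (T \<omega>) * indicator C (T \<omega>) \<partial>M) = prob {\<omega> \<in> space M. \<omega> \<in> E \<and> T \<omega> \<in> C}"
proof -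
  note [measurable] = T E
  let ?F = "vimage_algebra (space M) T borel"
  define N where "N = distr (density M (indicator E)) borel T"
  interpret T: prob_space "distr M borel T" by (rule prob_space_distr) (rule T)
  have N: "emeasure N C = prob {\<omega> \<in> space M. \<omega> \<in> E \<and> T \<omega> \<in> C}" if [measurable]: "C \<in> sets borel" for C
  proof -
    have "emeasure N C = emeasure (density M (indicator E)) (T -` C \<inter> space M)"
      unfolding N_def by (subst emeasure_distr) auto
    also have "\<dots> = (\<integral>\<^sup>+\<omega>. indicator E \<omega> * indicator (T -` C \<inter> space M) \<omega> \<partial>M)" by (subst emeasure_density) auto
    also have "\<dots> = (\<integral>\<^sup>+\<omega>. indicator {\<omega> \<in> space M. \<omega> \<in> E \<and> T \<omega> \<in> C} \<omega> \<partial>M)"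
      by (intro nn_integral_cong) (auto split: split_indicator)
    also have "\<dots> = prob {\<omega> \<in> space M. \<omega> \<in> E \<and> T \<omega> \<in> C}" by (simp add: emeasure_eq_measure)
    finally show ?thesis .
  qed
  have Nfin: "finite_measure N" using N[of UNIV] by (intro finite_measureI) (simp add: N_def)
  have ac: "absolutely_continuous (distr M borel T) N"
    unfolding absolutely_continuous_def
  proof
    fix C assume C: "C \<in> null_sets (distr M borel T)"
    then have Cb: "C \<in> sets borel" by auto
    have "prob {\<omega> \<in> space M. \<omega> \<in> E \<and> T \<omega> \<in> C} \<le> prob (T -` C \<inter> space M)"
      using Cb by (intro finite_measure_mono) auto
    also have "\<dots> = 0" using C Cb by (auto simp: null_sets_def emeasure_distr emeasure_eq_measure)
    finally show "C \<in> null_sets N" using N[OF Cb] Cb by (auto simp: null_sets_def N_def measure_le_0_iff)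
  qed
  obtain d where d [measurable]: "d \<in> borel_measurable (distr M borel T)"
    and RN: "AE t in distr M borel T. RN_deriv (distr M borel T) N t = ennreal (d t)" and dnn: "\<And>t. 0 \<le> d t"
    using T.real_RN_deriv[OF Nfin ac] by (auto simp: N_def)
  have dm [measurable]: "d \<in> borel_measurable borel" using d by simp
  have dN: "(\<integral>\<^sup>+\<omega>. ennreal (d (T \<omega>) * indicator C (T \<omega>)) \<partial>M) = ennreal (prob {\<omega> \<in> space M. \<omega> \<in> E \<and> T \<omega> \<in> C})"
    if [measurable]: "C \<in> sets borel" for C
  proof -
    have "ennreal (prob {\<omega> \<in> space M. \<omega> \<in> E \<and> T \<omega> \<in> C}) = emeasure (density (distr M borel T) (RN_deriv (distr M borel T) N)) C"
      using T.density_RN_deriv[OF ac] N[of C] by (simp add: N_def)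
    also have "\<dots> = (\<integral>\<^sup>+t. RN_deriv (distr M borel T) N t * indicator C t \<partial>distr M borel T)"
      by (subst emeasure_density) auto
    also have "\<dots> = (\<integral>\<^sup>+t. ennreal (d t * indicator C t) \<partial>distr M borel T)"
      using RN by (intro nn_integral_cong_AE) (auto split: split_indicator)
    also have "\<dots> = (\<integral>\<^sup>+\<omega>. ennreal (d (T \<omega>) * indicator C (T \<omega>)) \<partial>M)" by (subst nn_integral_distr) auto
    finally show ?thesis ..
  qed
  have di: "integrable M (\<lambda>\<omega>. d (T \<omega>))"
    using dN[of UNIV] dnn by (intro integrableI_nonneg) auto
  have dI: "(\<integral>\<omega>. d (T \<omega>) * indicator C (T \<omega>) \<partial>M) = prob {\<omega> \<in> space M. \<omega> \<in> E \<and> T \<omega> \<in> C}"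
    if [measurable]: "C \<in> sets borel" for C
    using dN[of C] dnn by (subst integral_eq_nn_integral) (auto simp: measure_nonneg)
  have sub: "finite_measure_subalgebra M ?F" by (rule cond_exp_given_rv(1)[OF T])
  interpret F: finite_measure_subalgebra M ?F by (rule sub)
  have iE: "integrable M (indicator E :: 'a \<Rightarrow> real)"
    by (intro integrable_real_indicator) (auto simp: emeasure_eq_measure)
  have ver: "AE \<omega> in M. real_cond_exp M ?F (indicator E) \<omega> = d (T \<omega>)"
  proof (rule F.real_cond_exp_charact[OF _ iE di])
    fix A assume "A \<in> sets ?F"
    then obtain C where C [measurable]: "C \<in> sets borel" and A: "A = T -` C \<inter> space M"
      unfolding cond_exp_given_rv(2)[OF T] by auto
    have "(\<integral>\<omega>\<in>A. indicator E \<omega> \<partial>M) = (\<integral>\<omega>. indicator {\<omega> \<in> space M. \<omega> \<in> E \<and> T \<omega> \<in> C} \<omega> \<partial>M)"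
      unfolding set_lebesgue_integral_def A
      by (intro Bochner_Integration.integral_cong refl) (auto split: split_indicator)
    also have "\<dots> = prob {\<omega> \<in> space M. \<omega> \<in> E \<and> T \<omega> \<in> C}" by (simp add: Int_absorb2)
    also have "\<dots> = (\<integral>\<omega>. d (T \<omega>) * indicator C (T \<omega>) \<partial>M)" by (rule dI[OF C, symmetric])
    also have "\<dots> = (\<integral>\<omega>\<in>A. d (T \<omega>) \<partial>M)"
      unfolding set_lebesgue_integral_def A
      by (intro Bochner_Integration.integral_cong refl) (auto split: split_indicator)
    finally show "(\<integral>\<omega>\<in>A. indicator E \<omega> \<partial>M) = (\<integral>\<omega>\<in>A. d (T \<omega>) \<partial>M)" .
  next
    show "(\<lambda>\<omega>. d (T \<omega>)) \<in> borel_measurable ?F"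
      by (rule measurable_compose[OF measurable_vimage_algebra1 dm]) simp
  qed
  have "AE \<omega> in M. real_cond_exp M ?F (indicator E) \<omega> \<le> 1"
    using F.real_cond_exp_le_c[OF iE, of 1] by (auto split: split_indicator)
  then have le1: "AE \<omega> in M. d (T \<omega>) = min 1 (d (T \<omega>))" using ver by eventually_elim auto
  show ?thesis
  \<comment> \<open>The density is at most 1 almost surely along T, so cutting it at 1 changes
    neither the version nor the integrals and gives a bound for every t.\<close>
  proof (rule that[of "\<lambda>t. min 1 (d t)"])
    show "AE \<omega> in M. real_cond_exp M ?F (indicator E) \<omega> = min 1 (d (T \<omega>))" using ver le1 by eventually_elim simp
    fix C :: "real set" assume C [measurable]: "C \<in> sets borel"
    have "(\<integral>\<omega>. min 1 (d (T \<omega>)) * indicator C (T \<omega>) \<partial>M) = (\<integral>\<omega>. d (T \<omega>) * indicator C (T \<omega>) \<partial>M)"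
      using le1 by (intro integral_cong_AE) auto
    then show "(\<integral>\<omega>. min 1 (d (T \<omega>)) * indicator C (T \<omega>) \<partial>M) = prob {\<omega> \<in> space M. \<omega> \<in> E \<and> T \<omega> \<in> C}"
      using dI[OF C] by simp
  qed (use dnn in auto)
qed

lemma (in prob_space) integral_conditioned:
  fixes f :: "'a \<Rightarrow> real"
  assumes A: "A \<in> events" "0 < prob A" and f: "f \<in> borel_measurable M"
  shows "(\<integral>\<omega>. f \<omega> \<partial>uniform_measure M A) = (\<integral>\<omega>. f \<omega> * indicator A \<omega> \<partial>M) / prob A"
proof -
  have "uniform_measure M A = density M (\<lambda>\<omega>. ennreal (indicator A \<omega> / prob A))"
    unfolding uniform_measure_def
    using A by (intro density_cong) (auto simp: emeasure_eq_measure divide_ennreal split: split_indicator simp flip: ennreal_1)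
  then have "(\<integral>\<omega>. f \<omega> \<partial>uniform_measure M A) = (\<integral>\<omega>. (indicator A \<omega> / prob A) *\<^sub>R f \<omega> \<partial>M)"
    using A f by (simp add: integral_density)
  also have "\<dots> = (\<integral>\<omega>. f \<omega> * indicator A \<omega> / prob A \<partial>M)" by (simp add: mult.commute)
  finally show ?thesis by simp
qed

text \<open>With a the mean of f on A, p the probability of A, and b the mean of f off A, the
  difference is (a / p) (1 - p) - b. Both terms lie between 0 and 1 - p, hence so does the absolute
  value of their difference.\<close>

lemma (in prob_space) conditioned_expectation_close:
  fixes f :: "'a \<Rightarrow> real"
  assumes A: "A \<in> events" "0 < prob A" and f: "f \<in> borel_measurable M" "\<And>\<omega>. \<omega> \<in> space M \<Longrightarrow> 0 \<le> f \<omega> \<and> f \<omega> \<le> 1"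
  shows "\<bar>(\<integral>\<omega>. f \<omega> \<partial>uniform_measure M A) - expectation f\<bar> \<le> 1 - prob A"
proof -
  note [measurable] = A(1) f(1)
  let ?a = "\<integral>\<omega>. f \<omega> * indicator A \<omega> \<partial>M" and ?b = "\<integral>\<omega>. f \<omega> * indicator (space M - A) \<omega> \<partial>M"
  have i: "integrable M (\<lambda>\<omega>. f \<omega> * indicator B \<omega>)" if "B \<in> events" for B
    using f that by (intro integrable_const_bound[where B=1]) (auto split: split_indicator)
  have bd: "0 \<le> (\<integral>\<omega>. f \<omega> * indicator B \<omega> \<partial>M) \<and> (\<integral>\<omega>. f \<omega> * indicator B \<omega> \<partial>M) \<le> prob B" if B: "B \<in> events" for B
  proof
    show "0 \<le> (\<integral>\<omega>. f \<omega> * indicator B \<omega> \<partial>M)" using f by (intro integral_nonneg_AE) auto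
    have "(\<integral>\<omega>. f \<omega> * indicator B \<omega> \<partial>M) \<le> (\<integral>\<omega>. indicator B \<omega> \<partial>M)"
    proof (rule integral_mono[OF i[OF B]])
      show "integrable M (indicator B :: 'a \<Rightarrow> real)" using B by (intro integrable_real_indicator) (auto simp: emeasure_eq_measure)
    qed (use f in \<open>auto split: split_indicator\<close>)
    also have "\<dots> = prob B" using B by (simp add: Int_absorb2 sets.sets_into_space)
    finally show "(\<integral>\<omega>. f \<omega> * indicator B \<omega> \<partial>M) \<le> prob B" .
  qed
  have "expectation f = (\<integral>\<omega>. f \<omega> * indicator A \<omega> + f \<omega> * indicator (space M - A) \<omega> \<partial>M)"
    by (intro Bochner_Integration.integral_cong refl) (auto split: split_indicator)
  also have "\<dots> = ?a + ?b" using i A(1) by (subst Bochner_Integration.integral_add) auto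
  finally have E: "expectation f = ?a + ?b" .
  have b: "0 \<le> ?b" "?b \<le> 1 - prob A" using bd[of "space M - A"] A(1) prob_compl[OF A(1)] by auto
  have a: "0 \<le> ?a" "?a / prob A \<le> 1" using bd[OF A(1)] A(2) by auto
  have p1: "0 \<le> 1 - prob A" by simp
  have "?a / prob A - ?a = ?a / prob A * (1 - prob A)" using A(2) by (simp add: field_simps)
  moreover have "0 \<le> ?a / prob A * (1 - prob A)" using a(1) A(2) p1 by (intro mult_nonneg_nonneg divide_nonneg_pos)
  moreover have "?a / prob A * (1 - prob A) \<le> 1 * (1 - prob A)" using a(2) p1 by (rule mult_right_mono)
  moreover have "\<bar>x - (a + b)\<bar> \<le> d" if "x - a = y" "0 \<le> y" "y \<le> 1 * d" "0 \<le> b" "b \<le> d" for x a b y d :: real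
    using that by linarith
  ultimately show ?thesis unfolding integral_conditioned[OF A f(1)] E using b by blast
qed

text \<open>The neighbourhoods of x shrink to the level set of x, which is null; continuity from
  above makes one of them small.\<close>

lemma (in prob_space) small_near_level:
  fixes X :: "'a \<Rightarrow> real"
  assumes X [measurable]: "X \<in> borel_measurable M" and ne: "AE \<omega> in M. X \<omega> \<noteq> x" and e: "0 < e"
  shows "\<exists>\<delta>>0. prob {\<omega> \<in> space M. \<bar>X \<omega> - x\<bar> \<le> \<delta>} < e"
proof -
  define A where "A m = {\<omega> \<in> space M. \<bar>X \<omega> - x\<bar> \<le> 1 / real (Suc m)}" for m
  have "decseq A" unfolding A_def decseq_def
    by (auto intro: order.trans simp: frac_le)
  moreover have "range A \<subseteq> events" unfolding A_def by auto
  ultimately have "(\<lambda>m. prob (A m)) \<longlonglongrightarrow> prob (\<Inter>m. A m)"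
    by (intro finite_Lim_measure_decseq)
  moreover have "(\<Inter>m. A m) = {\<omega> \<in> space M. X \<omega> = x}"
  proof
    show "(\<Inter>m. A m) \<subseteq> {\<omega> \<in> space M. X \<omega> = x}"
    proof
      fix \<omega> assume \<omega>: "\<omega> \<in> (\<Inter>m. A m)"
      have "X \<omega> = x"
      proof (rule ccontr)
        assume "X \<omega> \<noteq> x"
        then have "0 < \<bar>X \<omega> - x\<bar>" by simp
        then obtain m where "1 / real (Suc m) < \<bar>X \<omega> - x\<bar>" using nat_approx_posE by blast
        then show False using \<omega> by (auto simp: A_def not_le[symmetric])
      qed
      then show "\<omega> \<in> {\<omega> \<in> space M. X \<omega> = x}" using \<omega> by (auto simp: A_def)
    qed
  qed (auto simp: A_def)
  moreover have "prob {\<omega> \<in> space M. X \<omega> = x} = 0"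
    using ne by (subst prob_eq_0) auto
  ultimately have "(\<lambda>m. prob (A m)) \<longlonglongrightarrow> 0" by simp
  then have "\<forall>\<^sub>F m in sequentially. prob (A m) < e" using e by (rule order_tendstoD)
  then obtain m where "prob (A m) < e" by (auto simp: eventually_sequentially)
  then show ?thesis unfolding A_def by (intro exI[of _ "1 / real (Suc m)"]) auto
qed

section \<open>The law of a dyad does not depend on the sample\<close>

context sampled
begin

text \<open>The nodes i and j and the variable \<open>nu s i j\<close> are three different sources,
  so the product law is assembled in two steps; the result mentions neither the sample nor the
  dyad.\<close>

lemma dyad_distr:
  assumes ij: "(i, j) \<in> dyads {1..n}"
  shows "(\<lambda>\<omega>. ((node s i \<omega>, node s j \<omega>), nu s i j \<omega>)) \<in> pspace s \<rightarrow>\<^sub>M (node_space SX SZ \<Otimes>\<^sub>M node_space SX SZ) \<Otimes>\<^sub>M V"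
    and "distr (pspace s) ((node_space SX SZ \<Otimes>\<^sub>M node_space SX SZ) \<Otimes>\<^sub>M V)
      (\<lambda>\<omega>. ((node s i \<omega>, node s j \<omega>), nu s i j \<omega>)) = (D \<Otimes>\<^sub>M D) \<Otimes>\<^sub>M V"
proof -
  have ij': "i \<in> {1..n}" "j \<in> {1..n}" "i < j" using ij by (auto simp: dyads_def)
  note ms = node_measurable[OF ij'(1)] node_measurable[OF ij'(2)] nu_measurable[OF ij]
  have pair: "(\<lambda>\<omega>. (node s i \<omega>, node s j \<omega>)) \<in> pspace s \<rightarrow>\<^sub>M node_space SX SZ \<Otimes>\<^sub>M node_space SX SZ"
    using ms by (intro measurable_Pair)
  show "(\<lambda>\<omega>. ((node s i \<omega>, node s j \<omega>), nu s i j \<omega>)) \<in> pspace s \<rightarrow>\<^sub>M (node_space SX SZ \<Otimes>\<^sub>M node_space SX SZ) \<Otimes>\<^sub>M V"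
    using pair ms by (intro measurable_Pair)
  have "distr (pspace s) (node_space SX SZ) (node s i) \<Otimes>\<^sub>M distr (pspace s) (node_space SX SZ) (node s j) =
      distr (pspace s) (node_space SX SZ \<Otimes>\<^sub>M node_space SX SZ) (\<lambda>\<omega>. (node s i \<omega>, node s j \<omega>))"
  proof (rule distr_pair_indep[OF ms(1,2)])
    fix A B assume AB: "A \<in> sets (node_space SX SZ)" "B \<in> sets (node_space SX SZ)"
    have "indep_set (sets (src_alg {Node i})) (sets (src_alg {Node j}))"
      using ij' Node_in_sources by (intro src_alg_indep) auto
    then show "prob (node s i -` A \<inter> space (pspace s) \<inter> (node s j -` B \<inter> space (pspace s))) =
        prob (node s i -` A \<inter> space (pspace s)) * prob (node s j -` B \<inter> space (pspace s))"
      using AB measurable_sets[OF node_src[OF ij'(1), of "{Node i}"]] measurable_sets[OF node_src[OF ij'(2), of "{Node j}"]]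
      by (intro indep_setD) auto
  qed
  then have 1: "D \<Otimes>\<^sub>M D = distr (pspace s) (node_space SX SZ \<Otimes>\<^sub>M node_space SX SZ) (\<lambda>\<omega>. (node s i \<omega>, node s j \<omega>))"
    using node_distr ij' by simp
  have "distr (pspace s) (node_space SX SZ \<Otimes>\<^sub>M node_space SX SZ) (\<lambda>\<omega>. (node s i \<omega>, node s j \<omega>)) \<Otimes>\<^sub>M distr (pspace s) V (nu s i j) =
      distr (pspace s) ((node_space SX SZ \<Otimes>\<^sub>M node_space SX SZ) \<Otimes>\<^sub>M V) (\<lambda>\<omega>. ((node s i \<omega>, node s j \<omega>), nu s i j \<omega>))"
  proof (rule distr_pair_indep[OF pair ms(3)])
    fix A B assume AB: "A \<in> sets (node_space SX SZ \<Otimes>\<^sub>M node_space SX SZ)" "B \<in> sets V"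
    have "indep_set (sets (src_alg {Node i, Node j})) (sets (src_alg {Nu i j}))"
      using ij' ij Node_in_sources Nu_in_sources by (intro src_alg_indep) auto
    moreover have "(\<lambda>\<omega>. (node s i \<omega>, node s j \<omega>)) \<in> src_alg {Node i, Node j} \<rightarrow>\<^sub>M node_space SX SZ \<Otimes>\<^sub>M node_space SX SZ"
      using ij' by (intro measurable_Pair node_src) auto
    ultimately show "prob ((\<lambda>\<omega>. (node s i \<omega>, node s j \<omega>)) -` A \<inter> space (pspace s) \<inter> (nu s i j -` B \<inter> space (pspace s))) =
        prob ((\<lambda>\<omega>. (node s i \<omega>, node s j \<omega>)) -` A \<inter> space (pspace s)) * prob (nu s i j -` B \<inter> space (pspace s))"
      using AB measurable_sets[of "\<lambda>\<omega>. (node s i \<omega>, node s j \<omega>)" "src_alg {Node i, Node j}"]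
        measurable_sets[OF nu_src[OF ij, of "{Nu i j}"]]
      by (intro indep_setD) auto
  qed
  then show "distr (pspace s) ((node_space SX SZ \<Otimes>\<^sub>M node_space SX SZ) \<Otimes>\<^sub>M V)
      (\<lambda>\<omega>. ((node s i \<omega>, node s j \<omega>), nu s i j \<omega>)) = (D \<Otimes>\<^sub>M D) \<Otimes>\<^sub>M V"
    using nu_distr[OF ij] by (simp add: 1)
qed

lemma pair_function_src:
  assumes h: "(\<lambda>((x, u, z), (x', u', z')). h x u z x' u' z') \<in> borel_measurable (node_space SX SZ \<Otimes>\<^sub>M node_space SX SZ)"
    and ij: "i \<in> {1..n}" "j \<in> {1..n}" "Node i \<in> A" "Node j \<in> A"
  shows "(\<lambda>\<omega>. h (Xcov s i \<omega>) (xi s i \<omega>) (zeta s i \<omega>) (Xcov s j \<omega>) (xi s j \<omega>) (zeta s j \<omega>)) \<in> borel_measurable (src_alg A)"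
proof -
  have "(\<lambda>\<omega>. (node s i \<omega>, node s j \<omega>)) \<in> src_alg A \<rightarrow>\<^sub>M node_space SX SZ \<Otimes>\<^sub>M node_space SX SZ"
    using ij by (intro measurable_Pair node_src)
  from measurable_compose[OF this h] show ?thesis by (simp add: node_def)
qed

text \<open>g and h are fixed maps, so surrogate and response of a dyad are the image of one fixed
  law; this lets a statement about their joint law pass from one sample to all others.\<close>

lemma surrogate_response_distr:
  assumes ij: "(i, j) \<in> dyads {1..n}"
    and h: "(\<lambda>((x, u, z), (x', u', z')). h x u z x' u' z') \<in> borel_measurable (node_space SX SZ \<Otimes>\<^sub>M node_space SX SZ)"
    and g: "(\<lambda>(x, z, x', z', v). g x z x' z' v) \<in> borel_measurable (SX \<Otimes>\<^sub>M SZ \<Otimes>\<^sub>M SX \<Otimes>\<^sub>M SZ \<Otimes>\<^sub>M V)"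
    and T: "\<And>\<omega>. \<omega> \<in> space (pspace s) \<Longrightarrow>
      T \<omega> = h (Xcov s i \<omega>) (xi s i \<omega>) (zeta s i \<omega>) (Xcov s j \<omega>) (xi s j \<omega>) (zeta s j \<omega>)"
  shows "(\<lambda>\<omega>. (T \<omega>, resp g s i j \<omega>)) \<in> pspace s \<rightarrow>\<^sub>M borel \<Otimes>\<^sub>M borel"
    and "distr (pspace s) (borel \<Otimes>\<^sub>M borel) (\<lambda>\<omega>. (T \<omega>, resp g s i j \<omega>)) =
      distr ((D \<Otimes>\<^sub>M D) \<Otimes>\<^sub>M V) (borel \<Otimes>\<^sub>M borel)
        (\<lambda>(((x, u, z), (x', u', z')), v). (h x u z x' u' z', g x z x' z' v))"
proof -
  let ?N = "(node_space SX SZ \<Otimes>\<^sub>M node_space SX SZ) \<Otimes>\<^sub>M V"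
  let ?f = "\<lambda>\<omega>. ((node s i \<omega>, node s j \<omega>), nu s i j \<omega>)"
  let ?\<Psi> = "\<lambda>(((x, u, z), (x', u', z')), v). (h x u z x' u' z', g x z x' z' v)"
  note law = dyad_distr[OF ij]
  have [measurable]: "(\<lambda>a. h (fst (fst a)) (fst (snd (fst a))) (snd (snd (fst a))) (fst (snd a)) (fst (snd (snd a))) (snd (snd (snd a))))
      \<in> borel_measurable (node_space SX SZ \<Otimes>\<^sub>M node_space SX SZ)"
    using h by (simp add: case_prod_unfold)
  have 1: "(\<lambda>a. h (fst (fst (fst a))) (fst (snd (fst (fst a)))) (snd (snd (fst (fst a))))
      (fst (snd (fst a))) (fst (snd (snd (fst a)))) (snd (snd (snd (fst a))))) \<in> borel_measurable ?N"
    by (rule measurable_compose[OF measurable_fst]) measurable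
  have "(\<lambda>a. (\<lambda>(x, z, x', z', v). g x z x' z' v) (fst (fst (fst a)), snd (snd (fst (fst a))),
      fst (snd (fst a)), snd (snd (snd (fst a))), snd a)) \<in> borel_measurable ?N"
    using g unfolding node_space_def by measurable
  with 1 have \<Psi>: "?\<Psi> \<in> ?N \<rightarrow>\<^sub>M borel \<Otimes>\<^sub>M borel"
    unfolding case_prod_unfold by (intro measurable_Pair) simp_all
  have ij': "min i j = i" "max i j = j" using ij by (auto simp: dyads_def)
  have eq: "(T \<omega>, resp g s i j \<omega>) = ?\<Psi> (?f \<omega>)" if "\<omega> \<in> space (pspace s)" for \<omega>
    using T[OF that] by (simp add: node_def resp_def ij' Let_def)
  show "(\<lambda>\<omega>. (T \<omega>, resp g s i j \<omega>)) \<in> pspace s \<rightarrow>\<^sub>M borel \<Otimes>\<^sub>M borel"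
    using measurable_compose[OF law(1) \<Psi>] by (subst measurable_cong[OF eq]) simp_all
  have "distr (pspace s) (borel \<Otimes>\<^sub>M borel) (\<lambda>\<omega>. (T \<omega>, resp g s i j \<omega>)) =
      distr (pspace s) (borel \<Otimes>\<^sub>M borel) (\<lambda>\<omega>. ?\<Psi> (?f \<omega>))"
    by (intro distr_cong refl eq)
  also have "\<dots> = distr (distr (pspace s) ?N ?f) (borel \<Otimes>\<^sub>M borel) ?\<Psi>"
    using distr_distr[OF \<Psi> law(1)] by (simp add: comp_def)
  finally show "distr (pspace s) (borel \<Otimes>\<^sub>M borel) (\<lambda>\<omega>. (T \<omega>, resp g s i j \<omega>)) =
      distr ((D \<Otimes>\<^sub>M D) \<Otimes>\<^sub>M V) (borel \<Otimes>\<^sub>M borel) ?\<Psi>"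
    unfolding law(2) .
qed

end

section \<open>Class probabilities with and without conditioning on missingness\<close>

context model
begin

text \<open>For the last bound, class 1 has conditional probability less than \<tau> where \<pi> <
  \<tau>, and class 0 where 1 - \<pi> < \<tau>. As \<tau> \<le> 1/2, these two sets of surrogate
  values are disjoint, so the two contributions add up to \<tau> and not to 2 * \<tau>.\<close>

lemma prob_discrete_split:
  assumes ij: "(i, j) \<in> dyads {1..n}" and T: "T \<in> borel_measurable (pspace s)"
    and Y01: "\<forall>\<omega>\<in>space (pspace s). Y i j \<omega> \<in> {0, 1}"
    and \<pi>: "\<pi> \<in> borel_measurable borel"
    and version: "AE \<omega> in given_missing w r s i j. \<pi> (T \<omega>) =
      cprob_missing w r s T i j {\<omega> \<in> space (pspace s). Y i j \<omega> = 1} \<omega>"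
  shows "integrable (given_missing w r s i j) (\<lambda>\<omega>. \<pi> (T \<omega>))"
    and "C' \<in> sets borel \<Longrightarrow> (\<integral>\<omega>. \<pi> (T \<omega>) * indicator C' (T \<omega>) \<partial>given_missing w r s i j) =
      measure (given_missing w r s i j) {\<omega> \<in> space (pspace s). Y i j \<omega> = 1 \<and> T \<omega> \<in> C'}"
    and "0 \<le> \<tau> \<Longrightarrow> \<tau> \<le> 1 / 2 \<Longrightarrow> C' \<in> sets borel \<Longrightarrow>
      measure (given_missing w r s i j) {\<omega> \<in> space (pspace s).
        (Y i j \<omega> = 1 \<and> \<pi> (T \<omega>) < \<tau> \<or> Y i j \<omega> = 0 \<and> 1 - \<pi> (T \<omega>) < \<tau>) \<and> T \<omega> \<in> C'}
      \<le> \<tau> * measure (given_missing w r s i j) {\<omega> \<in> space (pspace s). T \<omega> \<in> C'}"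
proof -
  let ?Q = "given_missing w r s i j"
  interpret Q: prob_space ?Q by (rule given_missing_prob(3)[OF ij])
  note [measurable] = T \<pi> resp_measurable[OF ij]
  have cong: "borel_measurable ?Q = (borel_measurable (pspace s) :: ('a \<Rightarrow> real) set)"
    by (rule measurable_cong_sets) simp_all
  let ?E = "{\<omega> \<in> space (pspace s). Y i j \<omega> = 1}"
  have E: "?E \<in> events" by measurable
  have \<pi>T: "(\<lambda>\<omega>. \<pi> (T \<omega>)) \<in> borel_measurable (pspace s)" by measurable
  have TQ: "T \<in> borel_measurable ?Q" and \<pi>Q: "(\<lambda>\<omega>. \<pi> (T \<omega>)) \<in> borel_measurable ?Q" using T \<pi>T cong by auto
  have "finite_measure_subalgebra ?Q (vimage_algebra (space ?Q) T borel)" by (rule Q.cond_exp_given_rv(1)[OF TQ])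
  then interpret F: finite_measure_subalgebra ?Q "vimage_algebra (space (pspace s)) T borel" by simp
  have iE: "integrable ?Q (indicator ?E :: 'a \<Rightarrow> real)"
    using E by (intro integrable_real_indicator) (auto simp: Q.emeasure_eq_measure)
  have "integrable ?Q (cprob_missing w r s T i j ?E)"
    unfolding cprob_missing_def by (rule F.real_cond_exp_int(1)[OF iE])
  then show int: "integrable ?Q (\<lambda>\<omega>. \<pi> (T \<omega>))"
    by (rule Bochner_Integration.integrable_cong_AE_imp) (use \<pi>Q version in auto)
  have one: "(\<integral>\<omega>. \<pi> (T \<omega>) * indicator C' (T \<omega>) \<partial>?Q) = measure ?Q {\<omega> \<in> space (pspace s). Y i j \<omega> = 1 \<and> T \<omega> \<in> C'}"
    if "C' \<in> sets borel" for C'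
    using integral_cprob_missing[OF ij T E that version \<pi>T]
    by (auto intro: arg_cong[where f="measure ?Q"] elim!: trans)
  then show "C' \<in> sets borel \<Longrightarrow> (\<integral>\<omega>. \<pi> (T \<omega>) * indicator C' (T \<omega>) \<partial>?Q) =
      measure ?Q {\<omega> \<in> space (pspace s). Y i j \<omega> = 1 \<and> T \<omega> \<in> C'}" .
  have Tset [measurable]: "{\<omega> \<in> space (pspace s). T \<omega> \<in> B} \<in> events" if "B \<in> sets borel" for B
    using that T by measurable
  have ind: "integrable ?Q (\<lambda>\<omega>. x * indicator B (T \<omega>) :: real)"
    and ind_eq: "(\<integral>\<omega>. x * indicator B (T \<omega>) \<partial>?Q) = x * measure ?Q {\<omega> \<in> space (pspace s). T \<omega> \<in> B}"
    if B: "B \<in> sets borel" for x :: real and B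
  proof -
    have m: "(\<lambda>\<omega>. x * indicator B (T \<omega>) :: real) \<in> borel_measurable ?Q" using TQ B by measurable
    then show "integrable ?Q (\<lambda>\<omega>. x * indicator B (T \<omega>) :: real)"
      by (intro Q.integrable_const_bound[where B="\<bar>x\<bar>"]) (auto split: split_indicator)
    have "(\<integral>\<omega>. x * indicator B (T \<omega>) \<partial>?Q) = (\<integral>\<omega>. x * indicator {\<omega> \<in> space (pspace s). T \<omega> \<in> B} \<omega> \<partial>?Q)"
      by (intro Bochner_Integration.integral_cong refl) (auto split: split_indicator)
    also have "\<dots> = x * measure ?Q {\<omega> \<in> space (pspace s). T \<omega> \<in> B}" by (simp add: Int_absorb2)
    finally show "(\<integral>\<omega>. x * indicator B (T \<omega>) \<partial>?Q) = x * measure ?Q {\<omega> \<in> space (pspace s). T \<omega> \<in> B}" .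
  qed
  have \<pi>ind: "integrable ?Q (\<lambda>\<omega>. \<pi> (T \<omega>) * indicator B (T \<omega>))" if B: "B \<in> sets borel" for B
  proof (rule Bochner_Integration.integrable_bound[OF int])
    show "(\<lambda>\<omega>. \<pi> (T \<omega>) * indicator B (T \<omega>)) \<in> borel_measurable ?Q" using TQ \<pi>Q B by measurable
  qed (auto split: split_indicator)
  have zero: "(\<integral>\<omega>. (1 - \<pi> (T \<omega>)) * indicator B (T \<omega>) \<partial>?Q) = measure ?Q {\<omega> \<in> space (pspace s). Y i j \<omega> = 0 \<and> T \<omega> \<in> B}"
    if B: "B \<in> sets borel" for B
  proof -
    have "measure ?Q {\<omega> \<in> space (pspace s). T \<omega> \<in> B} = measure ?Q ({\<omega> \<in> space (pspace s). Y i j \<omega> = 1 \<and> T \<omega> \<in> B} \<union>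
        {\<omega> \<in> space (pspace s). Y i j \<omega> = 0 \<and> T \<omega> \<in> B})"
      using Y01 by (intro arg_cong[where f="measure ?Q"]) auto
    also have "\<dots> = measure ?Q {\<omega> \<in> space (pspace s). Y i j \<omega> = 1 \<and> T \<omega> \<in> B} +
        measure ?Q {\<omega> \<in> space (pspace s). Y i j \<omega> = 0 \<and> T \<omega> \<in> B}"
      using B by (intro Q.finite_measure_Union) auto
    finally have "measure ?Q {\<omega> \<in> space (pspace s). Y i j \<omega> = 0 \<and> T \<omega> \<in> B} =
        (\<integral>\<omega>. 1 * indicator B (T \<omega>) \<partial>?Q) - (\<integral>\<omega>. \<pi> (T \<omega>) * indicator B (T \<omega>) \<partial>?Q)"
      using one[OF B] ind_eq[OF B, of 1] by simp
    also have "\<dots> = (\<integral>\<omega>. 1 * indicator B (T \<omega>) - \<pi> (T \<omega>) * indicator B (T \<omega>) \<partial>?Q)"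
      using \<pi>ind[OF B] ind[OF B, of 1] by (subst Bochner_Integration.integral_diff) auto
    finally show ?thesis by (simp add: algebra_simps)
  qed
  assume \<tau>: "0 \<le> \<tau>" "\<tau> \<le> 1 / 2" and C': "C' \<in> sets borel"
  let ?B1 = "C' \<inter> {t. \<pi> t < \<tau>}" and ?B0 = "C' \<inter> {t. 1 - \<pi> t < \<tau>}"
  have B: "?B1 \<in> sets borel" "?B0 \<in> sets borel" using C' \<pi> by measurable
  have "measure ?Q {\<omega> \<in> space (pspace s). Y i j \<omega> = 1 \<and> T \<omega> \<in> ?B1} \<le> \<tau> * measure ?Q {\<omega> \<in> space (pspace s). T \<omega> \<in> ?B1}"
    unfolding one[OF B(1), symmetric] ind_eq[OF B(1), symmetric]
    using \<pi>ind[OF B(1)] ind[OF B(1)] by (intro integral_mono) (auto split: split_indicator)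
  moreover have "measure ?Q {\<omega> \<in> space (pspace s). Y i j \<omega> = 0 \<and> T \<omega> \<in> ?B0} \<le> \<tau> * measure ?Q {\<omega> \<in> space (pspace s). T \<omega> \<in> ?B0}"
  proof -
    have "integrable ?Q (\<lambda>\<omega>. 1 * indicator ?B0 (T \<omega>) - \<pi> (T \<omega>) * indicator ?B0 (T \<omega>))"
      using \<pi>ind[OF B(2)] ind[OF B(2), of 1] by (rule Bochner_Integration.integrable_diff[rotated])
    then have "integrable ?Q (\<lambda>\<omega>. (1 - \<pi> (T \<omega>)) * indicator ?B0 (T \<omega>))" by (simp add: algebra_simps)
    then show ?thesis
      unfolding zero[OF B(2), symmetric] ind_eq[OF B(2), symmetric]
      using ind[OF B(2)] by (intro integral_mono) (auto split: split_indicator)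
  qed
  moreover have "measure ?Q {\<omega> \<in> space (pspace s). T \<omega> \<in> ?B1} + measure ?Q {\<omega> \<in> space (pspace s). T \<omega> \<in> ?B0} \<le>
      measure ?Q {\<omega> \<in> space (pspace s). T \<omega> \<in> C'}"
  proof -
    have "measure ?Q {\<omega> \<in> space (pspace s). T \<omega> \<in> ?B1} + measure ?Q {\<omega> \<in> space (pspace s). T \<omega> \<in> ?B0} =
        measure ?Q ({\<omega> \<in> space (pspace s). T \<omega> \<in> ?B1} \<union> {\<omega> \<in> space (pspace s). T \<omega> \<in> ?B0})"
      using Tset[OF B(1)] Tset[OF B(2)] \<tau>(2) by (intro Q.finite_measure_Union[symmetric]) auto
    also have "\<dots> \<le> measure ?Q {\<omega> \<in> space (pspace s). T \<omega> \<in> C'}"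
      using Tset[OF C'] by (intro Q.finite_measure_mono) auto
    finally show ?thesis .
  qed
  moreover have "measure ?Q {\<omega> \<in> space (pspace s).
        (Y i j \<omega> = 1 \<and> \<pi> (T \<omega>) < \<tau> \<or> Y i j \<omega> = 0 \<and> 1 - \<pi> (T \<omega>) < \<tau>) \<and> T \<omega> \<in> C'} \<le>
      measure ?Q {\<omega> \<in> space (pspace s). Y i j \<omega> = 1 \<and> T \<omega> \<in> ?B1} + measure ?Q {\<omega> \<in> space (pspace s). Y i j \<omega> = 0 \<and> T \<omega> \<in> ?B0}"
  proof -
    have eq: "{\<omega> \<in> space (pspace s). (Y i j \<omega> = 1 \<and> \<pi> (T \<omega>) < \<tau> \<or> Y i j \<omega> = 0 \<and> 1 - \<pi> (T \<omega>) < \<tau>) \<and> T \<omega> \<in> C'} =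
        {\<omega> \<in> space (pspace s). Y i j \<omega> = 1 \<and> T \<omega> \<in> ?B1} \<union> {\<omega> \<in> space (pspace s). Y i j \<omega> = 0 \<and> T \<omega> \<in> ?B0}" by auto
    have YT: "{\<omega> \<in> space (pspace s). Y i j \<omega> = y \<and> T \<omega> \<in> B'} \<in> events" if "B' \<in> sets borel" for y B'
      using that by measurable
    show ?thesis unfolding eq using YT[OF B(1)] YT[OF B(2)] by (intro measure_Un_le) simp_all
  qed
  ultimately show "measure ?Q {\<omega> \<in> space (pspace s).
        (Y i j \<omega> = 1 \<and> \<pi> (T \<omega>) < \<tau> \<or> Y i j \<omega> = 0 \<and> 1 - \<pi> (T \<omega>) < \<tau>) \<and> T \<omega> \<in> C'}
      \<le> \<tau> * measure ?Q {\<omega> \<in> space (pspace s). T \<omega> \<in> C'}"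
    using mult_left_mono[OF _ \<tau>(1)] by (smt (verit, best) distrib_left)
qed

text \<open>Tested on a set B of surrogate values under the conditioned law, both \<pi> and \<phi>
  integrate to P(Y = 1, T \<in> B) up to C * r, the price of conditioning. On the set where one
  exceeds the other by \<delta> this gives mass at most 2 * C * r / \<delta>, and there are two
  signs.\<close>

lemma missingness_effect:
  assumes ij: "(i, j) \<in> dyads {1..n}" and T: "T \<in> borel_measurable (pspace s)"
    and Y01: "\<forall>\<omega>\<in>space (pspace s). Y i j \<omega> \<in> {0, 1}"
    and \<pi>: "\<pi> \<in> borel_measurable borel"
    and version: "AE \<omega> in given_missing w r s i j. \<pi> (T \<omega>) =
      cprob_missing w r s T i j {\<omega> \<in> space (pspace s). Y i j \<omega> = 1} \<omega>"
    and \<phi>: "\<phi> \<in> borel_measurable borel" "\<And>t. 0 \<le> \<phi> t" "\<And>t. \<phi> t \<le> 1"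
    and \<phi>_int: "\<And>B. B \<in> sets borel \<Longrightarrow> (\<integral>\<omega>. \<phi> (T \<omega>) * indicator B (T \<omega>) \<partial>pspace s) =
      prob {\<omega> \<in> space (pspace s). Y i j \<omega> = 1 \<and> T \<omega> \<in> B}"
    and \<delta>: "0 < \<delta>"
  shows "measure (given_missing w r s i j) {\<omega> \<in> space (pspace s). \<delta> < \<bar>\<pi> (T \<omega>) - \<phi> (T \<omega>)\<bar>} \<le> 4 * (C * r) / \<delta>"
proof -
  let ?Q = "given_missing w r s i j"
  let ?M = "{\<omega> \<in> space (pspace s). obsv i j \<omega> = 0}"
  interpret Q: prob_space ?Q by (rule given_missing_prob(3)[OF ij])
  have M: "?M \<in> events" by (rule given_missing_prob(1)[OF ij])
  have \<kappa>: "1 - prob ?M \<le> C * r" using given_missing_prob(2)[OF ij] by simp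
  have M0: "0 < prob ?M" using \<kappa> sparse by (simp add: mult.commute)
  note [measurable] = T \<pi> \<phi>(1) resp_measurable[OF ij]
  have cong: "borel_measurable ?Q = (borel_measurable (pspace s) :: ('a \<Rightarrow> real) set)"
    by (rule measurable_cong_sets) simp_all
  have close: "\<bar>(\<integral>\<omega>. f \<omega> \<partial>?Q) - expectation f\<bar> \<le> C * r"
    if "f \<in> borel_measurable (pspace s)" "\<And>\<omega>. \<omega> \<in> space (pspace s) \<Longrightarrow> 0 \<le> f \<omega> \<and> f \<omega> \<le> 1" for f
    using conditioned_expectation_close[OF M M0 that] \<kappa> by (simp add: given_missing_def)
  note split = prob_discrete_split[OF ij T Y01 \<pi> version]
  have diff: "\<bar>(\<integral>\<omega>. (\<pi> (T \<omega>) - \<phi> (T \<omega>)) * indicator B (T \<omega>) \<partial>?Q)\<bar> \<le> 2 * (C * r)"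
    and int: "integrable ?Q (\<lambda>\<omega>. (\<pi> (T \<omega>) - \<phi> (T \<omega>)) * indicator B (T \<omega>))"
    if B [measurable]: "B \<in> sets borel" for B
  proof -
    have m1: "(\<lambda>\<omega>. \<phi> (T \<omega>) * indicator B (T \<omega>)) \<in> borel_measurable (pspace s)" by measurable
    then have i1: "integrable ?Q (\<lambda>\<omega>. \<phi> (T \<omega>) * indicator B (T \<omega>))"
      using \<phi> cong by (intro Q.integrable_const_bound[where B=1]) (auto split: split_indicator)
    have "(\<lambda>\<omega>. \<pi> (T \<omega>) * indicator B (T \<omega>)) \<in> borel_measurable (pspace s)" by measurable
    then have i2: "integrable ?Q (\<lambda>\<omega>. \<pi> (T \<omega>) * indicator B (T \<omega>))"
      using cong by (intro Bochner_Integration.integrable_bound[OF split(1)]) (auto split: split_indicator)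
    show "integrable ?Q (\<lambda>\<omega>. (\<pi> (T \<omega>) - \<phi> (T \<omega>)) * indicator B (T \<omega>))"
      using Bochner_Integration.integrable_diff[OF i2 i1] by (simp add: algebra_simps)
    let ?A = "{\<omega> \<in> space (pspace s). Y i j \<omega> = 1 \<and> T \<omega> \<in> B}"
    have A: "?A \<in> events" by measurable
    have "(\<integral>\<omega>. (\<pi> (T \<omega>) - \<phi> (T \<omega>)) * indicator B (T \<omega>) \<partial>?Q) = measure ?Q ?A - (\<integral>\<omega>. \<phi> (T \<omega>) * indicator B (T \<omega>) \<partial>?Q)"
      using split(2)[OF B] Bochner_Integration.integral_diff[OF i2 i1] by (simp add: algebra_simps)
    moreover have "\<bar>measure ?Q ?A - prob ?A\<bar> \<le> C * r"
      using close[of "indicator ?A"] A by (auto simp: Int_absorb2 split: split_indicator)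
    moreover have "\<bar>(\<integral>\<omega>. \<phi> (T \<omega>) * indicator B (T \<omega>) \<partial>?Q) - prob ?A\<bar> \<le> C * r"
      using close[OF m1] \<phi>_int[OF B] \<phi>(2,3) by (auto split: split_indicator)
    ultimately show "\<bar>(\<integral>\<omega>. (\<pi> (T \<omega>) - \<phi> (T \<omega>)) * indicator B (T \<omega>) \<partial>?Q)\<bar> \<le> 2 * (C * r)" by linarith
  qed
  \<comment> \<open>x is the sign of the difference, so one computation serves both
    directions.\<close>
  have half: "\<delta> * measure ?Q {\<omega> \<in> space (pspace s). T \<omega> \<in> B} \<le> 2 * (C * r)"
    if B [measurable]: "B \<in> sets borel" and x: "x = 1 \<or> x = -1" and ge: "\<And>t. t \<in> B \<Longrightarrow> \<delta> \<le> x * (\<pi> t - \<phi> t)" for B and x :: real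
  proof -
    have m: "(\<lambda>\<omega>. \<delta> * indicator B (T \<omega>) :: real) \<in> borel_measurable (pspace s)" by measurable
    have "\<delta> * measure ?Q {\<omega> \<in> space (pspace s). T \<omega> \<in> B} = (\<integral>\<omega>. \<delta> * indicator {\<omega> \<in> space (pspace s). T \<omega> \<in> B} \<omega> \<partial>?Q)"
      by (simp add: Int_absorb2)
    also have "\<dots> = (\<integral>\<omega>. \<delta> * indicator B (T \<omega>) \<partial>?Q)"
      by (intro Bochner_Integration.integral_cong refl) (auto split: split_indicator)
    also have "\<dots> \<le> (\<integral>\<omega>. x * ((\<pi> (T \<omega>) - \<phi> (T \<omega>)) * indicator B (T \<omega>)) \<partial>?Q)"
    proof (rule integral_mono)
      show "integrable ?Q (\<lambda>\<omega>. \<delta> * indicator B (T \<omega>) :: real)"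
        using m cong \<delta> by (intro Q.integrable_const_bound[where B=\<delta>]) (auto split: split_indicator)
      show "integrable ?Q (\<lambda>\<omega>. x * ((\<pi> (T \<omega>) - \<phi> (T \<omega>)) * indicator B (T \<omega>)))"
        using int[OF B] by (rule integrable_mult_right)
    qed (use ge in \<open>auto split: split_indicator\<close>)
    also have "\<dots> = x * (\<integral>\<omega>. (\<pi> (T \<omega>) - \<phi> (T \<omega>)) * indicator B (T \<omega>) \<partial>?Q)" by simp
    also have "\<dots> \<le> 2 * (C * r)" using diff[OF B] x by (auto simp: abs_le_iff)
    finally show ?thesis .
  qed
  let ?B1 = "{t. \<delta> < \<pi> t - \<phi> t}" and ?B2 = "{t. \<delta> < \<phi> t - \<pi> t}"
  have B: "?B1 \<in> sets borel" "?B2 \<in> sets borel" using \<pi> \<phi>(1) by measurable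
  have "measure ?Q {\<omega> \<in> space (pspace s). \<delta> < \<bar>\<pi> (T \<omega>) - \<phi> (T \<omega>)\<bar>} =
      measure ?Q ({\<omega> \<in> space (pspace s). T \<omega> \<in> ?B1} \<union> {\<omega> \<in> space (pspace s). T \<omega> \<in> ?B2})"
    by (intro arg_cong[where f="measure ?Q"]) auto
  also have "\<dots> \<le> measure ?Q {\<omega> \<in> space (pspace s). T \<omega> \<in> ?B1} + measure ?Q {\<omega> \<in> space (pspace s). T \<omega> \<in> ?B2}"
    by (intro measure_Un_le) (simp_all, measurable)
  also have "\<dots> \<le> 2 * (C * r) / \<delta> + 2 * (C * r) / \<delta>"
    using half[OF B(1), of 1] half[OF B(2), of "-1"] \<delta> by (intro add_mono) (auto simp: pos_le_divide_eq mult.commute)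
  finally show ?thesis by simp
qed

end

context model_array
begin

text \<open>
  The law of surrogate and response of a dyad is the same throughout the array, so the unconditional
  class probability is a fixed function of the surrogate, and so is its distance from 1/2.
\<close>

lemma no_fair_coin_uniform:
  assumes kl: "pair_seq k l"
    and h: "(\<lambda>((x, u, z), (x', u', z')). h x u z x' u' z') \<in> borel_measurable (node_space SX SZ \<Otimes>\<^sub>M node_space SX SZ)"
    and T: "\<And>n i j \<omega>. even n \<Longrightarrow> (i, j) \<in> dyads (D2 n) \<Longrightarrow> \<omega> \<in> space (pspace (smp n)) \<Longrightarrow>
          Ytil n i j \<omega> = h (Xcov (smp n) i \<omega>) (xi (smp n) i \<omega>) (zeta (smp n) i \<omega>)
                           (Xcov (smp n) j \<omega>) (xi (smp n) j \<omega>) (zeta (smp n) j \<omega>)"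
    and Y01: "discrete_response g smp" and fair: "no_fair_coin g smp Ytil" and \<pi>: "is_pi g w \<rho> smp Ytil pip"
    and e: "0 < e"
  shows "\<exists>\<delta>>0. \<forall>\<^sub>F n in even_top. {\<omega> \<in> space (pspace (smp n)). \<bar>pip n 1 (Ytil n (k n) (l n) \<omega>) - 1 / 2\<bar> \<le> \<delta>} \<in> sets (pspace (smp n)) \<and>
    measure (pspace (smp n)) {\<omega> \<in> space (pspace (smp n)). \<bar>pip n 1 (Ytil n (k n) (l n) \<omega>) - 1 / 2\<bar> \<le> \<delta>} < e"
proof -
  let ?\<Lambda> = "distr ((D \<Otimes>\<^sub>M D) \<Otimes>\<^sub>M V) (borel \<Otimes>\<^sub>M borel)
        (\<lambda>(((x, u, z), (x', u', z')), v). (h x u z x' u' z', g x z x' z' v))"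
  have g: "(\<lambda>(x, z, x', z', v). g x z x' z' v) \<in> borel_measurable (SX \<Otimes>\<^sub>M SZ \<Otimes>\<^sub>M SX \<Otimes>\<^sub>M SZ \<Otimes>\<^sub>M V)"
    using dyadic_model by (simp add: dyadic_model_def)
  have law: "(\<lambda>\<omega>. (Ytil n i j \<omega>, resp g (smp n) i j \<omega>)) \<in> pspace (smp n) \<rightarrow>\<^sub>M borel \<Otimes>\<^sub>M borel"
    "distr (pspace (smp n)) (borel \<Otimes>\<^sub>M borel) (\<lambda>\<omega>. (Ytil n i j \<omega>, resp g (smp n) i j \<omega>)) = ?\<Lambda>"
    if "even n" "(i, j) \<in> dyads (D2 n)" for n i j
    using sampled.surrogate_response_distr[OF sampled_smp subsetD[OF dyads_D2_subset that(2)] h g, of "Ytil n i j"] T[OF that]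
    by blast+
  have law_prob: "measure (pspace (smp n)) {\<omega> \<in> space (pspace (smp n)). Ytil n i j \<omega> \<in> B \<and> resp g (smp n) i j \<omega> \<in> B'} = measure ?\<Lambda> (B \<times> B')"
    if nij: "even n" "(i, j) \<in> dyads (D2 n)" and B: "B \<in> sets borel" "B' \<in> sets borel" for n i j B B'
  proof -
    have "measure ?\<Lambda> (B \<times> B') = measure (pspace (smp n)) ((\<lambda>\<omega>. (Ytil n i j \<omega>, resp g (smp n) i j \<omega>)) -` (B \<times> B') \<inter> space (pspace (smp n)))"
      using law(1)[OF nij] B unfolding law(2)[OF nij, symmetric] by (intro measure_distr) auto
    then show ?thesis by (auto intro: arg_cong[where f="measure (pspace (smp n))"])
  qed
  have Tm: "Ytil n i j \<in> borel_measurable (pspace (smp n))" and Ym: "resp g (smp n) i j \<in> borel_measurable (pspace (smp n))"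
    if "even n" "(i, j) \<in> dyads (D2 n)" for n i j
    using measurable_compose[OF law(1)[OF that] measurable_fst] measurable_compose[OF law(1)[OF that] measurable_snd] by simp_all
  \<comment> \<open>The smallest sample whose second half contains a dyad serves as reference;
    \<phi> is constructed there and transported to all other samples by equality of laws.\<close>
  have r: "even (4::nat)" "(3, 4) \<in> dyads (D2 4)" by (auto simp: dyads_def D2_def)
  interpret R: sampled SX SZ D V 4 "smp 4" by (rule sampled_smp)
  note Tr = Tm[OF r] and Yr = Ym[OF r]
  have "{\<omega> \<in> space (pspace (smp 4)). resp g (smp 4) 3 4 \<omega> = 1} \<in> R.events" using Yr by measurable
  from R.cond_prob_version[OF Tr this] obtain \<phi> :: "real \<Rightarrow> real" where
    \<phi>: "\<phi> \<in> borel_measurable borel" "\<And>t. 0 \<le> \<phi> t" "\<And>t. \<phi> t \<le> 1"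
    and ver: "AE \<omega> in pspace (smp 4). real_cond_exp (pspace (smp 4)) (vimage_algebra (space (pspace (smp 4))) (Ytil 4 3 4) borel)
      (indicator {\<omega> \<in> space (pspace (smp 4)). resp g (smp 4) 3 4 \<omega> = 1}) \<omega> = \<phi> (Ytil 4 3 4 \<omega>)"
    and \<phi>_int: "\<And>B. B \<in> sets borel \<Longrightarrow> (\<integral>\<omega>. \<phi> (Ytil 4 3 4 \<omega>) * indicator B (Ytil 4 3 4 \<omega>) \<partial>pspace (smp 4)) =
      R.prob {\<omega> \<in> space (pspace (smp 4)). \<omega> \<in> {\<omega> \<in> space (pspace (smp 4)). resp g (smp 4) 3 4 \<omega> = 1} \<and> Ytil 4 3 4 \<omega> \<in> B}"
    by blast
  have \<phi>\<Lambda>: "(\<integral>\<omega>. \<phi> (Ytil n i j \<omega>) * indicator B (Ytil n i j \<omega>) \<partial>pspace (smp n)) =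
      (\<integral>z. \<phi> (fst z) * indicator B (fst z) \<partial>?\<Lambda>)"
    if nij: "even n" "(i, j) \<in> dyads (D2 n)" and B: "B \<in> sets borel" for n i j B
  proof -
    have "(\<lambda>z. \<phi> (fst z) * indicator B (fst z)) \<in> borel_measurable (borel \<Otimes>\<^sub>M borel)"
      using \<phi>(1) B by measurable
    then show ?thesis unfolding law(2)[OF nij, symmetric] by (subst integral_distr[OF law(1)[OF nij]]) auto
  qed
  \<comment> \<open>Both sides are functionals of the common law of surrogate and response, so the
    identity for \<phi> in the reference sample holds for every dyad of every second half.\<close>
  have int: "(\<integral>\<omega>. \<phi> (Ytil n i j \<omega>) * indicator B (Ytil n i j \<omega>) \<partial>pspace (smp n)) =
      measure (pspace (smp n)) {\<omega> \<in> space (pspace (smp n)). resp g (smp n) i j \<omega> = 1 \<and> Ytil n i j \<omega> \<in> B}"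
    if nij: "even n" "(i, j) \<in> dyads (D2 n)" and B: "B \<in> sets borel" for n i j B
  proof -
    have "(\<integral>\<omega>. \<phi> (Ytil n i j \<omega>) * indicator B (Ytil n i j \<omega>) \<partial>pspace (smp n)) =
        R.prob {\<omega> \<in> space (pspace (smp 4)). \<omega> \<in> {\<omega> \<in> space (pspace (smp 4)). resp g (smp 4) 3 4 \<omega> = 1} \<and> Ytil 4 3 4 \<omega> \<in> B}"
      using \<phi>\<Lambda>[OF nij B] \<phi>\<Lambda>[OF r B] \<phi>_int[OF B] by simp
    also have "{\<omega> \<in> space (pspace (smp 4)). \<omega> \<in> {\<omega> \<in> space (pspace (smp 4)). resp g (smp 4) 3 4 \<omega> = 1} \<and> Ytil 4 3 4 \<omega> \<in> B} =
        {\<omega> \<in> space (pspace (smp 4)). Ytil 4 3 4 \<omega> \<in> B \<and> resp g (smp 4) 3 4 \<omega> \<in> {1}}" by auto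
    also have "R.prob \<dots> = measure (pspace (smp n)) {\<omega> \<in> space (pspace (smp n)). Ytil n i j \<omega> \<in> B \<and> resp g (smp n) i j \<omega> \<in> {1}}"
      using law_prob[OF r B, of "{1}"] law_prob[OF nij B, of "{1}"] by simp
    also have "{\<omega> \<in> space (pspace (smp n)). Ytil n i j \<omega> \<in> B \<and> resp g (smp n) i j \<omega> \<in> {1}} =
        {\<omega> \<in> space (pspace (smp n)). resp g (smp n) i j \<omega> = 1 \<and> Ytil n i j \<omega> \<in> B}" by auto
    finally show ?thesis .
  qed
  have "AE \<omega> in pspace (smp 4). real_cond_exp (pspace (smp 4)) (vimage_algebra (space (pspace (smp 4))) (Ytil 4 3 4) borel)
      (indicator {\<omega> \<in> space (pspace (smp 4)). resp g (smp 4) 3 4 \<omega> = 1}) \<omega> \<noteq> 1 / 2"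
    using fair r unfolding no_fair_coin_def by blast
  with ver have "AE \<omega> in pspace (smp 4). \<phi> (Ytil 4 3 4 \<omega>) \<noteq> 1 / 2" by eventually_elim simp
  moreover have "(\<lambda>\<omega>. \<phi> (Ytil 4 3 4 \<omega>)) \<in> borel_measurable (pspace (smp 4))" using \<phi>(1) Tr by measurable
  ultimately obtain d where d: "0 < d" "R.prob {\<omega> \<in> space (pspace (smp 4)). \<bar>\<phi> (Ytil 4 3 4 \<omega>) - 1 / 2\<bar> \<le> d} < e / 4"
    using R.small_near_level[of "\<lambda>\<omega>. \<phi> (Ytil 4 3 4 \<omega>)" "1 / 2" "e / 4"] e by auto
  let ?W = "{t. \<bar>\<phi> t - 1 / 2\<bar> \<le> d}"
  have W: "?W \<in> sets borel" using \<phi>(1) by measurable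
  have near: "measure (pspace (smp n)) {\<omega> \<in> space (pspace (smp n)). \<bar>\<phi> (Ytil n i j \<omega>) - 1 / 2\<bar> \<le> d} < e / 4"
    if nij: "even n" "(i, j) \<in> dyads (D2 n)" for n i j
    using law_prob[OF r W, of UNIV] law_prob[OF nij W, of UNIV] d(2) by simp
  \<comment> \<open>The target e is split into e/4 for the event that the dyad is observed, e/4 for
    the effect of missingness, by 8 * C * \<rho> / d < e/4, and e/2 for \<phi> near 1/2, whose bound
    e/4 at most doubles under conditioning on an event of probability above 1/2.\<close>
  have "0 < min (1 / 2) (min (e / 4) (e * d / 32))" using e d by simp
  from rho_small[OF this] eventually_model eventually_even_top[of 4]
  have "\<forall>\<^sub>F n in even_top. {\<omega> \<in> space (pspace (smp n)). \<bar>pip n 1 (Ytil n (k n) (l n) \<omega>) - 1 / 2\<bar> \<le> d / 2} \<in> sets (pspace (smp n)) \<and>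
    measure (pspace (smp n)) {\<omega> \<in> space (pspace (smp n)). \<bar>pip n 1 (Ytil n (k n) (l n) \<omega>) - 1 / 2\<bar> \<le> d / 2} < e"
  proof eventually_elim
    case (elim n)
    interpret model SX SZ D V n "smp n" g w "\<rho> n" c C by (rule elim)
    have n: "even n" using elim by simp
    have ij: "(k n, l n) \<in> dyads (D2 n)" using kl elim by (simp add: pair_seq_def)
    then have ij': "(k n, l n) \<in> dyads {1..n}" using dyads_D2_subset by blast
    have pm: "pip n 1 \<in> borel_measurable borel" using \<pi> n by (simp add: is_pi_def)
    have pv: "AE \<omega> in given_missing w (\<rho> n) (smp n) (k n) (l n). pip n 1 (Ytil n (k n) (l n) \<omega>) =
      cprob_missing w (\<rho> n) (smp n) (Ytil n (k n) (l n)) (k n) (l n) {\<omega> \<in> space (pspace (smp n)). Y (k n) (l n) \<omega> = 1} \<omega>"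
    proof -
      have "\<forall>(i, j)\<in>dyads (D2 n). AE \<omega> in given_missing w (\<rho> n) (smp n) i j. pip n 1 (Ytil n i j \<omega>) =
        cprob_missing w (\<rho> n) (smp n) (Ytil n i j) i j {\<omega> \<in> space (pspace (smp n)). resp g (smp n) i j \<omega> = 1} \<omega>"
        using \<pi> n by (simp add: is_pi_def)
      then show ?thesis using ij by auto
    qed
    have y01: "\<forall>\<omega>\<in>space (pspace (smp n)). Y (k n) (l n) \<omega> \<in> {0, 1}"
      using Y01 ij' unfolding discrete_response_def by blast
    note [measurable] = Tm[OF n ij] pm \<phi>(1)
    let ?Q = "given_missing w (\<rho> n) (smp n) (k n) (l n)"
    let ?T = "Ytil n (k n) (l n)"
    let ?M = "{\<omega> \<in> space (pspace (smp n)). obsv (k n) (l n) \<omega> = 0}"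
    let ?X = "{\<omega> \<in> space (pspace (smp n)). \<bar>pip n 1 (?T \<omega>) - 1 / 2\<bar> \<le> d / 2}"
    let ?Y1 = "{\<omega> \<in> space (pspace (smp n)). d / 2 < \<bar>pip n 1 (?T \<omega>) - \<phi> (?T \<omega>)\<bar>}"
    let ?Y2 = "{\<omega> \<in> space (pspace (smp n)). \<bar>\<phi> (?T \<omega>) - 1 / 2\<bar> \<le> d}"
    have Xm: "?X \<in> events" "?Y1 \<in> events" "?Y2 \<in> events" by measurable
    note M = given_missing_prob(1,2)[OF ij']
    have M0: "1 / 2 < prob ?M" "0 < prob ?M" using M(2) elim(1) by linarith+
    interpret Q: prob_space ?Q by (rule given_missing_prob(3)[OF ij'])
    have "prob ?X \<le> prob ((?M \<inter> ?X) \<union> (space (pspace (smp n)) - ?M))"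
      using M(1) Xm by (intro finite_measure_mono) auto
    also have "\<dots> \<le> prob (?M \<inter> ?X) + prob (space (pspace (smp n)) - ?M)" using M(1) Xm by (intro measure_Un_le) auto
    also have "prob (space (pspace (smp n)) - ?M) < e / 4" using prob_compl[OF M(1)] M(2) elim(1) by linarith
    also have "prob (?M \<inter> ?X) \<le> measure ?Q ?X"
      using conditioned_on_event(2)[OF M(1) M0(2) Xm(1)] M0(2) prob_le_1[of ?M]
      by (simp add: given_missing_def pos_le_divide_eq mult_left_le)
    \<comment> \<open>If the conditional class probability is within d/2 of 1/2, then either it
      differs from \<phi> by more than d/2 or \<phi> is within d of 1/2.\<close>
    also have "measure ?Q ?X \<le> measure ?Q (?Y1 \<union> ?Y2)"
      using Xm by (intro Q.finite_measure_mono) (auto simp: abs_if split: if_splits)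
    also have "\<dots> \<le> measure ?Q ?Y1 + measure ?Q ?Y2" using Xm by (intro measure_Un_le) auto
    also have "measure ?Q ?Y1 \<le> 4 * (C * \<rho> n) / (d / 2)"
      using d(1) by (intro missingness_effect[OF ij' Tm[OF n ij] y01 pm pv \<phi> int[OF n ij]]) auto
    also have "\<dots> < e / 4" using elim(1) d(1) by (simp add: field_simps)
    also have "measure ?Q ?Y2 \<le> prob ?Y2 / prob ?M"
      using conditioned_on_event(3)[OF M(1) M0(2) Xm(3)] by (simp add: given_missing_def)
    also have "\<dots> \<le> prob ?Y2 / (1 / 2)" using M0 by (intro divide_left_mono) auto
    also have "\<dots> < e / 2" using near[OF n ij] by simp
    finally show ?case using Xm(1) by simp
  qed
  then show ?thesis using d(1) by (intro exI[of _ "d / 2"]) auto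
qed

end

section \<open>Coverage of the discrete score\<close>

context model_array
begin

text \<open>The score never falls below 1 - \<alpha>, so at that threshold every observed dyad
  counts. Up to a negligible event, a test pair is then uncovered only if its score exceeds 1 -
  \<alpha>, that is, if its class has estimated probability less than both \<alpha> and 1/2.\<close>

theorem discrete_coverage:
  assumes kl: "pair_seq k l" and \<alpha>: "0 < \<alpha>" "\<alpha> < 1"
    and h: "(\<lambda>((x, u, z), (x', u', z')). h x u z x' u' z') \<in> borel_measurable (node_space SX SZ \<Otimes>\<^sub>M node_space SX SZ)"
    and Ytil: "\<And>n i j \<omega>. even n \<Longrightarrow> (i, j) \<in> dyads (D2 n) \<Longrightarrow> \<omega> \<in> space (pspace (smp n)) \<Longrightarrow>
          Ytil n i j \<omega> = h (Xcov (smp n) i \<omega>) (xi (smp n) i \<omega>) (zeta (smp n) i \<omega>)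
                           (Xcov (smp n) j \<omega>) (xi (smp n) j \<omega>) (zeta (smp n) j \<omega>)"
    and T: "\<And>n i j. i \<in> {1..n} \<Longrightarrow> j \<in> {1..n} \<Longrightarrow> Ytil n i j \<in> borel_measurable (pspace (smp n))"
    and T_src: "\<And>n i j A. even n \<Longrightarrow> (i, j) \<in> dyads (D2 n) \<Longrightarrow> dyad_sources i j \<subseteq> A \<Longrightarrow> Ytil n i j \<in> borel_measurable (src n A)"
    and Y01: "discrete_response g smp" and fair: "\<alpha> < 1 / 2 \<or> no_fair_coin g smp Ytil"
    and pi: "is_pi g w \<rho> smp Ytil pip"
    and ad: "adapted A G Yhat" and fit: "fitted_pi smp G pihat"
    and rate: "rate_ok A (\<lambda>n k l \<omega>. pihat n \<omega> 1 (Yhat n k l \<omega>)) (\<lambda>n k l \<omega>. pip n 1 (Ytil n k l \<omega>))"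
  shows "asymptotic_coverage \<alpha> (\<lambda>n. Ytil n (k n) (l n)) k l
    (coverage_event {0, 1} \<alpha> (\<lambda>n \<omega>. discrete_score \<alpha> (pihat n \<omega>)) Yhat k l)"
proof -
  let ?X1 = "\<lambda>n k l \<omega>. pihat n \<omega> 1 (Yhat n k l \<omega>)"
  let ?X2 = "\<lambda>n k l \<omega>. pip n 1 (Ytil n k l \<omega>)"
  let ?S = "\<lambda>n i j \<omega>. discrete_score \<alpha> (pihat n \<omega>) (resp g (smp n) i j \<omega>) (Yhat n i j \<omega>)"
  let ?E = "coverage_event {0, 1} \<alpha> (\<lambda>n \<omega>. discrete_score \<alpha> (pihat n \<omega>)) Yhat k l"
  let ?Q = "\<lambda>n. given_missing w (\<rho> n) (smp n) (k n) (l n)"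
  have y01: "\<forall>\<omega>\<in>space (pspace (smp n)). resp g (smp n) i j \<omega> \<in> {0, 1}" if "(i, j) \<in> dyads (D2 n)" for n i j
    using Y01 subsetD[OF dyads_D2_subset that] unfolding discrete_response_def by blast
  have pm: "pip n 1 \<in> borel_measurable borel" if "even n" for n using pi that by (simp add: is_pi_def)
  have meas_y: "\<forall>\<^sub>F n in even_top. \<forall>(i, j)\<in>dyads (D2 n). \<forall>y\<in>{0, 1}.
      (\<lambda>\<omega>. pihat n \<omega> y (Yhat n i j \<omega>)) \<in> borel_measurable (src n (A n i j))"
    using ad[unfolded adapted_def]
  proof eventually_elim
    case (elim n)
    show ?case
    proof (intro ballI, unfold split_paired_all prod.case, intro ballI)
      fix i j and y :: real assume ij: "(i, j) \<in> dyads (D2 n)" and y: "y \<in> {0, 1}"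
      have [measurable]: "(\<lambda>\<omega>. \<omega>) \<in> src n (A n i j) \<rightarrow>\<^sub>M G n" "Yhat n i j \<in> borel_measurable (src n (A n i j))"
        using elim ij by blast+
      have [measurable]: "(\<lambda>(\<omega>, u). pihat n \<omega> y u) \<in> borel_measurable (G n \<Otimes>\<^sub>M borel)"
        using fit y unfolding fitted_pi_def by blast
      have "(\<lambda>\<omega>. (\<lambda>(\<omega>, u). pihat n \<omega> y u) (\<omega>, Yhat n i j \<omega>)) \<in> borel_measurable (src n (A n i j))" by measurable
      then show "(\<lambda>\<omega>. pihat n \<omega> y (Yhat n i j \<omega>)) \<in> borel_measurable (src n (A n i j))" by simp
    qed
  qed
  have meas: "\<forall>\<^sub>F n in even_top. \<forall>(i, j)\<in>dyads (D2 n). A n i j \<subseteq> sources n \<and>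
      ?X1 n i j \<in> borel_measurable (src n (A n i j)) \<and> ?X2 n i j \<in> borel_measurable (src n (A n i j))"
    using ad[unfolded adapted_def] meas_y eventually_even_top[of 4]
  proof eventually_elim
    case (elim n)
    show ?case
    proof (intro ballI, unfold split_paired_all prod.case, intro conjI)
      fix i j assume ij: "(i, j) \<in> dyads (D2 n)"
      show "A n i j \<subseteq> sources n" using elim(1) ij by blast
      show "?X1 n i j \<in> borel_measurable (src n (A n i j))" using elim(2) ij by blast
      have "dyad_sources i j \<subseteq> A n i j" using elim(1) ij by blast
      from measurable_compose[OF T_src[OF _ ij this] pm] elim(3)
      show "?X2 n i j \<in> borel_measurable (src n (A n i j))" by simp
    qed
  qed
  have Sm: "\<forall>\<^sub>F n in even_top. \<forall>(i, j)\<in>dyads (D2 n). ?S n i j \<in> borel_measurable (pspace (smp n))"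
    using meas_y meas eventually_model
  proof eventually_elim
    case (elim n)
    interpret model SX SZ D V n "smp n" g w "\<rho> n" c C by (rule elim)
    show ?case
    proof (intro ballI, unfold split_paired_all prod.case)
      fix i j assume ij: "(i, j) \<in> dyads (D2 n)"
      have "A n i j \<subseteq> sources n" using elim(2) ij by blast
      then have [measurable]: "(\<lambda>\<omega>. pihat n \<omega> y (Yhat n i j \<omega>)) \<in> borel_measurable (pspace (smp n))" if "y \<in> {0, 1}" for y
        using elim(1) ij that by (blast intro: src_alg_measurable)
      note [measurable] = resp_measurable[OF subsetD[OF dyads_D2_subset ij]]
      have s: "(\<lambda>\<omega>. discrete_score \<alpha> (pihat n \<omega>) y (Yhat n i j \<omega>)) \<in> borel_measurable (pspace (smp n))" if "y \<in> {0, 1}" for y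
        unfolding discrete_score_def using that by measurable
      have [measurable]: "(\<lambda>\<omega>. discrete_score \<alpha> (pihat n \<omega>) 0 (Yhat n i j \<omega>)) \<in> borel_measurable (pspace (smp n))"
        "(\<lambda>\<omega>. discrete_score \<alpha> (pihat n \<omega>) 1 (Yhat n i j \<omega>)) \<in> borel_measurable (pspace (smp n))"
        using s by simp_all
      \<comment> \<open>\<open>pihat\<close> is measurable for each of the two classes separately,
        so the score at the random class is written as a case distinction.\<close>
      have "(\<lambda>\<omega>. if Y i j \<omega> = 1 then discrete_score \<alpha> (pihat n \<omega>) 1 (Yhat n i j \<omega>)
          else discrete_score \<alpha> (pihat n \<omega>) 0 (Yhat n i j \<omega>)) \<in> borel_measurable (pspace (smp n))" by measurable
      moreover have "?S n i j \<omega> = (if Y i j \<omega> = 1 then discrete_score \<alpha> (pihat n \<omega>) 1 (Yhat n i j \<omega>)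
          else discrete_score \<alpha> (pihat n \<omega>) 0 (Yhat n i j \<omega>))" if "\<omega> \<in> space (pspace (smp n))" for \<omega>
        using y01[OF ij] that by auto
      ultimately show "?S n i j \<in> borel_measurable (pspace (smp n))" by (subst measurable_cong)
    qed
  qed
  define miss where "miss n = {\<omega> \<in> space (pspace (smp n)). ?S n (k n) (l n) \<omega> \<le> 1 - \<alpha> \<and>
      Pi_weighted n (\<lambda>i j. obs w (\<rho> n) (smp n) i j \<omega>) (\<lambda>i j. phat n i j \<omega>) (\<lambda>i j. ?S n i j \<omega>) (k n) (l n) \<le> \<alpha>}" for n
  have miss: "vanishing smp miss"
    unfolding miss_def
  \<comment> \<open>\<open>B\<close> is everything and \<open>Bad\<close> is empty. The oracle count
    has mean P(M = 0) per dyad, which tends to 1; the midpoint (1 + \<alpha>) / 2 separates it from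
    \<alpha>.\<close>
  proof (rule vanishing_miss[OF kl, where \<beta>="(1 + \<alpha>) / 2" and B="\<lambda>n _. space (pspace (smp n))" and Bad="\<lambda>_ _. {}"])
    show "0 \<le> \<alpha>" "\<alpha> < (1 + \<alpha>) / 2" using \<alpha> by auto
    have "0 < (1 - \<alpha>) / 2" using \<alpha> by simp
    from eventually_model rho_small[OF this]
    show "\<forall>\<^sub>F n in even_top. \<forall>(i, j)\<in>dyads (D2 n). space (pspace (smp n)) \<in> sets (src n (dyad_sources i j)) \<and>
        (1 + \<alpha>) / 2 \<le> measure (pspace (smp n)) {\<omega> \<in> space (pspace (smp n)). obs w (\<rho> n) (smp n) i j \<omega> = 0}"
    proof eventually_elim
      case (elim n)
      interpret model SX SZ D V n "smp n" g w "\<rho> n" c C by (rule elim)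
      show ?case
      proof (intro ballI, unfold split_paired_all prod.case, intro conjI)
        fix i j assume ij: "(i, j) \<in> dyads (D2 n)"
        show "space (pspace (smp n)) \<in> sets (src_alg (dyad_sources i j))"
          using sets.top[of "src_alg (dyad_sources i j)"] by simp
        have "1 - C * \<rho> n \<le> prob {\<omega> \<in> space (pspace (smp n)). obsv i j \<omega> = 0}"
          using dyads_D2_subset ij by (intro given_missing_prob(2)) blast
        then show "(1 + \<alpha>) / 2 \<le> prob {\<omega> \<in> space (pspace (smp n)). obsv i j \<omega> = 0}"
          using elim(2) by (simp add: field_simps)
      qed
    qed
  next
    fix b :: real assume "0 < b"
    then show "\<forall>\<^sub>F n in even_top. \<forall>(i, j)\<in>dyads (D2 n). {} \<in> sets (pspace (smp n)) \<and>
        measure (pspace (smp n)) {\<omega> \<in> {}. obs w (\<rho> n) (smp n) i j \<omega> = 1} \<le> \<rho> n * b"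
      using rho_pos by (intro always_eventually) (auto intro: less_imp_le)
  qed (simp add: discrete_score_def)
  define Bad where "Bad \<delta> n = {\<omega> \<in> space (pspace (smp n)). \<bar>?X1 n (k n) (l n) \<omega> - ?X2 n (k n) (l n) \<omega>\<bar> > \<delta>}" for \<delta> n
  have Bad: "vanishing smp (Bad \<delta>)" if "0 < \<delta>" for \<delta>
    using estimation_error_small(2)[OF rate meas that kl] by (simp add: Bad_def[abs_def])
  define Gb where "Gb \<tau> n = {\<omega> \<in> space (pspace (smp n)).
    resp g (smp n) (k n) (l n) \<omega> = 1 \<and> ?X2 n (k n) (l n) \<omega> < \<tau> \<or>
    resp g (smp n) (k n) (l n) \<omega> = 0 \<and> 1 - ?X2 n (k n) (l n) \<omega> < \<tau>}" for \<tau> n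
  have Gb: "\<forall>\<^sub>F n in even_top. Gb \<tau> n \<in> sets (pspace (smp n)) \<and>
      (\<forall>B\<in>sets borel. measure (?Q n) {\<omega> \<in> space (pspace (smp n)). \<omega> \<in> Gb \<tau> n \<and> Ytil n (k n) (l n) \<omega> \<in> B}
        \<le> \<tau> * measure (?Q n) {\<omega> \<in> space (pspace (smp n)). Ytil n (k n) (l n) \<omega> \<in> B})"
    if \<tau>: "0 \<le> \<tau>" "\<tau> \<le> 1 / 2" for \<tau>
    using eventually_model eventually_even_top[of 4]
  proof eventually_elim
    case (elim n)
    interpret model SX SZ D V n "smp n" g w "\<rho> n" c C by (rule elim)
    have n: "even n" using elim by simp
    have ij: "(k n, l n) \<in> dyads (D2 n)" using kl elim by (simp add: pair_seq_def)
    then have ij': "(k n, l n) \<in> dyads {1..n}" using dyads_D2_subset by blast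
    have Tm: "Ytil n (k n) (l n) \<in> borel_measurable (pspace (smp n))" using T dyadsD[OF ij'] by blast
    note [measurable] = Tm resp_measurable[OF ij'] pm[OF n]
    have version: "AE \<omega> in ?Q n. ?X2 n (k n) (l n) \<omega> =
      cprob_missing w (\<rho> n) (smp n) (Ytil n (k n) (l n)) (k n) (l n) {\<omega> \<in> space (pspace (smp n)). Y (k n) (l n) \<omega> = 1} \<omega>"
    proof -
      have "\<forall>(i, j)\<in>dyads (D2 n). AE \<omega> in given_missing w (\<rho> n) (smp n) i j. pip n 1 (Ytil n i j \<omega>) =
        cprob_missing w (\<rho> n) (smp n) (Ytil n i j) i j {\<omega> \<in> space (pspace (smp n)). resp g (smp n) i j \<omega> = 1} \<omega>"
        using pi n by (simp add: is_pi_def)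
      then show ?thesis using ij by auto
    qed
    show ?case
    proof (intro conjI ballI)
      show "Gb \<tau> n \<in> events" unfolding Gb_def by measurable
      fix B :: "real set" assume B: "B \<in> sets borel"
      have "{\<omega> \<in> space (pspace (smp n)). \<omega> \<in> Gb \<tau> n \<and> Ytil n (k n) (l n) \<omega> \<in> B} = {\<omega> \<in> space (pspace (smp n)).
          (Y (k n) (l n) \<omega> = 1 \<and> ?X2 n (k n) (l n) \<omega> < \<tau> \<or> Y (k n) (l n) \<omega> = 0 \<and> 1 - ?X2 n (k n) (l n) \<omega> < \<tau>) \<and>
          Ytil n (k n) (l n) \<omega> \<in> B}" by (auto simp: Gb_def)
      then show "measure (?Q n) {\<omega> \<in> space (pspace (smp n)). \<omega> \<in> Gb \<tau> n \<and> Ytil n (k n) (l n) \<omega> \<in> B}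
        \<le> \<tau> * measure (?Q n) {\<omega> \<in> space (pspace (smp n)). Ytil n (k n) (l n) \<omega> \<in> B}"
        using prob_discrete_split(3)[OF ij' Tm y01[OF ij] pm[OF n] version \<tau> B] by simp
    qed
  qed
  \<comment> \<open>A score above 1 - \<alpha> excludes the branch with value 0, so the class has
    estimated probability less than 1/2, and also less than \<alpha>. Class 0 is expressed through
    class 1 because the two estimates sum to 1.\<close>
  have high: "(y = 1 \<and> ?X1 n (k n) (l n) \<omega> < min \<alpha> (1 / 2)) \<or> (y = 0 \<and> 1 - ?X1 n (k n) (l n) \<omega> < min \<alpha> (1 / 2))"
    if n: "even n" "4 \<le> n" and \<omega>: "\<omega> \<in> space (pspace (smp n))" and y: "y = resp g (smp n) (k n) (l n) \<omega>"
      and S: "1 - \<alpha> < ?S n (k n) (l n) \<omega>" for n \<omega> y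
  proof -
    have ij: "(k n, l n) \<in> dyads (D2 n)" using kl n by (simp add: pair_seq_def)
    have sum1: "pihat n \<omega> 0 (Yhat n (k n) (l n) \<omega>) = 1 - ?X1 n (k n) (l n) \<omega>"
      using fit \<omega> unfolding fitted_pi_def by (metis add_diff_cancel_right')
    have "y = 0 \<or> y = 1" using y01[OF ij] \<omega> y by auto
    then show ?thesis
      using S \<alpha> unfolding y[symmetric] discrete_score_def
      by (elim disjE) (auto simp: sum1 max_absorb2 split: if_splits)
  qed
  have uncovered: "\<omega> \<in> miss n \<or> 1 - \<alpha> < ?S n (k n) (l n) \<omega>"
    if n: "even n" "4 \<le> n" and \<omega>: "\<omega> \<in> space (pspace (smp n))" "\<omega> \<notin> ?E n" for n \<omega>
  proof -
    have ij: "(k n, l n) \<in> dyads (D2 n)" using kl n by (simp add: pair_seq_def)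
    have "\<omega> \<notin> {\<omega> \<in> space (pspace (smp n)). \<alpha> < Pi_weighted n (\<lambda>i j. obs w (\<rho> n) (smp n) i j \<omega>) (\<lambda>i j. phat n i j \<omega>)
      (\<lambda>i j. ?S n i j \<omega>) (k n) (l n)}"
      using \<omega>(2) y01[OF ij] by (subst (asm) coverage_event_eq) blast+
    then show ?thesis using \<omega>(1) by (auto simp: miss_def)
  qed
  show ?thesis
    unfolding asymptotic_coverage_def
  proof (rule coverage[OF kl \<alpha>(2)])
    show "Ytil n (k n) (l n) \<in> borel_measurable (pspace (smp n))" if "even n" "4 \<le> n" for n
      using kl that by (intro T) (auto simp: pair_seq_def dyads_def D2_def)
    have "\<forall>\<^sub>F n in even_top. \<forall>\<omega>\<in>space (pspace (smp n)). resp g (smp n) (k n) (l n) \<omega> \<in> {0, 1}"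
      using eventually_even_top[of 4] by eventually_elim (use kl y01 in \<open>simp add: pair_seq_def\<close>)
    then show "\<forall>\<^sub>F n in even_top. ?E n \<in> sets (pspace (smp n))"
      using Sm by (rule coverage_event_measurable[OF kl])
    fix \<epsilon> :: real assume \<epsilon>: "0 < \<epsilon>" "\<epsilon> < 1 - \<alpha>"
    \<comment> \<open>The passage from estimated to true class probability. For \<alpha> < 1/2 the
      level can be raised to \<alpha> + \<delta> \<le> 1/2, which absorbs an error of size \<delta>.
      For \<alpha> \<ge> 1/2 the level is 1/2 and cannot be raised, since the split into classes
      requires \<tau> \<le> 1/2; there true probabilities close to 1/2 are excluded by the
      hypothesis on fair coins.\<close>
    have "\<exists>\<tau> H. 0 \<le> \<tau> \<and> \<tau> \<le> 1 / 2 \<and> \<tau> \<le> \<alpha> + \<epsilon> \<and> vanishing smp H \<and>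
        (\<forall>\<^sub>F n in even_top. \<forall>\<omega>\<in>space (pspace (smp n)). 1 - \<alpha> < ?S n (k n) (l n) \<omega> \<longrightarrow> \<omega> \<in> Gb \<tau> n \<union> H n)"
    proof (cases "\<alpha> < 1 / 2")
      case True
      define \<delta> where "\<delta> = min \<epsilon> (1 / 2 - \<alpha>)"
      have \<delta>: "0 < \<delta>" "\<alpha> + \<delta> \<le> 1 / 2" "\<delta> \<le> \<epsilon>" using True \<epsilon> by (auto simp: \<delta>_def min_def)
      have "\<forall>\<^sub>F n in even_top. \<forall>\<omega>\<in>space (pspace (smp n)). 1 - \<alpha> < ?S n (k n) (l n) \<omega> \<longrightarrow> \<omega> \<in> Gb (\<alpha> + \<delta>) n \<union> Bad \<delta> n"
        using eventually_even_top[of 4]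
      proof eventually_elim
        case (elim n)
        show ?case
        proof (intro ballI impI)
          fix \<omega> assume \<omega>: "\<omega> \<in> space (pspace (smp n))" "1 - \<alpha> < ?S n (k n) (l n) \<omega>"
          have n: "even n" "4 \<le> n" using elim by blast+
          show "\<omega> \<in> Gb (\<alpha> + \<delta>) n \<union> Bad \<delta> n"
            using high[OF n \<omega>(1) refl \<omega>(2)]
          proof (elim disjE conjE)
            assume "resp g (smp n) (k n) (l n) \<omega> = 1" "?X1 n (k n) (l n) \<omega> < min \<alpha> (1 / 2)"
            moreover have "?X2 n (k n) (l n) \<omega> < \<alpha> + \<delta> \<or> \<delta> < \<bar>?X1 n (k n) (l n) \<omega> - ?X2 n (k n) (l n) \<omega>\<bar>"
              using calculation(2) unfolding min_less_iff_conj by linarith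
            ultimately show ?thesis using \<omega>(1) by (auto simp: Gb_def Bad_def)
          next
            assume "resp g (smp n) (k n) (l n) \<omega> = 0" "1 - ?X1 n (k n) (l n) \<omega> < min \<alpha> (1 / 2)"
            moreover have "1 - ?X2 n (k n) (l n) \<omega> < \<alpha> + \<delta> \<or> \<delta> < \<bar>?X1 n (k n) (l n) \<omega> - ?X2 n (k n) (l n) \<omega>\<bar>"
              using calculation(2) unfolding min_less_iff_conj by linarith
            ultimately show ?thesis using \<omega>(1) by (auto simp: Gb_def Bad_def)
          qed
        qed
      qed
      then show ?thesis using Bad[OF \<delta>(1)] \<delta> \<alpha> by (intro exI[of _ "\<alpha> + \<delta>"] exI[of _ "Bad \<delta>"]) auto
    next
      case False
      then have nf: "no_fair_coin g smp Ytil" using fair by simp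
      define H where "H n = {\<omega> \<in> space (pspace (smp n)). 1 - \<alpha> < ?S n (k n) (l n) \<omega> \<and> \<omega> \<notin> Gb (1 / 2) n}" for n
      have "vanishing smp H"
      proof (rule vanishingI)
        fix e :: real assume e: "0 < e"
        then have e2: "0 < e / 2" by simp
        obtain \<delta> where \<delta>: "0 < \<delta>" and near: "\<forall>\<^sub>F n in even_top.
            {\<omega> \<in> space (pspace (smp n)). \<bar>?X2 n (k n) (l n) \<omega> - 1 / 2\<bar> \<le> \<delta>} \<in> sets (pspace (smp n)) \<and>
            measure (pspace (smp n)) {\<omega> \<in> space (pspace (smp n)). \<bar>?X2 n (k n) (l n) \<omega> - 1 / 2\<bar> \<le> \<delta>} < e / 2"
          using no_fair_coin_uniform[OF kl h Ytil Y01 nf pi e2] by blast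
        have "\<forall>\<^sub>F n in even_top. \<exists>A\<in>sets (pspace (smp n)). Bad \<delta> n \<subseteq> A \<and> measure (pspace (smp n)) A < e / 2"
          using Bad[OF \<delta>] e2 unfolding vanishing_def by blast
        with near eventually_even_top[of 4]
        show "\<forall>\<^sub>F n in even_top. \<exists>A\<in>sets (pspace (smp n)). H n \<subseteq> A \<and> measure (pspace (smp n)) A < e"
        proof eventually_elim
          case (elim n)
          let ?N = "{\<omega> \<in> space (pspace (smp n)). \<bar>?X2 n (k n) (l n) \<omega> - 1 / 2\<bar> \<le> \<delta>}"
          obtain A' where A': "A' \<in> sets (pspace (smp n))" "Bad \<delta> n \<subseteq> A'" "measure (pspace (smp n)) A' < e / 2"
            using elim by blast
          have "H n \<subseteq> Bad \<delta> n \<union> ?N"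
          proof
            fix \<omega> assume \<omega>: "\<omega> \<in> H n"
            then have sp: "\<omega> \<in> space (pspace (smp n))" "1 - \<alpha> < ?S n (k n) (l n) \<omega>" "\<omega> \<notin> Gb (1 / 2) n"
              by (simp_all add: H_def)
            \<comment> \<open>x is the estimate and q the true value; if 1/2 separates them, the
              distance of q from 1/2 is at most |x - q|.\<close>
            have close: "\<delta> < \<bar>x - q\<bar> \<or> \<bar>q - 1 / 2\<bar> \<le> \<delta>"
              if "x < 1 / 2 \<and> \<not> q < 1 / 2 \<or> 1 - x < 1 / 2 \<and> \<not> 1 - q < 1 / 2" for x q :: real
              using that by linarith
            have n: "even n" "4 \<le> n" using elim by blast+
            have "\<delta> < \<bar>?X1 n (k n) (l n) \<omega> - ?X2 n (k n) (l n) \<omega>\<bar> \<or> \<bar>?X2 n (k n) (l n) \<omega> - 1 / 2\<bar> \<le> \<delta>"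
              using high[OF n sp(1) refl sp(2)] sp(1,3) by (intro close) (auto simp only: Gb_def mem_Collect_eq min_less_iff_conj)
            then show "\<omega> \<in> Bad \<delta> n \<union> ?N" using sp(1) by (simp add: Bad_def)
          qed
          then have "H n \<subseteq> A' \<union> ?N" using A'(2) by blast
          moreover have "measure (pspace (smp n)) (A' \<union> ?N) \<le> measure (pspace (smp n)) A' + measure (pspace (smp n)) ?N"
            using A'(1) elim by (intro measure_Un_le) auto
          then have "measure (pspace (smp n)) (A' \<union> ?N) < e" using A'(3) elim by linarith
          moreover have "A' \<union> ?N \<in> sets (pspace (smp n))" using A'(1) elim by (intro sets.Un) auto
          ultimately show ?case by blast
        qed
      qed
      then show ?thesis using False \<epsilon> by (intro exI[of _ "1 / 2"] exI[of _ H]) (auto simp: H_def)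
    qed
    then obtain \<tau> H where \<tau>: "0 \<le> \<tau>" "\<tau> \<le> 1 / 2" "\<tau> \<le> \<alpha> + \<epsilon>" and H: "vanishing smp H"
      and GH: "\<forall>\<^sub>F n in even_top. \<forall>\<omega>\<in>space (pspace (smp n)). 1 - \<alpha> < ?S n (k n) (l n) \<omega> \<longrightarrow> \<omega> \<in> Gb \<tau> n \<union> H n"
      by blast
    show "\<exists>G H. vanishing smp H \<and> (\<forall>\<^sub>F n in even_top.
        G n \<in> sets (pspace (smp n)) \<and>
        {\<omega> \<in> space (pspace (smp n)). obs w (\<rho> n) (smp n) (k n) (l n) \<omega> = 0} - ?E n \<subseteq> G n \<union> H n \<and>
        (\<forall>C\<in>sets borel. measure (?Q n) {\<omega> \<in> space (pspace (smp n)). \<omega> \<in> G n \<and> Ytil n (k n) (l n) \<omega> \<in> C}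
          \<le> (\<alpha> + \<epsilon>) * measure (?Q n) {\<omega> \<in> space (pspace (smp n)). Ytil n (k n) (l n) \<omega> \<in> C}))"
    proof (intro exI conjI, rule vanishing_Un[OF miss H])
      from Gb[OF \<tau>(1,2)] GH eventually_even_top[of 4]
      show "\<forall>\<^sub>F n in even_top. Gb \<tau> n \<in> sets (pspace (smp n)) \<and>
        {\<omega> \<in> space (pspace (smp n)). obs w (\<rho> n) (smp n) (k n) (l n) \<omega> = 0} - ?E n \<subseteq> Gb \<tau> n \<union> (miss n \<union> H n) \<and>
        (\<forall>C\<in>sets borel. measure (?Q n) {\<omega> \<in> space (pspace (smp n)). \<omega> \<in> Gb \<tau> n \<and> Ytil n (k n) (l n) \<omega> \<in> C}
          \<le> (\<alpha> + \<epsilon>) * measure (?Q n) {\<omega> \<in> space (pspace (smp n)). Ytil n (k n) (l n) \<omega> \<in> C})"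
      proof eventually_elim
        case (elim n)
        show ?case
        proof (intro conjI ballI)
          show "Gb \<tau> n \<in> sets (pspace (smp n))" using elim(1) by blast
          show "{\<omega> \<in> space (pspace (smp n)). obs w (\<rho> n) (smp n) (k n) (l n) \<omega> = 0} - ?E n \<subseteq> Gb \<tau> n \<union> (miss n \<union> H n)"
            using uncovered[of n] elim(2,3) by blast
          fix B :: "real set" assume "B \<in> sets borel"
          then have "measure (?Q n) {\<omega> \<in> space (pspace (smp n)). \<omega> \<in> Gb \<tau> n \<and> Ytil n (k n) (l n) \<omega> \<in> B}
            \<le> \<tau> * measure (?Q n) {\<omega> \<in> space (pspace (smp n)). Ytil n (k n) (l n) \<omega> \<in> B}" using elim(1) by blast
          also have "\<dots> \<le> (\<alpha> + \<epsilon>) * measure (?Q n) {\<omega> \<in> space (pspace (smp n)). Ytil n (k n) (l n) \<omega> \<in> B}"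
            using \<tau>(3) by (intro mult_right_mono) auto
          finally show "measure (?Q n) {\<omega> \<in> space (pspace (smp n)). \<omega> \<in> Gb \<tau> n \<and> Ytil n (k n) (l n) \<omega> \<in> B}
            \<le> (\<alpha> + \<epsilon>) * measure (?Q n) {\<omega> \<in> space (pspace (smp n)). Ytil n (k n) (l n) \<omega> \<in> B}" .
        qed
      qed
    qed
  qed
qed

end

section \<open>The four settings\<close>

theorem theorem6p2:
  fixes smp :: "nat \<Rightarrow> ('a, 'x, 'z, 'v) sample"
    and SX :: "'x measure" and SZ :: "'z measure"
    and D :: "('x \<times> real \<times> 'z) measure" and V :: "'v measure"
    and SE :: "'e measure" and SC :: "'c measure"
    and g :: "'x \<Rightarrow> 'z \<Rightarrow> 'x \<Rightarrow> 'z \<Rightarrow> 'v \<Rightarrow> real"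
    and w :: "real \<Rightarrow> real \<Rightarrow> real"
    and \<rho> :: "nat \<Rightarrow> real"
    and \<alpha> :: real
    and phat :: "nat \<Rightarrow> nat \<Rightarrow> nat \<Rightarrow> 'a \<Rightarrow> real"
    and ecov :: "'x \<Rightarrow> 'x \<Rightarrow> 'e"
    and zst :: "nat \<Rightarrow> (nat \<times> nat \<Rightarrow> 'x \<times> 'x \<times> 'e \<times> real) \<Rightarrow> nat \<times> nat \<Rightarrow> 'c"
    and Yhat Ytil :: "nat \<Rightarrow> nat \<Rightarrow> nat \<Rightarrow> 'a \<Rightarrow> real"
    and h :: "'x \<Rightarrow> real \<Rightarrow> 'z \<Rightarrow> 'x \<Rightarrow> real \<Rightarrow> 'z \<Rightarrow> real"
    and pip :: "nat \<Rightarrow> real \<Rightarrow> real \<Rightarrow> real"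
    and pihat :: "nat \<Rightarrow> 'a \<Rightarrow> real \<Rightarrow> real \<Rightarrow> real"
    and F :: "nat \<Rightarrow> real \<Rightarrow> real \<Rightarrow> real"
    and Fhat :: "nat \<Rightarrow> 'a \<Rightarrow> real \<Rightarrow> real \<Rightarrow> real"
    and score :: "nat \<Rightarrow> 'a \<Rightarrow> real \<Rightarrow> real \<Rightarrow> real"
    and ys :: "real set"
    and k l :: "nat \<Rightarrow> nat"
  defines "Z \<equiv> network_covariates ecov w \<rho> smp zst"
    and "plain \<equiv> (\<lambda>n. training_plain SX g w (\<rho> n) n (smp n))"
    and "network \<equiv> (\<lambda>n. training_network SX SC g w (\<rho> n) n (smp n)
                      (network_covariates ecov w \<rho> smp zst n))"
  assumes model: "dyadic_model SX SZ D V g w \<rho> smp"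
    and alpha: "0 < \<alpha>" "\<alpha> < 1"
    and phat_measurable:
      "\<And>n i j. i \<in> {1..n} \<Longrightarrow> j \<in> {1..n} \<Longrightarrow> phat n i j \<in> borel_measurable (pspace (smp n))"
    and a: "\<exists>c>0. (\<forall>u\<in>{0..1}. \<forall>v\<in>{0..1}. w u v \<ge> c) \<and>
              (\<forall>n. \<forall>i\<in>{1..n}. \<forall>j\<in>{1..n}. AE \<omega> in pspace (smp n). phat n i j \<omega> / \<rho> n \<ge> c)"
    and b: "filterlim (\<lambda>n. \<rho> n / (sqrt (ln (real n)) / real n)) at_top even_top"
    and c: "((\<lambda>n. (\<integral>\<^sup>+\<omega>. ennreal ((frobenius_norm n
                      (\<lambda>i j. phat n i j \<omega> - pmat w (\<rho> n) (smp n) i j \<omega>))\<^sup>2) \<partial>pspace (smp n))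
                  / ennreal ((real n)\<^sup>2 * \<rho> n ^ 3)) \<longlongrightarrow> 0) even_top"
    and Yhat_Ytil: "\<And>k l \<epsilon>. pair_seq k l \<Longrightarrow> \<epsilon> > 0 \<Longrightarrow>
          ((\<lambda>n. measure (pspace (smp n)) {\<omega> \<in> space (pspace (smp n)).
                   \<bar>Yhat n (k n) (l n) \<omega> - Ytil n (k n) (l n) \<omega>\<bar> > \<epsilon>}) \<longlongrightarrow> 0) even_top"
    and Ytil_measurable:
      "\<And>n i j. i \<in> {1..n} \<Longrightarrow> j \<in> {1..n} \<Longrightarrow> Ytil n i j \<in> borel_measurable (pspace (smp n))"
    and h_measurable: "(\<lambda>((x, u, z), (x', u', z')). h x u z x' u' z')
          \<in> borel_measurable (node_space SX SZ \<Otimes>\<^sub>M node_space SX SZ)"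
    and Ytil: "\<And>n i j \<omega>. even n \<Longrightarrow> (i, j) \<in> dyads (D2 n) \<Longrightarrow> \<omega> \<in> space (pspace (smp n)) \<Longrightarrow>
          Ytil n i j \<omega> = h (Xcov (smp n) i \<omega>) (xi (smp n) i \<omega>) (zeta (smp n) i \<omega>)
                           (Xcov (smp n) j \<omega>) (xi (smp n) j \<omega>) (zeta (smp n) j \<omega>)"
    and cases:
      \<comment> \<open>discrete response, without network covariates\<close>
      "(discrete_response g smp \<and> (\<alpha> < 1 / 2 \<or> no_fair_coin g smp Ytil) \<and>
        is_pi g w \<rho> smp Ytil pip \<and>
        predicts_without_network SX g w \<rho> smp Yhat \<and> fitted_pi smp plain pihat \<and>
        mean_dist_smallo smp (\<lambda>n k l \<omega>. pihat n \<omega> 1 (Yhat n k l \<omega>))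
                             (\<lambda>n k l \<omega>. pip n 1 (Ytil n k l \<omega>)) (\<lambda>_. 1) \<and>
        ys = {0, 1} \<and> score = (\<lambda>n \<omega>. discrete_score \<alpha> (pihat n \<omega>)))
       \<or>
       \<comment> \<open>discrete response, with network covariates\<close>
       (discrete_response g smp \<and> (\<alpha> < 1 / 2 \<or> no_fair_coin g smp Ytil) \<and>
        is_pi g w \<rho> smp Ytil pip \<and>
        network_statistic SX SE SC ecov w \<rho> smp zst \<and>
        predicts_with_network SX SC g w \<rho> smp Z Yhat \<and> fitted_pi smp network pihat \<and>
        mean_dist_smallo smp (\<lambda>n k l \<omega>. pihat n \<omega> 1 (Yhat n k l \<omega>))
                             (\<lambda>n k l \<omega>. pip n 1 (Ytil n k l \<omega>)) \<rho> \<and>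
        ys = {0, 1} \<and> score = (\<lambda>n \<omega>. discrete_score \<alpha> (pihat n \<omega>)))
       \<or>
       \<comment> \<open>continuous response, without network covariates\<close>
       (is_continuous_cond_cdf g w \<rho> smp Ytil F \<and>
        predicts_without_network SX g w \<rho> smp Yhat \<and> fitted_cdf plain Fhat \<and>
        mean_dist_smallo smp (\<lambda>n k l \<omega>. Fhat n \<omega> (resp g (smp n) k l \<omega>) (Yhat n k l \<omega>))
                             (\<lambda>n k l \<omega>. F n (resp g (smp n) k l \<omega>) (Ytil n k l \<omega>)) (\<lambda>_. 1) \<and>
        ys = UNIV \<and> score = (\<lambda>n \<omega>. continuous_score (Fhat n \<omega>)))
       \<or>
       \<comment> \<open>continuous response, with network covariates\<close>
       (is_continuous_cond_cdf g w \<rho> smp Ytil F \<and>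
        network_statistic SX SE SC ecov w \<rho> smp zst \<and>
        predicts_with_network SX SC g w \<rho> smp Z Yhat \<and> fitted_cdf network Fhat \<and>
        mean_dist_smallo smp (\<lambda>n k l \<omega>. Fhat n \<omega> (resp g (smp n) k l \<omega>) (Yhat n k l \<omega>))
                             (\<lambda>n k l \<omega>. F n (resp g (smp n) k l \<omega>) (Ytil n k l \<omega>)) \<rho> \<and>
        ys = UNIV \<and> score = (\<lambda>n \<omega>. continuous_score (Fhat n \<omega>)))"
    and kl: "pair_seq k l"
  shows "\<exists>R :: nat \<Rightarrow> 'a \<Rightarrow> real.
      (\<forall>n. R n \<in> borel_measurable (pspace (smp n))) \<and>
      (\<forall>n \<omega>. 0 \<le> R n \<omega>) \<and>
      (\<forall>\<epsilon>>0. ((\<lambda>n. measure (pspace (smp n)) {\<omega> \<in> space (pspace (smp n)). R n \<omega> > \<epsilon>})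
                \<longlongrightarrow> 0) even_top) \<and>
      (\<forall>n. even n \<and> 4 \<le> n \<longrightarrow>
        (AE \<omega> in given_missing w (\<rho> n) (smp n) (k n) (l n).
          cprob_missing w (\<rho> n) (smp n) (Ytil n (k n) (l n)) (k n) (l n)
            {\<omega> \<in> space (pspace (smp n)).
               resp g (smp n) (k n) (l n) \<omega> \<in>
                 C_weighted ys \<alpha> n (\<lambda>i j. obs w (\<rho> n) (smp n) i j \<omega>) (\<lambda>i j. phat n i j \<omega>)
                   (score n \<omega>) (\<lambda>i j. resp g (smp n) i j \<omega>) (\<lambda>i j. Yhat n i j \<omega>) (k n) (l n)} \<omega>
          \<ge> 1 - \<alpha> - R n \<omega>))"
proof -
  obtain c0 where c0: "0 < c0" "\<And>u v. u \<in> {0..1} \<Longrightarrow> v \<in> {0..1} \<Longrightarrow> c0 \<le> w u v"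
    "\<And>n i j. i \<in> {1..n} \<Longrightarrow> j \<in> {1..n} \<Longrightarrow> AE \<omega> in pspace (smp n). phat n i j \<omega> / \<rho> n \<ge> c0"
    using a by blast
  \<comment> \<open>Hypothesis \<open>a\<close> provides one lower constant for both w and
    \<open>phat\<close>; the upper bound on w comes from the model.\<close>
  obtain C0 where C0: "\<And>u v. u \<in> {0..1} \<Longrightarrow> v \<in> {0..1} \<Longrightarrow> w u v < C0"
    using model by (fastforce simp: dyadic_model_def)
  interpret model_array SX SZ D V g w \<rho> smp phat c0 C0
    using model c0 less_imp_le[OF C0] phat_measurable b c by unfold_locales auto
  have T_src: "Ytil n i j \<in> borel_measurable (src n A)"
    if "even n" and ij: "(i, j) \<in> dyads (D2 n)" and A: "dyad_sources i j \<subseteq> A" for n i j A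
  proof -
    interpret S: sampled SX SZ D V n "smp n" by (rule sampled_smp)
    have "i \<in> {1..n}" "j \<in> {1..n}" using ij by (auto simp: dyads_def D2_def)
    moreover have "Node i \<in> A" "Node j \<in> A" using A by (auto simp: dyad_sources_def)
    ultimately show ?thesis
      using S.pair_function_src[OF h_measurable] Ytil[OF that(1) ij] by (subst measurable_cong) auto
  qed
  let ?T = "\<lambda>n. Ytil n (k n) (l n)"
  \<comment> \<open>The four settings become two, with A recording which sources the predictions may
    use: all but the coin of the dyad itself without network covariates, where the rate is o(1), and
    all of them otherwise, where it is o(\<rho>).\<close>
  have "\<exists>A G. adapted A G Yhat \<and>
      ((discrete_response g smp \<and> (\<alpha> < 1 / 2 \<or> no_fair_coin g smp Ytil) \<and> is_pi g w \<rho> smp Ytil pip \<and>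
        fitted_pi smp G pihat \<and>
        rate_ok A (\<lambda>n k l \<omega>. pihat n \<omega> 1 (Yhat n k l \<omega>)) (\<lambda>n k l \<omega>. pip n 1 (Ytil n k l \<omega>)) \<and>
        ys = {0, 1} \<and> score = (\<lambda>n \<omega>. discrete_score \<alpha> (pihat n \<omega>))) \<or>
       (is_continuous_cond_cdf g w \<rho> smp Ytil F \<and> fitted_cdf G Fhat \<and>
        rate_ok A (\<lambda>n k l \<omega>. Fhat n \<omega> (resp g (smp n) k l \<omega>) (Yhat n k l \<omega>))
          (\<lambda>n k l \<omega>. F n (resp g (smp n) k l \<omega>) (Ytil n k l \<omega>)) \<and>
        ys = UNIV \<and> score = (\<lambda>n \<omega>. continuous_score (Fhat n \<omega>))))"
    using cases
  proof (elim disjE, goal_cases)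
    case 1
    then show ?case
      using adapted_plain[of Yhat, folded plain_def] unfolding rate_ok_def
      by (intro exI[of _ "\<lambda>n i j. sources n - {Eta i j}"] exI[of _ plain]) blast
  next
    case 2
    then show ?case
      using adapted_network[of SE SC ecov zst Yhat, folded network_def Z_def] unfolding rate_ok_def
      by (intro exI[of _ "\<lambda>n i j. sources n"] exI[of _ network]) blast
  next
    case 3
    then show ?case
      using adapted_plain[of Yhat, folded plain_def] unfolding rate_ok_def
      by (intro exI[of _ "\<lambda>n i j. sources n - {Eta i j}"] exI[of _ plain]) blast
  next
    case 4
    then show ?case
      using adapted_network[of SE SC ecov zst Yhat, folded network_def Z_def] unfolding rate_ok_def
      by (intro exI[of _ "\<lambda>n i j. sources n"] exI[of _ network]) blast
  qed
  then obtain A G where "adapted A G Yhat" and setting: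
      "(discrete_response g smp \<and> (\<alpha> < 1 / 2 \<or> no_fair_coin g smp Ytil) \<and> is_pi g w \<rho> smp Ytil pip \<and>
        fitted_pi smp G pihat \<and>
        rate_ok A (\<lambda>n k l \<omega>. pihat n \<omega> 1 (Yhat n k l \<omega>)) (\<lambda>n k l \<omega>. pip n 1 (Ytil n k l \<omega>)) \<and>
        ys = {0, 1} \<and> score = (\<lambda>n \<omega>. discrete_score \<alpha> (pihat n \<omega>))) \<or>
       (is_continuous_cond_cdf g w \<rho> smp Ytil F \<and> fitted_cdf G Fhat \<and>
        rate_ok A (\<lambda>n k l \<omega>. Fhat n \<omega> (resp g (smp n) k l \<omega>) (Yhat n k l \<omega>))
          (\<lambda>n k l \<omega>. F n (resp g (smp n) k l \<omega>) (Ytil n k l \<omega>)) \<and>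
        ys = UNIV \<and> score = (\<lambda>n \<omega>. continuous_score (Fhat n \<omega>)))"
    by blast
  have "asymptotic_coverage \<alpha> ?T k l (coverage_event ys \<alpha> score Yhat k l)"
    using setting
  proof (elim disjE conjE)
    assume "discrete_response g smp" "is_pi g w \<rho> smp Ytil pip" "fitted_pi smp G pihat"
      "rate_ok A (\<lambda>n k l \<omega>. pihat n \<omega> 1 (Yhat n k l \<omega>)) (\<lambda>n k l \<omega>. pip n 1 (Ytil n k l \<omega>))"
      "ys = {0, 1}" "score = (\<lambda>n \<omega>. discrete_score \<alpha> (pihat n \<omega>))" and "\<alpha> < 1 / 2"
    then show ?thesis
      using discrete_coverage[OF kl alpha h_measurable Ytil Ytil_measurable T_src] \<open>adapted A G Yhat\<close> by simp
  next
    assume "discrete_response g smp" "is_pi g w \<rho> smp Ytil pip" "fitted_pi smp G pihat"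
      "rate_ok A (\<lambda>n k l \<omega>. pihat n \<omega> 1 (Yhat n k l \<omega>)) (\<lambda>n k l \<omega>. pip n 1 (Ytil n k l \<omega>))"
      "ys = {0, 1}" "score = (\<lambda>n \<omega>. discrete_score \<alpha> (pihat n \<omega>))" and "no_fair_coin g smp Ytil"
    then show ?thesis
      using discrete_coverage[OF kl alpha h_measurable Ytil Ytil_measurable T_src] \<open>adapted A G Yhat\<close> by simp
  next
    assume "is_continuous_cond_cdf g w \<rho> smp Ytil F" "fitted_cdf G Fhat"
      "rate_ok A (\<lambda>n k l \<omega>. Fhat n \<omega> (resp g (smp n) k l \<omega>) (Yhat n k l \<omega>))
          (\<lambda>n k l \<omega>. F n (resp g (smp n) k l \<omega>) (Ytil n k l \<omega>))"
      "ys = UNIV" "score = (\<lambda>n \<omega>. continuous_score (Fhat n \<omega>))"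
    then show ?thesis
      using continuous_coverage[OF kl alpha Ytil_measurable T_src] \<open>adapted A G Yhat\<close> by simp
  qed
  then show ?thesis unfolding asymptotic_coverage_def coverage_event_def .
qed

end
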